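(* Let $q>1$ be the discriminant of a real quadratic field $\mathbb{Q}(\sqrt q)$, let $\chi$ be the even primitive real Dirichlet character modulo $q$ attached to this field, and suppose that $\chi(2)=1$. Then $$h\left(\mathbb{Q}(\sqrt q)\right)\le \frac{\sqrt q}{2}\left(1-\frac{1}{25\log q}\right),$$ where $h(\mathbb{Q}(\sqrt q))$ is the class number of $\mathbb{Q}(\sqrt q)$.
   Context: The character attached to the real quadratic field of discriminant $q$ is the Kronecker symbol $\chi(n)=\left(\frac{q}{n}\right)$; $\log$ is the natural logarithm. *)

theory Defs
  imports "HOL-Number_Theory.Number_Theory" "HOL-Algebra.Ideal"
    "HOL-Computational_Algebra.Polynomial"
begin

definition quadratic_field :: "int \<Rightarrow> real set" where
  "quadratic_field q = {x + y * sqrt (of_int q) | x y. x \<in> \<rat> \<and> y \<in> \<rat>}"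

definition quadratic_integers :: "int \<Rightarrow> real ring" where
  "quadratic_integers q =
     \<lparr>carrier = {z \<in> quadratic_field q. algebraic_int z},
      mult = (*), one = 1, zero = 0, add = (+)\<rparr>"

text \<open>The nontrivial automorphism of \<open>\<rat>(\<surd>q)\<close>. The description is unique only when
  \<open>z\<close> lies in the field and \<open>\<surd>q\<close> is irrational; it is used only in that case.\<close>

definition quadratic_conj :: "int \<Rightarrow> real \<Rightarrow> real" where
  "quadratic_conj q z =
     (THE w. \<exists>x y. x \<in> \<rat> \<and> y \<in> \<rat> \<and>
        z = x + y * sqrt (of_int q) \<and> w = x - y * sqrt (of_int q))"

definition integral_basis :: "int \<Rightarrow> real \<Rightarrow> real \<Rightarrow> bool" where
  "integral_basis q v w \<longleftrightarrow>
     v \<in> carrier (quadratic_integers q) \<and> w \<in> carrier (quadratic_integers q) \<and>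
     (\<forall>z \<in> carrier (quadratic_integers q).
        \<exists>!c :: int \<times> int. z = of_int (fst c) * v + of_int (snd c) * w)"

text \<open>\<open>\<rat>(\<surd>q)\<close> is a real quadratic field and its discriminant, the squared determinant of the
  two embeddings applied to an integral basis, is \<open>q\<close> itself. The value does not depend on the
  basis.\<close>

definition real_quadratic_discriminant :: "int \<Rightarrow> bool" where
  "real_quadratic_discriminant q \<longleftrightarrow>
     q > 1 \<and> sqrt (of_int q) \<notin> \<rat> \<and>
     (\<exists>v w. integral_basis q v w \<and>
        of_int q = (v * quadratic_conj q w - quadratic_conj q v * w)\<^sup>2)"

text \<open>The Kronecker symbol \<open>(a / n)\<close>. Prime factors in \<open>int\<close> are normalised to be positive, so the
  sign of \<open>n\<close> contributes its own factor \<open>(a / -1)\<close>.\<close>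

definition kronecker_prime :: "int \<Rightarrow> int \<Rightarrow> int" where
  "kronecker_prime a p =
     (if p = 2 then (if even a then 0 else if a mod 8 \<in> {1, 7} then 1 else - 1)
      else Legendre a p)"

definition kronecker :: "int \<Rightarrow> int \<Rightarrow> int" where
  "kronecker a n =
     (if n = 0 then (if \<bar>a\<bar> = 1 then 1 else 0)
      else (if n < 0 \<and> a < 0 then - 1 else 1) *
           (\<Prod>p \<in> prime_factors n. kronecker_prime a p ^ multiplicity p n))"

definition nonzero_ideals :: "('a, 'b) ring_scheme \<Rightarrow> 'a set set" where
  "nonzero_ideals R = {I. ideal I R \<and> I \<noteq> {\<zero>\<^bsub>R\<^esub>}}"

text \<open>Two nonzero ideals of a domain lie in the same class iff they agree up to a nonzero
  principal factor on either side, i.e. up to a principal fractional ideal. Every fractional ideal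
  is equivalent to an integral one, so the classes are those of the ideal class group.\<close>

definition ideal_class_rel :: "('a, 'b) ring_scheme \<Rightarrow> ('a set \<times> 'a set) set" where
  "ideal_class_rel R =
     {(I, J). I \<in> nonzero_ideals R \<and> J \<in> nonzero_ideals R \<and>
        (\<exists>a \<in> carrier R - {\<zero>\<^bsub>R\<^esub>}. \<exists>b \<in> carrier R - {\<zero>\<^bsub>R\<^esub>}.
           a <#\<^bsub>R\<^esub> I = b <#\<^bsub>R\<^esub> J)}"

text \<open>\<open>card\<close> of an infinite set is \<open>0\<close>, but rings of integers of number fields have only finitely
  many ideal classes.\<close>

definition class_number :: "('a, 'b) ring_scheme \<Rightarrow> nat" where
  "class_number R = card (nonzero_ideals R // ideal_class_rel R)"

end

theory Submission
  imports "HOL-Analysis.Henstock_Kurzweil_Integration" "HOL-Analysis.Harmonic_Numbers"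
    "HOL-Real_Asymp.Real_Asymp" "HOL-Computational_Algebra.Squarefree" Defs
begin

text \<open>
  Write \<open>q = 4 k + 1\<close> and \<open>\<omega> = (1 + \<surd>q) / 2\<close>. Every ideal class contains at least
  \<open>(2 ln E / \<surd>q) X - o(X)\<close> ideals of norm at most \<open>X\<close>, where \<open>E\<close> is any lower bound for the units
  above \<open>1\<close>: for an ideal \<open>K\<close> of the class and \<open>\<alpha>\<close> in its conjugate, \<open>(\<alpha> / N K) K\<close> is an integral
  ideal of norm \<open>\<bar>N \<alpha>\<bar> / N K\<close>, and the lattice points with \<open>1 < \<bar>\<alpha> / \<alpha>'\<bar> \<le> E\<^sup>2\<close> are pairwise
  non-associate, so they give distinct ideals.
  On the other hand the number of ideals of norm \<open>n\<close> is at most the sum of \<open>\<chi>(d)\<close> over \<open>d\<close> dividing \<open>n\<close>, whose mean value is \<open>L(1, \<chi>)\<close>. Hence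
  \<open>h ln E \<le> (\<surd>q / 2) L(1, \<chi>)\<close>.

  Since \<open>2\<close> splits, \<open>k\<close> is even, and this forces \<open>E = \<surd>q + \<surd>(q - 1)\<close>, about \<open>2 \<surd>q\<close>. By quadratic
  reciprocity \<open>\<chi>\<close> is the Jacobi symbol modulo \<open>q\<close>, so its Gauss sum has absolute value \<open>\<surd>q\<close>, and
  expanding the sum of \<open>\<chi>(x - y)\<close> over \<open>x, y < N\<close> in Gauss sums bounds it by \<open>N \<surd>q\<close>.
  Two summations by parts turn this into \<open>L(1, \<chi>) \<le> ln (2 \<surd>q / 5 + 1) + 1\<close>, which is below \<open>ln E - 3/100\<close>, while
  \<open>ln E \<le> (3/4) ln q\<close>.
\<close>

section \<open>The Jacobi symbol\<close>

text \<open>Both \<open>ln E\<close> and the bound for L(1, \<chi>) grow like (1/2) ln q, so the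
  theorem rests on constants: (2/5) e, about 1.09, against the factor 2 in E. A Polya-Vinogradov
  bound for the partial sums of \<chi> would lose a logarithm. The sum of \<chi>(x - y) over a
  square loses nothing: it depends only on differences, so its Fourier expansion has absolute
  squares as coefficients and Parseval evaluates their total exactly. Since \<chi> is even it is
  also twice the second summatory function of \<chi>, which is what two summations by parts call
  for.

  The class number formula is replaced by two one-sided counts, a lower bound for each class and an
  upper bound for all ideals. Hence ideals are handled as normal-form triples, with inequalities
  from the Chinese remainder theorem in place of factorisation into primes. L(1, \<chi>) itself
  never occurs: the series is cut at \<open>D\<close>, the norm bound X tends to infinity with
  \<open>D\<close> fixed, and only then does \<open>D\<close> grow.\<close>

lemma Legendre_cong:
  assumes "[a = b] (mod p)"
  shows "Legendre a p = Legendre b p"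
  using assms by (simp add: Legendre_def QuadRes_def cong_def)

lemma Legendre_eq_0_iff: "Legendre a p = 0 \<longleftrightarrow> p dvd a"
  by (simp add: Legendre_def cong_0_iff)

lemma Legendre_cases: "Legendre a p = -1 \<or> Legendre a p = 0 \<or> Legendre a p = 1"
  by (simp add: Legendre_def)

lemma euler_criterion_int:
  fixes p :: int
  assumes "prime p" "2 < p"
  shows "[Legendre a p = a ^ (nat ((p - 1) div 2))] (mod p)"
proof -
  have "nat ((p - 1) div 2) = (nat p - 1) div 2" using assms by linarith
  thus ?thesis using euler_criterion[of "nat p" a] assms by (simp add: prime_nat_iff_prime)
qed

lemma cong_sign_imp_eq:
  fixes a b p :: int
  assumes "2 < p" "[a = b] (mod p)" "a \<in> {-1,0,1}" "b \<in> {-1,0,1}"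
  shows "a = b"
proof -
  have "p dvd a - b" using assms(2) by (simp add: cong_iff_dvd_diff)
  moreover have "\<bar>a - b\<bar> < p" using assms by auto
  ultimately show ?thesis using dvd_imp_le_int[of "a - b" p] assms(1) by fastforce
qed

lemma Legendre_mult:
  fixes p :: int
  assumes "prime p" "2 < p"
  shows "Legendre (a * b) p = Legendre a p * Legendre b p"
proof (rule cong_sign_imp_eq[OF assms(2)])
  let ?e = "nat ((p - 1) div 2)"
  have 1: "[Legendre a p * Legendre b p = a ^ ?e * b ^ ?e] (mod p)"
    using assms by (intro cong_mult euler_criterion_int)
  have 2: "[Legendre (a * b) p = a ^ ?e * b ^ ?e] (mod p)"
    using euler_criterion_int[OF assms, of "a * b"] by (simp only: power_mult_distrib)
  show "[Legendre (a * b) p = Legendre a p * Legendre b p] (mod p)"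
    using cong_trans[OF 2 cong_sym[OF 1]] .
  show "Legendre (a * b) p \<in> {-1, 0, 1}"
    using Legendre_cases[of "a * b" p] by blast
  show "Legendre a p * Legendre b p \<in> {-1, 0, 1}"
    using Legendre_cases[of a p] Legendre_cases[of b p] by fastforce
qed

text \<open>On odd positive numbers this is the character (-4 / n) = (-1)^((n - 1) / 2), which
  carries the signs of quadratic reciprocity.\<close>

definition sign4 :: "int \<Rightarrow> int" where
  "sign4 n = (if n mod 4 = 3 then -1 else 1)"

lemma sign4_mult:
  assumes "odd a" "odd b"
  shows "sign4 (a * b) = sign4 a * sign4 b"
proof -
  have "a mod 4 = 1 \<or> a mod 4 = 3" "b mod 4 = 1 \<or> b mod 4 = 3"
    using assms by presburger+
  moreover have "(a * b) mod 4 = ((a mod 4) * (b mod 4)) mod 4" by (simp add: mod_mult_eq)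
  ultimately show ?thesis by (auto simp: sign4_def)
qed

lemma sign4_power:
  assumes "p mod 4 = 1 \<or> p mod 4 = 3" "p > 0"
  shows "(-1) ^ (nat ((p - 1) div 2)) = sign4 p"
proof (cases "p mod 4 = 3")
  case True
  have "odd ((p - 1) div 2)" using True by presburger
  moreover have "(p - 1) div 2 \<ge> 0" using assms(2) by simp
  ultimately have "odd (nat ((p - 1) div 2))" by (simp add: even_nat_iff)
  thus ?thesis using True by (simp add: sign4_def)
next
  case False
  hence "even ((p - 1) div 2)" using assms(1) by presburger
  moreover have "(p - 1) div 2 \<ge> 0" using assms(2) by simp
  ultimately have "even (nat ((p - 1) div 2))" by (simp add: even_nat_iff)
  thus ?thesis using False by (simp add: sign4_def)
qed

lemma Legendre_minus_one:
  fixes p :: int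
  assumes "prime p" "2 < p"
  shows "Legendre (-1) p = sign4 p"
proof (rule cong_sign_imp_eq[OF assms(2)])
  have "odd p" using assms prime_odd_int by blast
  hence "p mod 4 = 1 \<or> p mod 4 = 3" by presburger
  thus "[Legendre (- 1) p = sign4 p] (mod p)"
    using euler_criterion_int[OF assms, of "-1"] sign4_power[of p] assms by simp
qed (use Legendre_cases[of "-1" p] in \<open>auto simp: sign4_def\<close>)

text \<open>The symmetric sign is written as a function of \<open>p\<close> switched on by
  \<open>l\<close>, so that for fixed \<open>l\<close> its product over the primes \<open>p\<close>
  dividing \<open>q\<close> collapses to \<open>sign4 q\<close>.\<close>

lemma Legendre_reciprocity:
  fixes p l :: int
  assumes "prime p" "2 < p" "prime l" "2 < l" "p \<noteq> l"
  shows "Legendre l p = Legendre p l * (if l mod 4 = 3 then sign4 p else 1)"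
proof -
  have op: "odd p" and ol: "odd l" using assms prime_odd_int by blast+
  have p4: "p mod 4 = 1 \<or> p mod 4 = 3" and l4: "l mod 4 = 1 \<or> l mod 4 = 3"
    using op ol by presburger+
  have "Legendre p l * Legendre l p = (-1) ^ (nat ((p - 1) div 2 * ((l - 1) div 2)))"
    using assms by (intro Quadratic_Reciprocity_int) (auto simp: prime_nat_iff_prime)
  also have "\<dots> = ((-1) ^ (nat ((p - 1) div 2))) ^ (nat ((l - 1) div 2))"
    using assms by (simp add: nat_mult_distrib power_mult)
  also have "\<dots> = sign4 p ^ (nat ((l - 1) div 2))" using sign4_power[OF p4] assms by simp
  also have "\<dots> = (if l mod 4 = 3 then sign4 p else 1)"
    using sign4_power[OF l4] assms l4 by (auto simp: sign4_def split: if_splits)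
  finally have eq: "Legendre p l * Legendre l p = (if l mod 4 = 3 then sign4 p else 1)" .
  have "Legendre p l * Legendre p l = 1"
  proof -
    have "\<not> l dvd p" using assms primes_dvd_imp_eq by metis
    thus ?thesis using Legendre_cases[of p l] Legendre_eq_0_iff[of p l] by auto
  qed
  hence "Legendre l p = Legendre p l * (Legendre p l * Legendre l p)"
    by (simp flip: mult.assoc)
  thus ?thesis unfolding eq .
qed

text \<open>Otherwise squaring would map the finite set of nonzero residues onto itself and so be
  injective, yet 1 and p - 1 have the same square.\<close>

lemma exists_nonresidue:
  fixes p :: int
  assumes "prime p" "2 < p"
  shows "\<exists>a. Legendre a p = -1"
proof (rule ccontr)
  assume *: "\<not> ?thesis"
  let ?S = "{1..p-1}" and ?f = "\<lambda>y::int. y^2 mod p"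
  have "?S \<subseteq> ?f ` ?S"
  proof
    fix a assume a: "a \<in> ?S"
    have "\<not> p dvd a" using a zdvd_not_zless[of a p] by auto
    hence "QuadRes p a" using * Legendre_eq_0_iff[of a p] by (auto simp: Legendre_def split: if_splits)
    then obtain y where y: "[y^2 = a] (mod p)" by (auto simp: QuadRes_def)
    have 1: "(y mod p)^2 mod p = a"
      using y a by (simp add: cong_def power_mod)
    have "y mod p \<noteq> 0" using 1 a by auto
    moreover have "0 \<le> y mod p" "y mod p < p" using assms by auto
    ultimately have "y mod p \<in> ?S" by auto
    thus "a \<in> ?f ` ?S" using 1 by force
  qed
  hence "card (?f ` ?S) \<ge> card ?S" by (intro card_mono) auto
  moreover have "card (?f ` ?S) \<le> card ?S" by (intro card_image_le) auto
  ultimately have "inj_on ?f ?S" by (intro eq_card_imp_inj_on) auto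
  moreover have "?f 1 = ?f (p - 1)"
  proof -
    have "(p - 1)^2 = 1 + p * (p - 2)" by (simp add: power2_eq_square algebra_simps)
    thus ?thesis by simp
  qed
  ultimately have "1 = p - 1" using assms by (auto dest!: inj_onD[of ?f ?S 1 "p - 1"])
  thus False using assms by simp
qed

text \<open>For squarefree odd \<open>q\<close> this is the Jacobi symbol \<open>(n / q)\<close>.\<close>

definition jacobi :: "int \<Rightarrow> int \<Rightarrow> int" where
  "jacobi q n = (\<Prod>p\<in>prime_factors q. Legendre n p)"

lemma jacobi_mult:
  assumes "odd q"
  shows "jacobi q (a * b) = jacobi q a * jacobi q b"
proof -
  have "2 < p" if "p \<in> prime_factors q" for p
  proof -
    have "prime p" "p dvd q" using that by (auto simp: in_prime_factors_imp_prime)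
    hence "p \<ge> 2" "p \<noteq> 2" using assms prime_ge_2_int by auto
    thus ?thesis by simp
  qed
  thus ?thesis unfolding jacobi_def prod.distrib[symmetric]
    by (intro prod.cong refl Legendre_mult) auto
qed

lemma jacobi_cong:
  assumes "[a = b] (mod q)"
  shows "jacobi q a = jacobi q b"
  unfolding jacobi_def
proof (intro prod.cong refl Legendre_cong)
  fix p assume "p \<in> prime_factors q"
  thus "[a = b] (mod p)" using cong_dvd_modulus[OF assms] by auto
qed

lemma jacobi_mod: "jacobi q (a mod q) = jacobi q a"
  by (rule jacobi_cong) (simp add: cong_def)

lemma jacobi_1: "jacobi q 1 = 1"
proof -
  have "Legendre 1 p = 1" if "p \<in> prime_factors q" for p
    using in_prime_factors_imp_prime[OF that]
    by (auto simp: Legendre_def QuadRes_def cong_0_iff intro: exI[of _ 1])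
  thus ?thesis by (simp add: jacobi_def)
qed

lemma jacobi_cases: "jacobi q n \<in> {-1, 0, 1}"
proof -
  have "(\<Prod>p\<in>A. Legendre n p) \<in> {-1, 0, 1}" if "finite A" for A
    using that 
  proof (induction A)
    case (insert p A)
    thus ?case using Legendre_cases[of n p] by auto
  qed auto
  thus ?thesis by (simp add: jacobi_def)
qed

lemma not_coprime_imp_common_prime:
  fixes q n :: int
  assumes "q \<noteq> 0" "\<not> coprime n q"
  shows "\<exists>p. prime p \<and> p dvd q \<and> p dvd n"
proof -
  have "\<not> is_unit (gcd n q)" using assms(2) by (simp add: coprime_iff_gcd_eq_1)
  then obtain p where "prime p" "p dvd gcd n q"
    using assms by (metis gcd_eq_0_iff prime_divisor_exists)
  thus ?thesis by auto
qed

lemma jacobi_eq_0_iff: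
  assumes "q \<noteq> 0"
  shows "jacobi q n = 0 \<longleftrightarrow> \<not> coprime n q"
proof -
  have "jacobi q n = 0 \<longleftrightarrow> (\<exists>p. prime p \<and> p dvd q \<and> p dvd n)"
    using assms by (auto simp: jacobi_def Legendre_eq_0_iff prime_factors_dvd)
  also have "\<dots> \<longleftrightarrow> \<not> coprime n q"
  proof
    assume "\<exists>p. prime p \<and> p dvd q \<and> p dvd n"
    thus "\<not> coprime n q" by (metis coprime_common_divisor not_prime_unit)
  next
    assume "\<not> coprime n q"
    thus "\<exists>p. prime p \<and> p dvd q \<and> p dvd n"
      using not_coprime_imp_common_prime assms by blast
  qed
  finally show ?thesis .
qed

lemma prod_prime_factors_squarefree:
  fixes q :: int
  assumes "squarefree q" "q > 0"
  shows "\<Prod>(prime_factors q) = q"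
proof -
  have "q = (\<Prod>p\<in>prime_factors q. p ^ multiplicity p q)"
    using assms prime_factorization_int[of q] by (simp add: prod_prime_factors)
  also have "\<dots> = (\<Prod>p\<in>prime_factors q. p)"
  proof (rule prod.cong[OF refl])
    fix p assume "p \<in> prime_factors q"
    thus "p ^ multiplicity p q = p"
      using assms squarefree_factorial_semiring'[of q] by simp
  qed
  finally show ?thesis by simp
qed

lemma prime_factor_odd:
  fixes q p :: int
  assumes "odd q" "p \<in> prime_factors q"
  shows "prime p" "2 < p" "odd p" "p dvd q"
proof -
  show p: "prime p" and d: "p dvd q" using assms by (auto simp: in_prime_factors_imp_prime)
  show "odd p" using d assms(1) by (meson dvd_trans)
  thus "2 < p" using prime_ge_2_int[OF p] by (cases "p = 2") auto
qed

lemma prod_sign4_prime_factors: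
  fixes q :: int
  assumes "odd q" "squarefree q" "q > 0"
  shows "(\<Prod>p\<in>prime_factors q. sign4 p) = sign4 q"
proof -
  have "odd (\<Prod>A) \<and> (\<Prod>p\<in>A. sign4 p) = sign4 (\<Prod>A)"
    if "finite A" "A \<subseteq> prime_factors q" for A
    using that
  proof (induction A)
    case (insert p A)
    have "odd p" using prime_factor_odd(3)[OF assms(1)] insert.prems by blast
    moreover have "odd (\<Prod>A) \<and> (\<Prod>p\<in>A. sign4 p) = sign4 (\<Prod>A)" using insert by blast
    ultimately show ?case using insert.hyps by (simp add: sign4_mult)
  qed (simp add: sign4_def)
  from this[of "prime_factors q"] show ?thesis
    using prod_prime_factors_squarefree[OF assms(2,3)] by simp
qed

text \<open>An odd discriminant is squarefree and 1 modulo 4, and \<chi>(2) = 1 sharpens this to 1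
  modulo 8. The field itself does not appear, so the character and its sums can be treated by
  arithmetic modulo \<open>q\<close> alone.\<close>

locale jacobi_modulus =
  fixes q :: int
  assumes squarefree_q: "squarefree q" and q_mod_8: "q mod 8 = 1" and q_gt_1: "q > 1"
begin

lemma odd_q: "odd q"
  using q_mod_8 by presburger

lemma sign4_q: "sign4 q = 1"
proof -
  have "q mod 4 = 1" using q_mod_8 by presburger
  thus ?thesis by (simp add: sign4_def)
qed

abbreviation \<psi> :: "int \<Rightarrow> int" where "\<psi> \<equiv> jacobi q"

lemma psi_mult: "\<psi> (a * b) = \<psi> a * \<psi> b"
  by (rule jacobi_mult[OF odd_q])

lemma psi_minus_one: "\<psi> (-1) = 1"
proof -
  have "\<psi> (-1) = (\<Prod>p\<in>prime_factors q. sign4 p)"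
    unfolding jacobi_def
    by (intro prod.cong refl Legendre_minus_one) (use prime_factor_odd[OF odd_q] in auto)
  thus ?thesis using prod_sign4_prime_factors[OF odd_q squarefree_q] sign4_q q_gt_1 by simp
qed

lemma psi_minus: "\<psi> (- n) = \<psi> n"
  using psi_mult[of "-1" n] psi_minus_one by simp

lemma psi_eq_0_iff: "\<psi> n = 0 \<longleftrightarrow> \<not> coprime n q"
  using jacobi_eq_0_iff[of q n] q_gt_1 by simp

lemma psi_0: "\<psi> 0 = 0"
  using q_gt_1 by (simp add: psi_eq_0_iff)

lemma psi_power: "\<psi> (a ^ n) = \<psi> a ^ n"
  by (induction n) (simp_all add: jacobi_1 psi_mult)

text \<open>The reciprocity signs multiply to \<open>sign4 q\<close> = 1. The lemma links the two
  faces of the character: periodic modulo \<open>q\<close> on the left, deciding how odd primes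
  split on the right.\<close>

lemma psi_odd_prime:
  assumes "prime l" "odd l"
  shows "\<psi> l = Legendre q l"
proof (cases "l dvd q")
  case True
  hence "\<not> coprime l q" using assms(1) by (metis coprime_absorb_left not_prime_unit)
  thus ?thesis using True psi_eq_0_iff Legendre_eq_0_iff by metis
next
  case False
  have l2: "2 < l" using prime_ge_2_int[OF assms(1)] assms(2) by (cases "l = 2") auto
  have Leg: "(\<Prod>p\<in>A. Legendre p l) = Legendre (\<Prod>A) l" if "finite A" for A
    using that by (induction A)
      (use assms l2 in \<open>auto simp: Legendre_mult Legendre_def[of 1] QuadRes_def cong_0_iff intro: exI[of _ 1]\<close>)
  have "\<psi> l = (\<Prod>p\<in>prime_factors q. Legendre p l * (if l mod 4 = 3 then sign4 p else 1))"
    unfolding jacobi_def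
    by (intro prod.cong refl Legendre_reciprocity)
       (use prime_factor_odd[OF odd_q] assms l2 False in auto)
  also have "\<dots> = (\<Prod>p\<in>prime_factors q. Legendre p l)
      * (if l mod 4 = 3 then (\<Prod>p\<in>prime_factors q. sign4 p) else 1)"
    by (auto simp: prod.distrib)
  also have "\<dots> = Legendre q l"
    using prod_sign4_prime_factors[OF odd_q squarefree_q] sign4_q q_gt_1 Leg
      prod_prime_factors_squarefree[OF squarefree_q] by auto
  finally show ?thesis .
qed

lemma psi_eq_1:
  assumes "m > 0" "odd m" "\<And>l. prime l \<Longrightarrow> l dvd m \<Longrightarrow> \<psi> l = 1"
  shows "\<psi> m = 1"
proof -
  have "\<psi> m = (\<Prod>p\<in>prime_factors m. \<psi> (p ^ multiplicity p m))"
  proof -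
    have "\<psi> (\<Prod>p\<in>A. p ^ multiplicity p m) = (\<Prod>p\<in>A. \<psi> (p ^ multiplicity p m))" if "finite A" for A
      using that by (induction A) (auto simp: jacobi_1 psi_mult)
    from this[of "prime_factors m"] show ?thesis
      using assms(1) prod_prime_factors[of m] by simp
  qed
  also have "\<dots> = 1"
  proof (intro prod.neutral ballI)
    fix p assume "p \<in> prime_factors m"
    hence "prime p" "p dvd m" by (auto simp: in_prime_factors_imp_prime)
    thus "\<psi> (p ^ multiplicity p m) = 1" using assms(3) by (simp add: psi_power)
  qed
  finally show ?thesis .
qed

text \<open>The supplementary law is obtained from reciprocity for odd primes: for a suitable odd \<open>t\<close>
  coprime to \<open>q\<close>, the number \<open>(q - t\<^sup>2) / 8\<close> is odd, and \<open>q\<close> is a square modulo each of its prime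
  factors.\<close>

lemma psi_2: "\<psi> 2 = 1"
proof -
  obtain t m :: int where t: "coprime t q" "odd m" "q - t^2 = 8 * m"
  proof (cases "q mod 16 = 1")
    case True
    define j where "j = q div 16"
    have j: "q = 16 * j + 1" using True unfolding j_def by presburger
    \<comment> \<open>For (q - t^2) / 8 to be odd, t^2 must be 9 modulo 16. The choice t = 3 could
      share a factor with \<open>q\<close>; t = q - 4 is -3 modulo 16 and can share only a divisor
      of 4 with the odd \<open>q\<close>.\<close>
    have 1: "coprime (q - 4) q"
    proof (rule coprimeI)
      fix c assume c: "c dvd q - 4" "c dvd q"
      have "c dvd q - (q - 4)" using c dvd_diff by blast
      hence "c dvd 4" by simp
      moreover have "coprime 4 q" using odd_q by (metis coprime_mult_left_iff coprime_left_2_iff_odd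
          mult_2_right numeral_Bit0 one_add_one mult.commute numeral_times_numeral semiring_norm(12,13))
      ultimately show "is_unit c" using c(2) coprime_common_divisor by blast
    qed
    have "q - (q - 4)^2 = 8 * (- 32 * j * j + 14 * j - 1)"
      using j by (simp add: power2_eq_square algebra_simps)
    moreover have "odd (- 32 * j * j + 14 * j - 1)" by simp
    ultimately show ?thesis using that 1 by blast
  next
    case False
    define j where "j = q div 16"
    have j: "q = 16 * j + 9" using False q_mod_8 unfolding j_def by presburger
    show ?thesis by (rule that[of 1 "2 * j + 1"]) (use j in auto)
  qed
  have m0: "m \<noteq> 0" using t by auto
  \<comment> \<open>\<open>m\<close> is negative in the first case, so the factorisation argument is
    applied to its absolute value and transferred by evenness.\<close>
  have "\<psi> \<bar>m\<bar> = 1"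
  proof (rule psi_eq_1)
    fix l :: int assume l: "prime l" "l dvd \<bar>m\<bar>"
    have "odd l" using l t(2) by (meson dvd_abs_iff dvd_trans)
    have ld: "l dvd q - t^2" using t(3) l(2) by simp
    have "\<not> l dvd q"
    proof
      assume lq: "l dvd q"
      hence "l dvd t^2" using ld by (metis dvd_diff_right_iff dvd_diff_commute)
      hence "l dvd t" using l(1) prime_dvd_power by blast
      thus False using lq t(1) l(1) by (metis coprime_common_divisor not_prime_unit)
    qed
    moreover have "[t^2 = q] (mod l)"
      using ld by (simp add: cong_iff_dvd_diff dvd_diff_commute)
    ultimately have "Legendre q l = 1"
      unfolding Legendre_def QuadRes_def by (auto simp: cong_0_iff)
    thus "\<psi> l = 1" using psi_odd_prime l(1) \<open>odd l\<close> by simp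
  qed (use m0 t in auto)
  hence m1: "\<psi> m = 1" using psi_minus[of m] by (auto simp: abs_if split: if_splits)
  \<comment> \<open>Read modulo \<open>q\<close>, the equation q - t^2 = 8 m determines the cube of
    \<open>\<psi> 2\<close>, and a cube fixes a value among -1, 0, 1.\<close>
  have "\<psi> (8 * m) = \<psi> (- (t^2))"
  proof (rule jacobi_cong)
    have "8 * m - - (t^2) = q" using t(3) by simp
    thus "[8 * m = - (t^2)] (mod q)" by (simp only: cong_iff_dvd_diff dvd_refl)
  qed
  also have "\<dots> = (\<psi> t)^2" by (simp add: psi_minus psi_power)
  also have "\<dots> = 1"
    using t(1) psi_eq_0_iff[of t] jacobi_cases[of q t] by auto
  finally have "\<psi> (2^3 * m) = 1" by simp
  hence "\<psi> 2 ^ 3 = 1" using m1 by (simp only: psi_mult psi_power)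
  thus ?thesis using jacobi_cases[of q 2] by auto
qed

text \<open>Primitivity in the form needed for Gauss sums. With \<open>p\<close> dividing
  \<open>q\<close> and \<open>n\<close>, take \<open>u\<close> a nonresidue modulo \<open>p\<close>
  and 1 modulo q / p: the symbol sees only the nonresidue, while u - 1 is killed by the factor
  \<open>p\<close> of \<open>n\<close>.\<close>

lemma psi_primitive:
  assumes "\<not> coprime n q"
  shows "\<exists>u. coprime u q \<and> \<psi> u = -1 \<and> [u * n = n] (mod q)"
proof -
  obtain p where p: "prime p" "p dvd q" "p dvd n"
    using assms q_gt_1 not_coprime_imp_common_prime[of q n] by (auto simp: coprime_commute)
  have p': "p \<in> prime_factors q" using p q_gt_1 by (auto simp: prime_factors_dvd)
  have "2 < p" using prime_factor_odd[OF odd_q p'] by simp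
  then obtain a where a: "Legendre a p = -1" using exists_nonresidue p by blast
  obtain d where d: "q = p * d" using p by blast
  have "coprime p d"
  proof (rule ccontr)
    assume "\<not> coprime p d"
    hence "p dvd d" using p prime_imp_coprime by blast
    hence "p^2 dvd q" using d by (auto simp: power2_eq_square)
    thus False using squarefree_q p by (auto simp: squarefree_def)
  qed
  then obtain u where u: "[u = a] (mod p)" "[u = 1] (mod d)"
    using binary_chinese_remainder_int by blast
  have "\<psi> u = Legendre u p * (\<Prod>l\<in>prime_factors q - {p}. Legendre u l)"
    unfolding jacobi_def using p' by (subst prod.remove[of _ p]) auto
  also have "(\<Prod>l\<in>prime_factors q - {p}. Legendre u l) = (\<Prod>l\<in>prime_factors q - {p}. 1)"
  proof (intro prod.cong refl)
    fix l assume l: "l \<in> prime_factors q - {p}"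
    hence pl: "prime l" "l dvd q" by (auto simp: in_prime_factors_imp_prime)
    hence "l dvd d" using d l p(1) by (metis DiffD2 prime_dvd_mult_iff primes_dvd_imp_eq singletonI)
    hence "Legendre u l = Legendre 1 l" using u by (intro Legendre_cong) (auto intro: cong_dvd_modulus)
    also have "\<dots> = 1" using pl by (auto simp: Legendre_def QuadRes_def cong_0_iff intro: exI[of _ 1])
    finally show "Legendre u l = 1" .
  qed
  finally have "\<psi> u = -1" using a Legendre_cong[OF u(1)] by simp
  moreover have "[u * n = n] (mod q)"
  proof -
    have "d dvd u - 1" using u by (simp add: cong_iff_dvd_diff)
    hence "d * p dvd (u - 1) * n" using p(3) mult_dvd_mono by blast
    thus ?thesis using d by (simp add: cong_iff_dvd_diff algebra_simps)
  qed
  moreover have "coprime u q" using psi_eq_0_iff[of u] \<open>\<psi> u = -1\<close> by force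
  ultimately show ?thesis by blast
qed

end

section \<open>Gauss sums\<close>

context jacobi_modulus
begin

definition unity_root :: "int \<Rightarrow> complex" where
  "unity_root a = cis (2 * pi * of_int a / of_int q)"

lemma unity_root_add: "unity_root (a + b) = unity_root a * unity_root b"
  by (simp add: unity_root_def cis_mult add_divide_distrib distrib_left)

lemma unity_root_0: "unity_root 0 = 1"
  by (simp add: unity_root_def)

lemma cnj_unity_root: "cnj (unity_root a) = unity_root (- a)"
  by (simp add: unity_root_def cis_cnj)

lemma unity_root_mult_nat: "unity_root (a * int n) = unity_root a ^ n"
  by (induction n) (simp_all add: unity_root_0 unity_root_add distrib_left)

lemma unity_root_modulus: "unity_root (q * a) = 1"
proof -
  have "unity_root (q * a) = cis (2 * pi * of_int a)"
    using q_gt_1 by (simp add: unity_root_def mult.assoc)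
  also have "\<dots> = 1" by (rule cis_multiple_2pi) simp
  finally show ?thesis .
qed

lemma unity_root_cong:
  assumes "[a = b] (mod q)"
  shows "unity_root a = unity_root b"
proof -
  obtain c where "a = b + q * c" using assms by (metis cong_iff_lin cong_sym)
  thus ?thesis by (simp add: unity_root_add unity_root_modulus)
qed

lemma unity_root_eq_1: "unity_root a = 1 \<longleftrightarrow> q dvd a"
proof
  assume "unity_root a = 1"
  hence "cos (2 * pi * of_int a / of_int q) = 1"
    by (metis unity_root_def cis.simps(1) one_complex.simps(1))
  then obtain n :: int where "2 * pi * of_int a / of_int q = of_int n * 2 * pi"
    using cos_one_2pi_int by blast
  hence "of_int a = (of_int (n * q) :: real)" using q_gt_1 by (simp add: field_simps)
  hence "a = n * q" by (simp only: of_int_eq_iff)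
  thus "q dvd a" by simp
next
  assume "q dvd a"
  thus "unity_root a = 1" using unity_root_modulus by (auto elim: dvdE)
qed

lemma residues_eq_image: "{0..<q} = int ` {..<nat q}"
proof -
  have "x \<in> int ` {..<nat q}" if "x \<in> {0..<q}" for x
    by (rule image_eqI[of _ _ "nat x"]) (use that in auto)
  thus ?thesis by auto
qed

lemma sum_unity_root: "(\<Sum>n<nat q. unity_root (a * int n)) = (if q dvd a then of_int q else 0)"
proof (cases "q dvd a")
  case True
  hence "unity_root a = 1" by (simp add: unity_root_eq_1)
  thus ?thesis using True q_gt_1 by (simp add: unity_root_mult_nat)
next
  case False
  have "unity_root a ^ nat q = 1"
    using unity_root_mult_nat[of a "nat q"] unity_root_modulus[of a] q_gt_1
    by (simp add: mult.commute)
  thus ?thesis using False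
    by (simp add: unity_root_mult_nat geometric_sum unity_root_eq_1)
qed

lemma sum_unity_root_int: "(\<Sum>n\<in>{0..<q}. unity_root (a * n)) = (if q dvd a then of_int q else 0)"
  unfolding residues_eq_image by (subst sum.reindex) (simp_all add: sum_unity_root)

definition gauss_sum :: "int \<Rightarrow> complex" where
  "gauss_sum n = (\<Sum>a\<in>{0..<q}. of_int (\<psi> a) * unity_root (a * n))"

lemma gauss_sum_cong: "[m = n] (mod q) \<Longrightarrow> gauss_sum m = gauss_sum n"
  unfolding gauss_sum_def by (intro sum.cong refl arg_cong2[of _ _ _ _ "(*)"] unity_root_cong cong_mult) auto

lemma gauss_sum_mult:
  assumes "coprime u q"
  shows "gauss_sum (u * n) = of_int (\<psi> u) * gauss_sum n"
proof -
  let ?f = "\<lambda>a. (a * u) mod q"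
  have inj: "inj_on ?f {0..<q}"
  proof (rule inj_onI)
    fix a b assume *: "a \<in> {0..<q}" "b \<in> {0..<q}" "?f a = ?f b"
    hence "[a * u = b * u] (mod q)" by (simp add: cong_def)
    hence "[a = b] (mod q)" using assms cong_mult_rcancel by blast
    thus "a = b" using * by (simp add: cong_def)
  qed
  have "?f ` {0..<q} \<subseteq> {0..<q}" using q_gt_1 by auto
  hence im: "?f ` {0..<q} = {0..<q}" using inj by (intro endo_inj_surj) auto
  have "\<psi> u * \<psi> u = 1" using assms psi_eq_0_iff[of u] jacobi_cases[of q u] by auto
  hence psi: "\<psi> a = \<psi> u * \<psi> (?f a)" for a
    by (simp add: jacobi_mod psi_mult mult.left_commute)
  have "gauss_sum (u * n) = (\<Sum>a\<in>{0..<q}. of_int (\<psi> u) * (of_int (\<psi> (?f a)) * unity_root (?f a * n)))"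
    unfolding gauss_sum_def
  proof (intro sum.cong refl)
    fix a
    have "[a * (u * n) = ?f a * n] (mod q)" by (simp add: cong_def mod_mult_left_eq mult.assoc)
    hence "unity_root (a * (u * n)) = unity_root (?f a * n)" by (rule unity_root_cong)
    thus "of_int (\<psi> a) * unity_root (a * (u * n)) =
        of_int (\<psi> u) * (of_int (\<psi> (?f a)) * unity_root (?f a * n))"
      by (subst psi) simp
  qed
  also have "\<dots> = of_int (\<psi> u) * (\<Sum>a\<in>?f ` {0..<q}. of_int (\<psi> a) * unity_root (a * n))"
    by (simp add: sum.reindex[OF inj] sum_distrib_left)
  finally show ?thesis unfolding im gauss_sum_def .
qed

text \<open>For \<open>n\<close> not coprime to \<open>q\<close>, the twist by the \<open>u\<close>
  of \<open>psi_primitive\<close> both fixes and negates the sum, so it vanishes together with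
  \<open>\<psi> n\<close>.\<close>

lemma gauss_sum_eq: "gauss_sum n = of_int (\<psi> n) * gauss_sum 1"
proof (cases "coprime n q")
  case True
  thus ?thesis using gauss_sum_mult[of n 1] by simp
next
  case False
  then obtain u where u: "coprime u q" "\<psi> u = -1" "[u * n = n] (mod q)"
    using psi_primitive by blast
  have "gauss_sum n = - gauss_sum n"
    using gauss_sum_mult[OF u(1), of n] gauss_sum_cong[OF u(3)] u(2) by simp
  hence "gauss_sum n = 0" by simp
  moreover have "\<psi> n = 0" using False psi_eq_0_iff by simp
  ultimately show ?thesis by simp
qed

text \<open>The sum of |G(n)|^2 over all residues is computed twice, by orthogonality of the roots
  of unity and by \<open>gauss_sum_eq\<close>. Both results contain the same sum of squares of the
  symbol, which is nonzero because of the term at 1 and cancels.\<close>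

lemma norm_gauss_sum: "norm (gauss_sum 1) = sqrt (of_int q)"
proof -
  let ?R = "{0..<q}" and ?S = "\<Sum>a\<in>{0..<q}. (\<psi> a)^2"
  have "(\<Sum>n\<in>?R. gauss_sum n * cnj (gauss_sum n)) =
     (\<Sum>n\<in>?R. \<Sum>a\<in>?R. \<Sum>b\<in>?R. of_int (\<psi> a) * of_int (\<psi> b) * unity_root ((a - b) * n))"
    unfolding gauss_sum_def cnj_sum sum_product
    by (intro sum.cong refl) (simp add: cnj_unity_root left_diff_distrib unity_root_add[of "_" "- _", simplified])
  also have "\<dots> = (\<Sum>a\<in>?R. \<Sum>n\<in>?R. \<Sum>b\<in>?R. of_int (\<psi> a) * of_int (\<psi> b) * unity_root ((a - b) * n))"
    by (rule sum.swap)
  also have "\<dots> = (\<Sum>a\<in>?R. \<Sum>b\<in>?R. \<Sum>n\<in>?R. of_int (\<psi> a) * of_int (\<psi> b) * unity_root ((a - b) * n))"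
    by (intro sum.cong refl sum.swap)
  also have "\<dots> = (\<Sum>a\<in>?R. \<Sum>b\<in>?R. if a = b then of_int (\<psi> a) * of_int (\<psi> b) * of_int q else 0)"
  proof (intro sum.cong refl)
    fix a b assume ab: "a \<in> ?R" "b \<in> ?R"
    have "q dvd a - b \<longleftrightarrow> a = b"
    proof
      assume "q dvd a - b"
      hence "a mod q = b mod q" by (simp add: mod_eq_dvd_iff)
      thus "a = b" using ab by simp
    qed simp
    thus "(\<Sum>n\<in>?R. of_int (\<psi> a) * of_int (\<psi> b) * unity_root ((a - b) * n)) =
        (if a = b then of_int (\<psi> a) * of_int (\<psi> b) * of_int q else 0)"
      by (simp add: sum_unity_root_int flip: sum_distrib_left)
  qed
  also have "\<dots> = of_int q * of_int ?S"
    by (simp add: sum_distrib_left power2_eq_square mult_ac)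
  finally have 1: "(\<Sum>n\<in>?R. gauss_sum n * cnj (gauss_sum n)) = of_int q * of_int ?S" .
  have "(\<Sum>n\<in>?R. gauss_sum n * cnj (gauss_sum n)) = (\<Sum>n\<in>?R. of_int ((\<psi> n)^2) * (gauss_sum 1 * cnj (gauss_sum 1)))"
    by (intro sum.cong refl, subst (1 2) gauss_sum_eq) (simp add: power2_eq_square)
  also have "\<dots> = of_int ?S * (gauss_sum 1 * cnj (gauss_sum 1))"
    by (simp add: sum_distrib_right)
  finally have 2: "(\<Sum>n\<in>?R. gauss_sum n * cnj (gauss_sum n)) =
      of_int ?S * (gauss_sum 1 * cnj (gauss_sum 1))" .
  have "of_int ?S * (gauss_sum 1 * cnj (gauss_sum 1)) = of_int q * of_int ?S"
    unfolding 2[symmetric] by (rule 1)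
  moreover have "(of_int ?S :: complex) \<noteq> 0"
  proof -
    have "(\<psi> 1)^2 \<le> ?S" using q_gt_1 by (intro member_le_sum) auto
    hence "?S \<noteq> 0" by (simp add: jacobi_1)
    thus ?thesis by (metis of_int_eq_0_iff)
  qed
  ultimately have "gauss_sum 1 * cnj (gauss_sum 1) = of_int q"
    by (metis mult.commute mult_left_cancel)
  hence "complex_of_real ((norm (gauss_sum 1))\<^sup>2) = complex_of_real (of_int q)"
    by (simp only: complex_norm_square of_real_of_int_eq)
  hence "(norm (gauss_sum 1))\<^sup>2 = of_int q" by (simp only: of_real_eq_iff)
  thus ?thesis by (metis norm_ge_zero real_sqrt_unique)
qed

text \<open>An unnormalised Fejer mean of the character. It equals twice the second summatory
  function (\<open>psi_sum2_eq\<close>) but is diagonalised by the additive characters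
  (\<open>gauss_sum_psi_form\<close>).\<close>

definition psi_form :: "nat \<Rightarrow> int" where
  "psi_form N = (\<Sum>x<N. \<Sum>y<N. \<psi> (int x - int y))"

lemma gauss_sum_psi_form:
  "gauss_sum 1 * of_int (psi_form N) =
     (\<Sum>a\<in>{0..<q}. of_int (\<psi> a) * of_real ((norm (\<Sum>x<N. unity_root (a * int x)))\<^sup>2))"
proof -
  have "gauss_sum 1 * of_int (psi_form N) = (\<Sum>x<N. \<Sum>y<N. gauss_sum (int x - int y))"
    unfolding psi_form_def of_int_sum sum_distrib_left
    by (intro sum.cong refl, subst (2) gauss_sum_eq) simp
  also have "\<dots> = (\<Sum>x<N. \<Sum>a\<in>{0..<q}. \<Sum>y<N. of_int (\<psi> a) * unity_root (a * (int x - int y)))"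
    unfolding gauss_sum_def by (intro sum.cong refl sum.swap)
  also have "\<dots> = (\<Sum>a\<in>{0..<q}. \<Sum>x<N. \<Sum>y<N. of_int (\<psi> a) * unity_root (a * (int x - int y)))"
    by (rule sum.swap)
  also have "\<dots> = (\<Sum>a\<in>{0..<q}. of_int (\<psi> a) * ((\<Sum>x<N. unity_root (a * int x)) * cnj (\<Sum>x<N. unity_root (a * int x))))"
  proof (rule sum.cong[OF refl])
    fix a
    have "(\<Sum>x<N. \<Sum>y<N. of_int (\<psi> a) * unity_root (a * (int x - int y))) =
        (\<Sum>x<N. \<Sum>y<N. of_int (\<psi> a) * (unity_root (a * int x) * cnj (unity_root (a * int y))))"
      by (simp add: cnj_unity_root right_diff_distrib unity_root_add[of "_" "- _", simplified])
    also have "\<dots> = of_int (\<psi> a) * ((\<Sum>x<N. unity_root (a * int x)) * cnj (\<Sum>x<N. unity_root (a * int x)))"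
      by (simp only: cnj_sum sum_product, simp only: sum_distrib_left)
    finally show "(\<Sum>x<N. \<Sum>y<N. of_int (\<psi> a) * unity_root (a * (int x - int y))) =
      of_int (\<psi> a) * ((\<Sum>x<N. unity_root (a * int x)) * cnj (\<Sum>x<N. unity_root (a * int x)))" .
  qed
  finally show ?thesis by (simp only: complex_norm_square)
qed

text \<open>In the Fourier expansion the frequency 0 has weight \<open>\<psi> 0\<close> = 0, and at
  every other frequency \<open>q\<close> further terms add a full period of roots of unity, whose
  sum is 0.\<close>

lemma psi_form_periodic: "psi_form (N + nat q) = psi_form N"
proof -
  have "gauss_sum 1 \<noteq> 0" using norm_gauss_sum q_gt_1 by auto
  moreover have "gauss_sum 1 * of_int (psi_form (N + nat q)) = gauss_sum 1 * of_int (psi_form N)"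
    unfolding gauss_sum_psi_form
  proof (intro sum.cong refl)
    fix a assume a: "a \<in> {0..<q}"
    show "of_int (\<psi> a) * complex_of_real ((norm (\<Sum>x<N + nat q. unity_root (a * int x)))\<^sup>2) =
      of_int (\<psi> a) * of_real ((norm (\<Sum>x<N. unity_root (a * int x)))\<^sup>2)"
    proof (cases "a = 0")
      case False
      hence "\<not> q dvd a" using a zdvd_not_zless[of a q] by auto
      have "(\<Sum>x<N + nat q. unity_root (a * int x)) = (\<Sum>x<N. unity_root (a * int x))
          + (\<Sum>x<nat q. unity_root (a * int N) * unity_root (a * int x))"
      proof -
        have "(\<Sum>x<N + m. unity_root (a * int x)) = (\<Sum>x<N. unity_root (a * int x))
          + (\<Sum>x<m. unity_root (a * int N) * unity_root (a * int x))" for m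
          by (induction m) (simp_all add: unity_root_add distrib_left)
        thus ?thesis .
      qed
      also have "\<dots> = (\<Sum>x<N. unity_root (a * int x))"
        using \<open>\<not> q dvd a\<close> by (simp add: sum_unity_root flip: sum_distrib_left)
      finally show ?thesis by simp
    qed (simp add: psi_0)
  qed
  ultimately have "(of_int (psi_form (N + nat q)) :: complex) = of_int (psi_form N)" by simp
  thus ?thesis by (simp only: of_int_eq_iff)
qed

text \<open>The absolute squares add up to q N, and dividing by the Gauss sum of size sqrt q leaves
  sqrt q N. The restriction on \<open>N\<close> makes distinct x, y below \<open>N\<close>
  incongruent modulo \<open>q\<close>, so that only the diagonal survives in Parseval's
  identity.\<close>

lemma psi_form_le_small:
  assumes "N \<le> nat q"
  shows "of_int (psi_form N) \<le> sqrt (of_int q) * real N"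
proof -
  let ?E = "\<lambda>a. \<Sum>x<N. unity_root (a * int x)"
  have "complex_of_real (\<Sum>a\<in>{0..<q}. (norm (?E a))\<^sup>2) = (\<Sum>a\<in>{0..<q}. ?E a * cnj (?E a))"
    by (simp only: of_real_sum complex_norm_square)
  also have "\<dots> = (\<Sum>a\<in>{0..<q}. \<Sum>x<N. \<Sum>y<N. unity_root ((int x - int y) * a))"
    unfolding cnj_sum sum_product
    by (intro sum.cong refl)
       (simp add: cnj_unity_root left_diff_distrib right_diff_distrib mult.commute unity_root_add[of "_" "- _", simplified])
  also have "\<dots> = (\<Sum>x<N. \<Sum>a\<in>{0..<q}. \<Sum>y<N. unity_root ((int x - int y) * a))"
    by (rule sum.swap)
  also have "\<dots> = (\<Sum>x<N. \<Sum>y<N. \<Sum>a\<in>{0..<q}. unity_root ((int x - int y) * a))"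
    by (intro sum.cong refl sum.swap)
  also have "\<dots> = (\<Sum>x<N. \<Sum>y<N. if x = y then of_int q else 0)"
  proof (intro sum.cong refl)
    fix x y assume xy: "x \<in> {..<N}" "y \<in> {..<N}"
    have "q dvd int x - int y \<longleftrightarrow> x = y"
    proof
      assume "q dvd int x - int y"
      hence "int x mod q = int y mod q" by (simp add: mod_eq_dvd_iff)
      thus "x = y" using xy assms by simp
    qed simp
    thus "(\<Sum>a\<in>{0..<q}. unity_root ((int x - int y) * a)) = (if x = y then of_int q else 0)"
      by (simp add: sum_unity_root_int)
  qed
  also have "\<dots> = complex_of_real (of_int q * real N)" by simp
  finally have parseval: "(\<Sum>a\<in>{0..<q}. (norm (?E a))\<^sup>2) = of_int q * real N"
    by (simp only: of_real_eq_iff)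
  have "sqrt (of_int q) * \<bar>of_int (psi_form N)\<bar> = norm (gauss_sum 1 * of_int (psi_form N))"
    by (simp add: norm_mult norm_gauss_sum)
  also have "\<dots> \<le> (\<Sum>a\<in>{0..<q}. norm (of_int (\<psi> a) * complex_of_real ((norm (?E a))\<^sup>2)))"
    unfolding gauss_sum_psi_form by (rule norm_sum)
  also have "\<dots> \<le> (\<Sum>a\<in>{0..<q}. (norm (?E a))\<^sup>2)"
  proof (rule sum_mono)
    fix a
    have "norm (of_int (\<psi> a) :: complex) \<le> 1" using jacobi_cases[of q a] by auto
    hence "norm (of_int (\<psi> a) :: complex) * (norm (?E a))\<^sup>2 \<le> 1 * (norm (?E a))\<^sup>2"
      by (rule mult_right_mono) simp
    thus "norm (of_int (\<psi> a) * complex_of_real ((norm (?E a))\<^sup>2)) \<le> (norm (?E a))\<^sup>2"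
      by (simp add: norm_mult norm_power)
  qed
  also have "\<dots> = sqrt (of_int q) * (sqrt (of_int q) * real N)"
    using parseval q_gt_1 by simp
  finally have "\<bar>of_int (psi_form N)\<bar> \<le> sqrt (of_int q) * real N"
    using q_gt_1 by simp
  thus ?thesis by linarith
qed

lemma psi_form_le: "of_int (psi_form N) \<le> sqrt (of_int q) * real N"
proof (induction N rule: less_induct)
  case (less N)
  show ?case
  proof (cases "N \<le> nat q")
    case False
    define M where "M = N - nat q"
    have N: "N = M + nat q" and "M < N" using False q_gt_1 by (auto simp: M_def)
    have "of_int (psi_form N) \<le> sqrt (of_int q) * real M"
      using less[OF \<open>M < N\<close>] by (simp add: N psi_form_periodic)
    also have "\<dots> \<le> sqrt (of_int q) * real N"
      using \<open>M < N\<close> q_gt_1 by (intro mult_left_mono) auto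
    finally show ?thesis .
  qed (rule psi_form_le_small)
qed

end

section \<open>The series \<open>L(1, \<chi>)\<close>\<close>

context jacobi_modulus
begin

definition psi_sum :: "nat \<Rightarrow> int" where
  "psi_sum n = (\<Sum>k=1..n. \<psi> (int k))"

definition psi_sum2 :: "nat \<Rightarrow> int" where
  "psi_sum2 n = (\<Sum>m=1..n. psi_sum m)"

text \<open>The new row and the new column agree because the character is even, and the new diagonal
  entry is \<open>\<psi> 0\<close> = 0.\<close>

lemma psi_form_Suc: "psi_form (Suc N) = psi_form N + 2 * psi_sum N"
proof -
  have "(\<Sum>y<N. \<psi> (int N - int y)) = psi_sum N"
    unfolding psi_sum_def
    by (rule sum.reindex_bij_witness[of _ "\<lambda>k. N - k" "\<lambda>k. N - k"]) (auto simp: of_nat_diff)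
  moreover have "(\<Sum>x<N. \<psi> (int x - int N)) = (\<Sum>y<N. \<psi> (int N - int y))"
    by (intro sum.cong refl) (metis minus_diff_eq psi_minus)
  ultimately show ?thesis
    by (simp add: psi_form_def sum.distrib psi_0)
qed

lemma psi_sum2_eq: "2 * psi_sum2 N = psi_form (Suc N)"
  by (induction N) (simp_all add: psi_form_Suc psi_sum2_def psi_sum_def, simp add: psi_form_def)

lemma psi_sum2_le: "2 * of_int (psi_sum2 N) \<le> sqrt (of_int q) * (real N + 1)"
  using psi_form_le[of "Suc N"] by (simp add: algebra_simps flip: psi_sum2_eq)

lemma abs_psi_sum_le_self: "\<bar>psi_sum n\<bar> \<le> int n"
proof -
  have "\<bar>psi_sum n\<bar> \<le> (\<Sum>k=1..n. \<bar>\<psi> (int k)\<bar>)"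
    unfolding psi_sum_def by (rule sum_abs)
  also have "\<dots> \<le> (\<Sum>k=1..n. 1)"
  proof (rule sum_mono)
    fix k show "\<bar>\<psi> (int k)\<bar> \<le> 1" using jacobi_cases[of q "int k"] by auto
  qed
  finally show ?thesis by simp
qed

lemma psi_sum2_le_triangle: "2 * psi_sum2 n \<le> int n * (int n + 1)"
proof (induction n)
  case (Suc n)
  thus ?case using abs_psi_sum_le_self[of "Suc n"]
    by (simp add: psi_sum2_def algebra_simps)
qed (simp add: psi_sum2_def)

text \<open>\<open>psi_sum\<close> is half the increment of \<open>psi_form\<close> and inherits its
  period.\<close>

lemma psi_sum_periodic: "psi_sum (N + nat q) = psi_sum N"
  using psi_form_Suc[of "N + nat q"] psi_form_Suc[of N] psi_form_periodic[of "Suc N"]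
    psi_form_periodic[of N] by simp

lemma abs_psi_sum_le: "\<bar>psi_sum N\<bar> \<le> q"
proof (induction N rule: less_induct)
  case (less N)
  show ?case
  proof (cases "N \<le> nat q")
    case False
    define M where "M = N - nat q"
    have N: "N = M + nat q" and "M < N" using False q_gt_1 by (auto simp: M_def)
    thus ?thesis using less[of M] psi_sum_periodic[of M] by simp
  qed (use abs_psi_sum_le_self[of N] q_gt_1 in linarith)
qed

definition psi_log_sum :: "nat \<Rightarrow> real" where
  "psi_log_sum D = (\<Sum>d=1..D. of_int (\<psi> (int d)) / real d)"

text \<open>The weight 2 / (n (n + 1) (n + 2)) is the second difference of 1 / n. The two boundary
  terms vanish as \<open>D\<close> grows, since \<open>psi_sum\<close> is bounded and
  \<open>psi_sum2\<close> is bounded above linearly.\<close>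

lemma psi_log_sum_abel:
  "psi_log_sum D = (\<Sum>n=1..D. of_int (psi_sum2 n) * 2 / (real n * (real n + 1) * (real n + 2)))
     + of_int (psi_sum2 D) / ((real D + 1) * (real D + 2)) + of_int (psi_sum D) / (real D + 1)"
proof (induction D)
  case (Suc D)
  let ?s = "of_int (psi_sum (Suc D)) :: real" and ?t = "of_int (psi_sum2 (Suc D)) :: real"
  have t: "of_int (psi_sum2 D) = ?t - ?s" and s: "of_int (psi_sum D) = ?s - of_int (\<psi> (int (Suc D)))"
    by (simp_all add: psi_sum2_def psi_sum_def)
  have nz: "real D + 1 \<noteq> 0" "real D + 2 \<noteq> 0" "real D + 3 \<noteq> 0" by linarith+
  have "psi_log_sum (Suc D) = psi_log_sum D + of_int (\<psi> (int (Suc D))) / (real D + 1)"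
    by (simp add: psi_log_sum_def add.commute)
  also have "\<dots> = (\<Sum>n=1..D. of_int (psi_sum2 n) * 2 / (real n * (real n + 1) * (real n + 2)))
     + ((?t - ?s) / ((real D + 1) * (real D + 2)) + ?s / (real D + 1))"
    unfolding Suc.IH t s by (simp add: diff_divide_distrib)
  also have "(?t - ?s) / ((real D + 1) * (real D + 2)) + ?s / (real D + 1) =
     ?t * 2 / ((real D + 1) * (real D + 2) * (real D + 3)) + ?t / ((real D + 2) * (real D + 3)) + ?s / (real D + 2)"
    using nz by (simp add: divide_simps) (simp add: algebra_simps)
  finally show ?case by (simp add: add_ac)
qed (simp add: psi_log_sum_def psi_sum2_def psi_sum_def)

lemma sum_atLeast1_split:
  fixes f :: "nat \<Rightarrow> 'a :: comm_monoid_add"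
  assumes "M \<le> D"
  shows "(\<Sum>n=1..D. f n) = (\<Sum>n=1..M. f n) + (\<Sum>n=Suc M..D. f n)"
  using assms by (induction D rule: dec_induct) (simp_all add: add.assoc)

text \<open>By convexity 1 / (n + 2) is at most the integral of 1 / t over the unit interval centred
  at n + 2. The first interval starts at 5/2, the origin of that constant. Intervals ending at n + 2
  would give 2 instead, too weak for the final comparison at q = 17.\<close>

lemma sum_inverse_le_ln: "(\<Sum>n=1..M. 1 / (real n + 2)) \<le> ln ((real M + 5/2) / (5/2))"
proof (induction M)
  case (Suc M)
  have "1 / (real (Suc M) + 2) \<le> ln (real M + 7/2) - ln (real M + 5/2)"
    using ln_inverse_approx_ge[of "real M + 5/2" "real M + 7/2"] by (simp add: field_simps)
  moreover have "ln ((real M + 5/2) / (5/2)) = ln (real M + 5/2) - ln (5/2)"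
    by (subst ln_div) auto
  moreover have "ln ((real (Suc M) + 5/2) / (5/2)) = ln (real M + 7/2) - ln (5/2)"
    by (subst ln_div) (auto simp: algebra_simps)
  ultimately show ?case using Suc.IH by simp
qed simp

lemma sum_inverse_le_telescope:
  assumes "M \<le> D"
  shows "(\<Sum>n=Suc M..D. 1 / (real n * (real n + 2))) \<le> 1 / (real M + 1) - 1 / (real D + 1)"
  using assms
proof (induction D rule: dec_induct)
  case (step D)
  have "1 / (real (Suc D) * (real (Suc D) + 2)) \<le> 1 / (real (Suc D) * (real (Suc D) + 1))"
    by (intro divide_left_mono mult_left_mono mult_pos_pos) auto
  also have "\<dots> = 1 / (real D + 1) - 1 / (real (Suc D) + 1)"
    by (simp add: field_simps)
  finally show ?case using step by simp
qed simp

text \<open>Summation by parts twice; the trivial bound is used up to \<open>\<surd>q\<close>, the Gauss sum bound beyond.\<close>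

lemma psi_log_sum_le:
  assumes "sqrt (of_int q) \<le> real D"
  shows "psi_log_sum D \<le> ln ((sqrt (of_int q) + 5/2) / (5/2)) + 1 + 2 * of_int q / (real D + 1)"
proof -
  let ?r = "sqrt (of_int q)"
  define M where "M = nat \<lfloor>?r\<rfloor>"
  have r1: "1 < ?r" using q_gt_1 by simp
  have M: "real M \<le> ?r" "?r < real M + 1" unfolding M_def using r1 by linarith+
  have MD: "M \<le> D" using M assms by linarith
  let ?g = "\<lambda>n. of_int (psi_sum2 n) * 2 / (real n * (real n + 1) * (real n + 2))"
  have "(\<Sum>n=1..D. ?g n) = (\<Sum>n=1..M. ?g n) + (\<Sum>n=Suc M..D. ?g n)"
    by (rule sum_atLeast1_split[OF MD])
  also have "\<dots> \<le> (\<Sum>n=1..M. 1 / (real n + 2)) + (\<Sum>n=Suc M..D. ?r * (1 / (real n * (real n + 2))))"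
  proof (intro add_mono sum_mono)
    fix n assume n: "n \<in> {1..M}"
    have "of_int (2 * psi_sum2 n) \<le> (of_int (int n * (int n + 1)) :: real)"
      by (subst of_int_le_iff) (rule psi_sum2_le_triangle)
    hence "?g n \<le> (real n * (real n + 1)) / (real n * (real n + 1) * (real n + 2))"
      by (intro divide_right_mono) auto
    thus "?g n \<le> 1 / (real n + 2)" using n by simp
  next
    fix n assume n: "n \<in> {Suc M..D}"
    have "?g n \<le> (?r * (real n + 1)) / (real n * (real n + 1) * (real n + 2))"
      using psi_sum2_le[of n] by (intro divide_right_mono) (auto simp: mult.commute)
    also have "\<dots> = ?r * (1 / (real n * (real n + 2)))" using n by (simp add: divide_simps)
    finally show "?g n \<le> ?r * (1 / (real n * (real n + 2)))" .
  qed
  also have "(\<Sum>n=1..M. 1 / (real n + 2)) \<le> ln ((?r + 5/2) / (5/2))"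
  proof -
    have "ln ((real M + 5/2) / (5/2)) \<le> ln ((?r + 5/2) / (5/2))"
      using M by (subst ln_le_cancel_iff) auto
    thus ?thesis using sum_inverse_le_ln[of M] by linarith
  qed
  also have "(\<Sum>n=Suc M..D. ?r * (1 / (real n * (real n + 2)))) \<le> ?r * (1 / (real M + 1))"
  proof -
    have "(\<Sum>n=Suc M..D. 1 / (real n * (real n + 2))) \<le> 1 / (real M + 1)"
      using sum_inverse_le_telescope[OF MD] by (rule order_trans) simp
    thus ?thesis unfolding sum_distrib_left[symmetric] using r1 by (intro mult_left_mono) auto
  qed
  \<comment> \<open>The summand 1 of the estimate is this cost of the range beyond sqrt q.\<close>
  also have "?r * (1 / (real M + 1)) \<le> 1" using M by (simp add: field_simps)
  finally have 1: "(\<Sum>n=1..D. ?g n) \<le> ln ((?r + 5/2) / (5/2)) + 1" by simp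
  have "of_int (psi_sum2 D) / ((real D + 1) * (real D + 2)) \<le> (?r * (real D + 1)) / ((real D + 1) * (real D + 2))"
  proof (rule divide_right_mono)
    have "0 \<le> ?r * (real D + 1)" using r1 by simp
    thus "of_int (psi_sum2 D) \<le> ?r * (real D + 1)" using psi_sum2_le[of D] by linarith
  qed simp
  also have "\<dots> = ?r / (real D + 2)" by simp
  also have "\<dots> \<le> of_int q / (real D + 1)"
  proof (intro frac_le)
    have "?r * 1 \<le> ?r * ?r" using r1 by (intro mult_left_mono) auto
    thus "?r \<le> of_int q" using q_gt_1 by simp
  qed (use q_gt_1 in auto)
  finally have 2: "of_int (psi_sum2 D) / ((real D + 1) * (real D + 2)) \<le> of_int q / (real D + 1)" .
  have 3: "of_int (psi_sum D) / (real D + 1) \<le> of_int q / (real D + 1)"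
    using abs_psi_sum_le[of D] by (intro divide_right_mono) auto
  show ?thesis unfolding psi_log_sum_abel using 1 2 3 by simp
qed

section \<open>Mean value of the divisor sums of the character\<close>

lemma psi_div_sum_tail:
  assumes "1 \<le> D" "D \<le> Y"
  shows "(\<Sum>d=Suc D..Y. \<psi> (int d) * int (X div d)) \<le>
     psi_sum Y * int (X div Y) - psi_sum D * int (X div D) + q * (int (X div D) - int (X div Y))"
  using assms(2)
proof (induction Y rule: dec_induct)
  case (step Y)
  \<comment> \<open>Summation by parts: the quotients decrease in d and the partial sums are at most
    \<open>q\<close>, so the increments telescope and the tail costs O(q X / D) however long it
    is.\<close>
  have "X div Suc Y \<le> X div Y" using step assms(1) by (intro div_le_mono2) auto
  hence "psi_sum Y * (int (X div Y) - int (X div Suc Y)) \<le> q * (int (X div Y) - int (X div Suc Y))"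
    using abs_psi_sum_le[of Y] by (intro mult_right_mono) auto
  moreover have "psi_sum (Suc Y) = psi_sum Y + \<psi> (int (Suc Y))" by (simp add: psi_sum_def)
  ultimately show ?case using step by (simp add: algebra_simps)
qed simp

lemma card_multiples_upto:
  assumes "d > 0"
  shows "card {n \<in> {1..X}. d dvd n} = X div d"
proof -
  have "{n \<in> {1..X}. d dvd n} = (\<lambda>k. d * k) ` {1..X div d}"
  proof (intro equalityI subsetI)
    fix n assume n: "n \<in> {n \<in> {1..X}. d dvd n}"
    then obtain k where k: "n = d * k" by auto
    hence "k \<in> {1..X div d}" using n assms
      by (auto simp: less_eq_div_iff_mult_less_eq mult.commute Suc_le_eq)
    thus "n \<in> (\<lambda>k. d * k) ` {1..X div d}" using k by blast
  next
    fix n assume "n \<in> (\<lambda>k. d * k) ` {1..X div d}"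
    then obtain k where k: "k \<in> {1..X div d}" "n = d * k" by blast
    thus "n \<in> {n \<in> {1..X}. d dvd n}" using assms
      by (auto simp: less_eq_div_iff_mult_less_eq mult.commute Suc_le_eq)
  qed
  moreover have "inj_on (\<lambda>k. d * k) {1..X div d}" using assms by (auto simp: inj_on_def)
  ultimately show ?thesis by (simp add: card_image)
qed

text \<open>The coefficients of zeta(s) L(s, \<chi>), that is, of the Dedekind zeta function of the
  field. In \<open>card_ideal_codes_le\<close> they bound the number of ideals of norm
  \<open>n\<close>.\<close>

definition psi_divisor_sum :: "nat \<Rightarrow> int" where
  "psi_divisor_sum n = (\<Sum>d | d dvd n. \<psi> (int d))"

lemma sum_psi_divisor_sum: "(\<Sum>n=1..X. psi_divisor_sum n) = (\<Sum>d=1..X. \<psi> (int d) * int (X div d))"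
proof -
  have "(\<Sum>n=1..X. psi_divisor_sum n) = (\<Sum>n=1..X. \<Sum>d=1..X. if d dvd n then \<psi> (int d) else 0)"
  proof (intro sum.cong refl)
    fix n assume n: "n \<in> {1..X}"
    have "{d. d dvd n} = {d \<in> {1..X}. d dvd n}"
      using n by (auto dest: dvd_imp_le intro: Suc_leI dvd_pos_nat)
    thus "psi_divisor_sum n = (\<Sum>d=1..X. if d dvd n then \<psi> (int d) else 0)"
      unfolding psi_divisor_sum_def by (simp only: sum.inter_filter finite_atLeastAtMost)
  qed
  also have "\<dots> = (\<Sum>d=1..X. \<Sum>n=1..X. if d dvd n then \<psi> (int d) else 0)" by (rule sum.swap)
  also have "\<dots> = (\<Sum>d=1..X. \<psi> (int d) * int (X div d))"
  proof (intro sum.cong refl)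
    fix d assume d: "d \<in> {1..X}"
    have "(\<Sum>n=1..X. if d dvd n then \<psi> (int d) else 0) = (\<Sum>n\<in>{n\<in>{1..X}. d dvd n}. \<psi> (int d))"
      by (rule sum.inter_filter[symmetric]) simp
    thus "(\<Sum>n=1..X. if d dvd n then \<psi> (int d) else 0) = \<psi> (int d) * int (X div d)"
      using d card_multiples_upto[of d X] by simp
  qed
  finally show ?thesis .
qed

text \<open>Up to \<open>D\<close> each rounding of X / d costs at most 1; beyond \<open>D\<close>
  the summation by parts applies. \<open>D\<close> is left free because \<open>X\<close> tends to
  infinity before it, so no balance between the two errors has to be struck.\<close>

lemma sum_psi_divisor_sum_le:
  assumes "1 \<le> D" "D \<le> X"
  shows "of_int (\<Sum>n=1..X. psi_divisor_sum n) \<le>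
     real X * psi_log_sum D + real D + 2 * of_int q * (real X / real D)"
proof -
  have "(\<Sum>n=1..X. psi_divisor_sum n) =
      (\<Sum>d=1..D. \<psi> (int d) * int (X div d)) + (\<Sum>d=Suc D..X. \<psi> (int d) * int (X div d))"
    unfolding sum_psi_divisor_sum by (rule sum_atLeast1_split[OF assms(2)])
  hence eq: "of_int (\<Sum>n=1..X. psi_divisor_sum n) =
      (\<Sum>d=1..D. of_int (\<psi> (int d)) * real (X div d)) + of_int (\<Sum>d=Suc D..X. \<psi> (int d) * int (X div d))"
    by simp
  have "(\<Sum>d=1..D. of_int (\<psi> (int d)) * real (X div d)) \<le>
      (\<Sum>d=1..D. real X * (of_int (\<psi> (int d)) / real d) + 1)"
  proof (rule sum_mono)
    fix d assume d: "d \<in> {1..D}"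
    have 1: "real (X div d) \<le> real X / real d" by (rule of_nat_div_le_of_nat)
    have 2: "real X / real d \<le> real (X div d) + 1" using floor_divide_of_nat_eq[of X d, where ?'a=real] by linarith
    show "of_int (\<psi> (int d)) * real (X div d) \<le> real X * (of_int (\<psi> (int d)) / real d) + 1"
      using jacobi_cases[of q "int d"] 1 2 by auto
  qed
  also have "\<dots> = real X * psi_log_sum D + real D"
    by (simp add: sum.distrib psi_log_sum_def sum_distrib_left)
  finally have head: "(\<Sum>d=1..D. of_int (\<psi> (int d)) * real (X div d)) \<le> real X * psi_log_sum D + real D" .
  have "(\<Sum>d=Suc D..X. \<psi> (int d) * int (X div d)) \<le>
     psi_sum X * int (X div X) - psi_sum D * int (X div D) + q * (int (X div D) - int (X div X))"
    by (rule psi_div_sum_tail) (use assms in auto)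
  also have "\<dots> \<le> q * int (X div X) + q * int (X div D) + q * (int (X div D) - int (X div X))"
  proof -
    have "psi_sum X * int (X div X) \<le> q * int (X div X)"
      using abs_psi_sum_le[of X] by (intro mult_right_mono) auto
    moreover have "(- psi_sum D) * int (X div D) \<le> q * int (X div D)"
      using abs_psi_sum_le[of D] by (intro mult_right_mono) auto
    ultimately show ?thesis by simp
  qed
  also have "\<dots> = 2 * q * int (X div D)" by (simp add: algebra_simps)
  finally have "of_int (\<Sum>d=Suc D..X. \<psi> (int d) * int (X div d)) \<le> (of_int (2 * q * int (X div D)) :: real)"
    by (subst of_int_le_iff)
  also have "\<dots> = 2 * of_int q * real (X div D)" by simp
  also have "\<dots> \<le> 2 * of_int q * (real X / real D)"
    using q_gt_1 by (intro mult_left_mono of_nat_div_le_of_nat) auto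
  finally show ?thesis unfolding eq using head by linarith
qed

end

section \<open>Ideals of given norm\<close>

lemma coprime_split:
  fixes c m n :: nat
  assumes "coprime m n" "c dvd m * n"
  shows "c = gcd c m * gcd c n"
proof (rule dvd_antisym)
  obtain x y where xy: "c = x * y" "x dvd m" "y dvd n" using division_decomp[OF assms(2)] by blast
  thus "c dvd gcd c m * gcd c n" using mult_dvd_mono[of x "gcd c m" y "gcd c n"] by simp
  have "coprime (gcd c m) (gcd c n)" using assms(1)
    by (meson coprime_divisors gcd_dvd2)
  thus "gcd c m * gcd c n dvd c" by (intro divides_mult) auto
qed

context jacobi_modulus
begin

text \<open>b^2 + b - (q - 1) / 4 is the norm of b + \<omega>. A root modulo \<open>a\<close>
  amounts to a ring homomorphism \<omega> -> -b from the maximal order onto the integers modulo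
  \<open>a\<close>, so the roots count the primitive ideals of norm \<open>a\<close>.\<close>

definition roots_mod :: "int \<Rightarrow> int set" where
  "roots_mod a = {b \<in> {0..<a}. a dvd b^2 + b - (q - 1) div 4}"

lemma finite_roots_mod: "finite (roots_mod a)"
  unfolding roots_mod_def by (rule finite_subset[of _ "{0..<a}"]) auto

lemma four_times_norm_poly: "4 * (b^2 + b - (q - 1) div 4) = (2 * b + 1)^2 - q"
proof -
  have "4 * ((q - 1) div 4) = q - 1" using q_mod_8 by presburger
  thus ?thesis by (simp add: power2_eq_square algebra_simps)
qed

lemma root_imp_dvd:
  assumes "b \<in> roots_mod a" "d dvd a"
  shows "d dvd (2 * b + 1)^2 - q"
proof -
  have "d dvd b^2 + b - (q - 1) div 4" using assms dvd_trans by (auto simp: roots_mod_def)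
  hence "d dvd 4 * (b^2 + b - (q - 1) div 4)" by (rule dvd_mult)
  thus ?thesis unfolding four_times_norm_poly .
qed

text \<open>The inert primes: completing the square would make \<open>q\<close> a square modulo
  \<open>p\<close>. The prime 2, where squares would say nothing, is excluded by
  \<open>psi_2\<close>.\<close>

lemma roots_mod_eq_empty:
  assumes "prime p" "p dvd a" "\<psi> p = -1"
  shows "roots_mod a = {}"
proof (rule ccontr)
  assume "roots_mod a \<noteq> {}"
  then obtain b where "b \<in> roots_mod a" by blast
  hence "p dvd (2 * b + 1)^2 - q" using root_imp_dvd assms by blast
  hence "[(2 * b + 1)^2 = q] (mod p)" by (simp add: cong_iff_dvd_diff)
  hence "QuadRes p q" unfolding QuadRes_def by blast
  hence "Legendre q p \<noteq> -1" by (simp add: Legendre_def)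
  moreover have "odd p" using assms psi_2 primes_dvd_imp_eq[of 2 p] by auto
  ultimately show False using psi_odd_prime[OF assms(1)] assms(3) by simp
qed

text \<open>For two roots, p^k divides (b - b0) (b + b0 + 1). If \<open>p\<close> divided both
  factors it would divide their sum 2 b + 1, and with it \<open>q\<close>; so one factor takes all
  of p^k. The possible second root is the conjugate -1 - b0. This covers p = 2 as well.\<close>

lemma card_roots_mod_prime_power_le:
  assumes "prime p" "\<not> p dvd q"
  shows "card (roots_mod (p ^ k)) \<le> 2"
proof (cases "roots_mod (p ^ k) = {}")
  case False
  then obtain b0 where b0: "b0 \<in> roots_mod (p ^ k)" by blast
  have "b = b0 \<or> b = (- 1 - b0) mod p ^ k" if b: "b \<in> roots_mod (p ^ k)" for b
  proof -
    have "p ^ k dvd (b^2 + b - (q - 1) div 4) - (b0^2 + b0 - (q - 1) div 4)"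
      using b b0 unfolding roots_mod_def by (intro dvd_diff[of _ "_ - (q - 1) div 4"]) blast+
    also have "(b^2 + b - (q - 1) div 4) - (b0^2 + b0 - (q - 1) div 4) = (b - b0) * (b + b0 + 1)"
      by (simp add: power2_eq_square algebra_simps)
    finally have d: "p ^ k dvd (b - b0) * (b + b0 + 1)" .
    have "\<not> p dvd b - b0 \<or> \<not> p dvd b + b0 + 1 \<or> k = 0"
    proof (rule ccontr)
      assume "\<not> ?thesis"
      hence *: "p dvd b - b0" "p dvd b + b0 + 1" "k \<noteq> 0" by auto
      have "p dvd (b - b0) + (b + b0 + 1)" by (rule dvd_add[OF *(1,2)])
      also have "(b - b0) + (b + b0 + 1) = 2 * b + 1" by simp
      finally have "p dvd (2 * b + 1)^2" unfolding power2_eq_square by (rule dvd_mult)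
      moreover have "p dvd (2 * b + 1)^2 - q" using root_imp_dvd[OF b, of p] *(3) by simp
      ultimately have "p dvd (2 * b + 1)^2 - ((2 * b + 1)^2 - q)" by (rule dvd_diff)
      thus False using assms(2) by simp
    qed
    moreover have "b = b0" if "\<not> p dvd b + b0 + 1"
    proof -
      have "coprime (p ^ k) (b + b0 + 1)" using that assms(1) by (simp add: prime_imp_coprime)
      hence "p ^ k dvd b - b0" using d coprime_dvd_mult_left_iff by blast
      hence "b mod p ^ k = b0 mod p ^ k" by (simp add: mod_eq_dvd_iff)
      thus ?thesis using b b0 by (simp add: roots_mod_def)
    qed
    moreover have "b = (- 1 - b0) mod p ^ k" if "\<not> p dvd b - b0"
    proof -
      have "coprime (p ^ k) (b - b0)" using that assms(1) by (simp add: prime_imp_coprime)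
      hence "p ^ k dvd b + b0 + 1" using d coprime_dvd_mult_right_iff by blast
      hence "p ^ k dvd b - (- 1 - b0)" by (simp add: algebra_simps)
      hence "b mod p ^ k = (- 1 - b0) mod p ^ k" by (simp only: mod_eq_dvd_iff)
      thus ?thesis using b by (simp add: roots_mod_def)
    qed
    moreover have "b = b0" if "k = 0" using that b b0 by (auto simp: roots_mod_def)
    ultimately show ?thesis by blast
  qed
  hence "roots_mod (p ^ k) \<subseteq> {b0, (- 1 - b0) mod p ^ k}" by blast
  hence "card (roots_mod (p ^ k)) \<le> card {b0, (- 1 - b0) mod p ^ k}" by (intro card_mono) auto
  also have "\<dots> \<le> 2" by (simp add: card_insert_if)
  finally show ?thesis .
qed simp

lemma ramified_root:
  assumes "prime p" "p dvd q" "p dvd a" "b \<in> roots_mod a"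
  shows "p dvd 2 * b + 1"
proof -
  have "p dvd ((2 * b + 1)^2 - q) + q" using root_imp_dvd assms by (intro dvd_add) auto
  hence "p dvd (2 * b + 1)^2" by simp
  thus ?thesis by (rule prime_dvd_power[OF assms(1)])
qed

lemma card_roots_mod_ramified_le:
  assumes "prime p" "p dvd q"
  shows "card (roots_mod p) \<le> 1"
proof -
  have op: "odd p" using odd_q assms(2) by (meson dvd_trans)
  have "b = b'" if b: "b \<in> roots_mod p" "b' \<in> roots_mod p" for b b'
  proof -
    have "p dvd (2 * b + 1) - (2 * b' + 1)" using b assms by (intro dvd_diff ramified_root) auto
    hence "p dvd 2 * (b - b')" by (simp add: algebra_simps)
    hence "p dvd b - b'" using assms(1) op by (metis prime_dvd_mult_iff primes_dvd_imp_eq two_is_prime dvd_refl)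
    hence "b mod p = b' mod p" by (simp add: mod_eq_dvd_iff)
    thus ?thesis using b by (simp add: roots_mod_def)
  qed
  thus ?thesis using card_le_Suc0_iff_eq[OF finite_roots_mod, of p] by auto
qed

text \<open>The square of a ramified prime ideal is generated by \<open>p\<close>, so it is not
  primitive. In numbers: p^2 would divide both (2 b + 1)^2 and (2 b + 1)^2 - q, hence the squarefree
  \<open>q\<close>.\<close>

lemma roots_mod_ramified_eq_empty:
  assumes "prime p" "p dvd q" "p^2 dvd a"
  shows "roots_mod a = {}"
proof (rule ccontr)
  assume "roots_mod a \<noteq> {}"
  then obtain b where b: "b \<in> roots_mod a" by blast
  have "p dvd 2 * b + 1" using ramified_root b assms dvd_trans[of p "p^2" a] by fastforce
  hence "p^2 dvd (2 * b + 1)^2" by (simp add: dvd_power_same)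
  moreover have "p^2 dvd (2 * b + 1)^2 - q" using root_imp_dvd b assms by blast
  ultimately have "p^2 dvd (2 * b + 1)^2 - ((2 * b + 1)^2 - q)" by (rule dvd_diff)
  hence "p^2 dvd q" by simp
  thus False using squarefree_q assms(1) by (auto simp: squarefree_def)
qed

lemma card_roots_mod_prime_le:
  assumes "prime p"
  shows "int (card (roots_mod p)) \<le> 1 + \<psi> p"
proof -
  consider "\<psi> p = -1" | "\<psi> p = 0" | "\<psi> p = 1" using jacobi_cases[of q p] by auto
  thus ?thesis
  proof cases
    case 1
    thus ?thesis using roots_mod_eq_empty[of p p] assms by simp
  next
    case 2
    hence "p dvd q" using psi_eq_0_iff assms prime_imp_coprime by blast
    thus ?thesis using card_roots_mod_ramified_le assms 2 by simp
  next
    case 3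
    hence "\<not> p dvd q" using psi_eq_0_iff[of p] assms by (metis coprime_absorb_left not_prime_unit one_neq_zero)
    thus ?thesis using card_roots_mod_prime_power_le[of p 1] assms 3 by simp
  qed
qed

text \<open>The right-hand side is 2 for split and 0 for ramified or inert \<open>p\<close>. It is
  written as the increment of the geometric sum over two steps, as the induction in
  \<open>card_ideal_codes_prime_power_le\<close> requires.\<close>

lemma card_roots_mod_prime_power_le_psi:
  assumes "prime p"
  shows "int (card (roots_mod (p ^ (k + 2)))) \<le> \<psi> p ^ (k + 1) + \<psi> p ^ (k + 2)"
proof -
  consider "\<psi> p = -1" | "\<psi> p = 0" | "\<psi> p = 1" using jacobi_cases[of q p] by auto
  thus ?thesis
  proof cases
    case 1
    thus ?thesis using roots_mod_eq_empty[of p "p ^ (k + 2)"] assms by simp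
  next
    case 2
    hence "p dvd q" using psi_eq_0_iff assms prime_imp_coprime by blast
    thus ?thesis using roots_mod_ramified_eq_empty[OF assms _ le_imp_power_dvd[of 2 "k + 2" p]] 2 by simp
  next
    case 3
    hence "\<not> p dvd q" using psi_eq_0_iff[of p] assms by (metis coprime_absorb_left not_prime_unit one_neq_zero)
    thus ?thesis using card_roots_mod_prime_power_le[of p "k + 2"] assms 3 by simp
  qed
qed

text \<open>\<open>(c, a, b)\<close> encodes the ideal \<open>c (a \<int> + (b + \<omega>) \<int>)\<close> of norm \<open>c\<^sup>2 a\<close>, where
  \<open>\<omega> = (1 + \<surd>q) / 2\<close>.\<close>

definition ideal_codes :: "nat \<Rightarrow> (nat \<times> nat \<times> int) set" where
  "ideal_codes n = {(c, a, b). c^2 * a = n \<and> b \<in> roots_mod (int a)}"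

lemma finite_ideal_codes:
  assumes "n > 0"
  shows "finite (ideal_codes n)"
proof (rule finite_subset)
  show "ideal_codes n \<subseteq> {..n} \<times> {..n} \<times> {0..<int n}"
  proof
    fix t assume "t \<in> ideal_codes n"
    then obtain c a b where t: "t = (c, a, b)" "c^2 * a = n" "b \<in> roots_mod (int a)"
      by (auto simp: ideal_codes_def)
    have "c dvd n" "a dvd n" using t(2) by (auto simp: power2_eq_square)
    hence "c \<le> n" "a \<le> n" using assms by (auto dest: dvd_imp_le)
    thus "t \<in> {..n} \<times> {..n} \<times> {0..<int n}" using t by (auto simp: roots_mod_def)
  qed
qed auto

lemma card_ideal_codes_1: "card (ideal_codes 1) = 1"
proof -
  have "ideal_codes 1 = {(1, 1, 0)}" by (auto simp: ideal_codes_def roots_mod_def)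
  thus ?thesis by simp
qed

text \<open>A code with c = 1 is a root modulo p^k; otherwise \<open>p\<close> divides c, and
  removing it lowers the exponent by 2 because the norm contains c^2.\<close>

lemma card_ideal_codes_prime_power_le:
  fixes p :: nat
  assumes "prime p"
  shows "int (card (ideal_codes (p ^ k))) \<le> (\<Sum>i\<le>k. \<psi> (int p) ^ i)"
proof (induction k rule: nat_less_induct)
  case (1 k)
  have pi: "prime (int p)" using assms by simp
  have p0: "p > 0" using assms prime_gt_0_nat by simp
  consider "k = 0" | "k = 1" | l where "k = l + 2"
    by (metis One_nat_def add_2_eq_Suc' not0_implies_Suc)
  thus ?case
  proof cases
    case 1
    thus ?thesis using card_ideal_codes_1 by simp
  next
    case 2
    have "ideal_codes p \<subseteq> {1} \<times> {p} \<times> roots_mod (int p)"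
    proof
      fix t assume "t \<in> ideal_codes p"
      then obtain c a b where t: "t = (c, a, b)" "c^2 * a = p" "b \<in> roots_mod (int a)"
        by (auto simp: ideal_codes_def)
      have "c = 1"
      proof (rule ccontr)
        assume "c \<noteq> 1"
        moreover have "c dvd p" using t(2) by (auto simp: power2_eq_square)
        ultimately have "c = p" using assms by (metis prime_nat_iff)
        hence "p * (p * a) = p * 1" using t(2) by (simp add: power2_eq_square)
        hence "p * a = 1" using p0 by simp
        thus False using assms by simp
      qed
      thus "t \<in> {1} \<times> {p} \<times> roots_mod (int p)" using t by auto
    qed
    hence "card (ideal_codes p) \<le> card ({1::nat} \<times> {p} \<times> roots_mod (int p))"
      by (intro card_mono) (auto simp: finite_roots_mod)
    hence "card (ideal_codes p) \<le> card (roots_mod (int p))" by (simp add: card_cartesian_product)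
    thus ?thesis using card_roots_mod_prime_le[OF pi] 2 by simp
  next
    case (3 l)
    let ?f = "\<lambda>(c, a, b). (p * c, a, b)"
    have "ideal_codes (p ^ k) \<subseteq> ?f ` ideal_codes (p ^ l) \<union> {1} \<times> {p ^ k} \<times> roots_mod (int p ^ k)"
    proof
      fix t assume "t \<in> ideal_codes (p ^ k)"
      then obtain c a b where t: "t = (c, a, b)" "c^2 * a = p ^ k" "b \<in> roots_mod (int a)"
        by (auto simp: ideal_codes_def)
      have "c dvd p ^ k" using t(2) by (metis dvd_mult2 dvd_triv_left power2_eq_square)
      then obtain i where i: "c = p ^ i" using divides_primepow_nat[OF assms] by blast
      show "t \<in> ?f ` ideal_codes (p ^ l) \<union> {1} \<times> {p ^ k} \<times> roots_mod (int p ^ k)"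
      proof (cases i)
        case 0
        thus ?thesis using i t by auto
      next
        case (Suc j)
        have "p^2 * ((p ^ j)^2 * a) = p^2 * p ^ l"
          using t(2) i Suc 3 by (simp add: power_mult_distrib power_add mult_ac power2_eq_square)
        hence "(p ^ j)^2 * a = p ^ l" using p0 by simp
        hence "(p ^ j, a, b) \<in> ideal_codes (p ^ l)" using t by (simp add: ideal_codes_def)
        hence "?f (p ^ j, a, b) \<in> ?f ` ideal_codes (p ^ l)" by (rule imageI)
        thus ?thesis using t i Suc by simp
      qed
    qed
    hence "card (ideal_codes (p ^ k)) \<le>
        card (?f ` ideal_codes (p ^ l) \<union> {1} \<times> {p ^ k} \<times> roots_mod (int p ^ k))"
      by (intro card_mono) (auto simp: finite_roots_mod finite_ideal_codes p0)
    also have "\<dots> \<le> card (?f ` ideal_codes (p ^ l)) + card ({1::nat} \<times> {p ^ k} \<times> roots_mod (int p ^ k))"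
      by (rule card_Un_le)
    also have "\<dots> \<le> card (ideal_codes (p ^ l)) + card (roots_mod (int p ^ k))"
      by (intro add_mono card_image_le) (auto simp: finite_ideal_codes p0 card_cartesian_product)
    finally have "int (card (ideal_codes (p ^ k))) \<le>
        (\<Sum>i\<le>l. \<psi> (int p) ^ i) + (\<psi> (int p) ^ (l + 1) + \<psi> (int p) ^ (l + 2))"
    proof -
      assume le: "card (ideal_codes (p ^ k)) \<le> card (ideal_codes (p ^ l)) + card (roots_mod (int p ^ k))"
      have "int (card (ideal_codes (p ^ l))) \<le> (\<Sum>i\<le>l. \<psi> (int p) ^ i)" using 1 3 by simp
      moreover have "int (card (roots_mod (int p ^ k))) \<le> \<psi> (int p) ^ (l + 1) + \<psi> (int p) ^ (l + 2)"
        using card_roots_mod_prime_power_le_psi[OF pi, of l] 3 by simp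
      ultimately show ?thesis using le by linarith
    qed
    thus ?thesis using 3 by simp
  qed
qed

lemma roots_mod_mod:
  assumes "b \<in> roots_mod a" "d dvd a" "d > 0"
  shows "b mod d \<in> roots_mod d"
proof -
  have "d dvd b^2 + b - (q - 1) div 4" using assms dvd_trans by (auto simp: roots_mod_def)
  moreover have "[(b mod d)^2 + b mod d - (q - 1) div 4 = b^2 + b - (q - 1) div 4] (mod d)"
    by (intro cong_diff cong_add cong_pow cong_refl) (simp_all add: cong_def)
  ultimately have "d dvd (b mod d)^2 + b mod d - (q - 1) div 4" using cong_dvd_iff by blast
  thus ?thesis using assms(3) by (simp add: roots_mod_def)
qed

text \<open>Splitting c and \<open>a\<close> by gcds and reducing \<open>b\<close> accordingly sends
  a code to a pair of codes. By the Chinese remainder theorem nothing is lost, and injectivity is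
  all that an upper bound asks for.\<close>

lemma card_ideal_codes_mult_le:
  fixes m n :: nat
  assumes "coprime m n" "m > 0" "n > 0"
  shows "card (ideal_codes (m * n)) \<le> card (ideal_codes m) * card (ideal_codes n)"
proof -
  define g where "g l t = (case t of (c, a, b) \<Rightarrow> (gcd c l, gcd a l, b mod int (gcd a l)))"
    for l :: nat and t :: "nat \<times> nat \<times> int"
  have split: "gcd c m ^ 2 * gcd a m = m \<and> gcd c n ^ 2 * gcd a n = n \<and>
      c = gcd c m * gcd c n \<and> a = gcd a m * gcd a n"
    if "c^2 * a = m * n" for c a
  proof -
    have c: "c = gcd c m * gcd c n" and a: "a = gcd a m * gcd a n"
      using that by (auto intro!: coprime_split[OF assms(1)] simp: power2_eq_square simp flip: that)
    let ?x = "gcd c m ^ 2 * gcd a m" and ?y = "gcd c n ^ 2 * gcd a n"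
    have xy: "?x * ?y = m * n"
    proof -
      have "?x * ?y = (gcd c m * gcd c n)^2 * (gcd a m * gcd a n)"
        by (simp add: power_mult_distrib mult_ac)
      thus ?thesis using that c a by simp
    qed
    have "coprime ?x n" "coprime ?y m"
      using assms(1) coprime_divisors[OF gcd_dvd2 dvd_refl, of m n]
        coprime_divisors[OF gcd_dvd2 dvd_refl, of n m]
      by (simp_all add: coprime_mult_left_iff coprime_commute)
    have "?x dvd m" using xy \<open>coprime ?x n\<close> by (metis coprime_dvd_mult_left_iff dvd_triv_left)
    moreover have "?y dvd n" using xy \<open>coprime ?y m\<close> by (metis coprime_dvd_mult_right_iff dvd_triv_right)
    ultimately have "?x \<le> m" "?y \<le> n" using assms by (auto dest: dvd_imp_le)
    have "?x = m"
    proof (rule ccontr)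
      assume "?x \<noteq> m"
      hence "?x * ?y < m * n" using \<open>?x \<le> m\<close> \<open>?y \<le> n\<close> assms by (intro mult_less_le_imp_less) auto
      thus False using xy by simp
    qed
    moreover from this have "?y = n" using xy assms by simp
    ultimately show ?thesis using c a by blast
  qed
  have "inj_on (\<lambda>t. (g m t, g n t)) (ideal_codes (m * n))"
  proof (rule inj_onI)
    fix t t' assume "t \<in> ideal_codes (m * n)" "t' \<in> ideal_codes (m * n)" and eq: "(g m t, g n t) = (g m t', g n t')"
    then obtain c a b c' a' b' where t: "t = (c, a, b)" "c^2 * a = m * n" "b \<in> roots_mod (int a)"
      "t' = (c', a', b')" "c'^2 * a' = m * n" "b' \<in> roots_mod (int a')"
      by (auto simp: ideal_codes_def)
    have gs: "gcd c m = gcd c' m" "gcd c n = gcd c' n" "gcd a m = gcd a' m" "gcd a n = gcd a' n"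
      "b mod int (gcd a m) = b' mod int (gcd a' m)" "b mod int (gcd a n) = b' mod int (gcd a' n)"
      using eq unfolding t(1,4) g_def prod.case prod.inject by blast+
    have c: "c = c'" using split[OF t(2)] split[OF t(5)] gs by metis
    have a: "a = a'" using split[OF t(2)] split[OF t(5)] gs by metis
    have "int (gcd a m) dvd b - b'" "int (gcd a n) dvd b - b'"
      using gs by (simp_all add: mod_eq_dvd_iff)
    moreover have "coprime (int (gcd a m)) (int (gcd a n))"
      using assms(1) by (simp add: coprime_divisors[OF gcd_dvd2 gcd_dvd2])
    ultimately have "int (gcd a m) * int (gcd a n) dvd b - b'" by (rule divides_mult)
    moreover have "int (gcd a m) * int (gcd a n) = int a" using split[OF t(2)] by (metis of_nat_mult)
    ultimately have "b mod int a = b' mod int a" by (simp add: mod_eq_dvd_iff)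
    hence "b = b'" using t a by (simp add: roots_mod_def)
    thus "t = t'" using t c a by simp
  qed
  moreover have "(\<lambda>t. (g m t, g n t)) ` ideal_codes (m * n) \<subseteq> ideal_codes m \<times> ideal_codes n"
  proof
    fix u assume "u \<in> (\<lambda>t. (g m t, g n t)) ` ideal_codes (m * n)"
    then obtain c a b where t: "u = (g m (c, a, b), g n (c, a, b))" "c^2 * a = m * n" "b \<in> roots_mod (int a)"
      by (auto simp: ideal_codes_def)
    have "b mod int (gcd a m) \<in> roots_mod (int (gcd a m))" "b mod int (gcd a n) \<in> roots_mod (int (gcd a n))"
      using t assms by (auto intro!: roots_mod_mod[OF t(3)] simp del: gcd_int_int_eq)
    thus "u \<in> ideal_codes m \<times> ideal_codes n"
      using t split[OF t(2)] by (simp add: g_def ideal_codes_def)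
  qed
  ultimately have "card (ideal_codes (m * n)) \<le> card (ideal_codes m \<times> ideal_codes n)"
    using assms by (intro card_inj_on_le) (auto simp: finite_ideal_codes)
  thus ?thesis by (simp add: card_cartesian_product)
qed

section \<open>Ideal counts compared with divisor sums\<close>

lemma psi_divisor_sum_mult:
  fixes m n :: nat
  assumes "coprime m n" "m > 0" "n > 0"
  shows "psi_divisor_sum (m * n) = psi_divisor_sum m * psi_divisor_sum n"
proof -
  have fin: "finite {d. d dvd m}" "finite {d. d dvd n}" using assms by auto
  have gcds: "gcd (x * y) m = x" "gcd (x * y) n = y" if "x dvd m" "y dvd n" for x y
  proof -
    have "coprime y m" "coprime x n" using assms(1) that
      by (meson coprime_commute coprime_divisors dvd_refl)+
    hence "gcd (x * y) m = gcd x m" "gcd (x * y) n = gcd y n"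
      using gcd_mult_left_right_cancel[of m y x] gcd_mult_left_left_cancel[of n x y]
      by (simp_all add: coprime_commute)
    thus "gcd (x * y) m = x" "gcd (x * y) n = y"
      using that by (simp_all add: gcd_nat.absorb1)
  qed
  have "psi_divisor_sum m * psi_divisor_sum n =
      (\<Sum>(x, y)\<in>{d. d dvd m} \<times> {d. d dvd n}. \<psi> (int x) * \<psi> (int y))"
    unfolding psi_divisor_sum_def sum_product using fin by (simp add: sum.cartesian_product)
  also have "\<dots> = (\<Sum>d | d dvd m * n. \<psi> (int d))"
    by (rule sum.reindex_bij_witness[of _ "\<lambda>d. (gcd d m, gcd d n)" "\<lambda>(x, y). x * y"])
       (use gcds coprime_split[OF assms(1)] in \<open>auto simp: psi_mult mult_dvd_mono\<close>)
  finally show ?thesis unfolding psi_divisor_sum_def by simp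
qed

lemma psi_divisor_sum_prime_power:
  fixes p :: nat
  assumes "prime p"
  shows "psi_divisor_sum (p ^ k) = (\<Sum>i\<le>k. \<psi> (int p) ^ i)"
proof -
  have "{d. d dvd p ^ k} = (\<lambda>i. p ^ i) ` {..k}" using divides_primepow_nat[OF assms] by auto
  moreover have "inj_on (\<lambda>i. p ^ i) {..k}"
    using assms prime_gt_1_nat by (auto simp: inj_on_def)
  ultimately show ?thesis unfolding psi_divisor_sum_def
    by (simp add: sum.reindex psi_power)
qed

lemma card_ideal_codes_le:
  assumes "n > 0"
  shows "int (card (ideal_codes n)) \<le> psi_divisor_sum n"
  using assms
proof (induction n rule: less_induct)
  case (less n)
  show ?case
  proof (cases "n = 1")
    case True
    have "{d::nat. d dvd 1} = {1}" by auto
    hence "psi_divisor_sum 1 = 1" by (simp add: psi_divisor_sum_def jacobi_1)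
    thus ?thesis using True card_ideal_codes_1 by simp
  next
    case False
    then obtain p where p: "prime p" "p dvd n" using prime_factor_nat by blast
    define k where "k = multiplicity p n"
    obtain m where m: "n = p ^ k * m" "\<not> p dvd m"
      using multiplicity_decompose'[of n p] p less.prems k_def by (metis not_prime_unit less_irrefl)
    have k: "k > 0" using p less.prems k_def by (simp add: prime_multiplicity_gt_zero_iff)
    have m0: "m > 0" using m less.prems by (cases m) auto
    have "p ^ k > 1" using p k prime_gt_1_nat one_less_power by blast
    hence "m < n" using m m0 by simp
    have cop: "coprime (p ^ k) m" using p m by (simp add: prime_imp_coprime)
    have pk: "p ^ k > 0" using p prime_gt_0_nat by simp
    have "int (card (ideal_codes n)) \<le> int (card (ideal_codes (p ^ k))) * int (card (ideal_codes m))"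
      using card_ideal_codes_mult_le[OF cop pk m0] m(1) by (metis of_nat_le_iff of_nat_mult)
    \<comment> \<open>Multiplying the bounds requires \<open>psi_divisor_sum (p ^ k)\<close> to be
      nonnegative, which it is as an upper bound of a cardinality.\<close>
    also have "\<dots> \<le> psi_divisor_sum (p ^ k) * psi_divisor_sum m"
      using card_ideal_codes_prime_power_le[OF p(1), of k] less.IH[OF \<open>m < n\<close> m0]
      by (intro mult_mono) (auto simp: psi_divisor_sum_prime_power[OF p(1)] intro: order_trans)
    also have "\<dots> = psi_divisor_sum n" using psi_divisor_sum_mult[OF cop pk m0] m(1) by simp
    finally show ?thesis .
  qed
qed

end

section \<open>Integers of a real quadratic field\<close>

lemma of_int_poly_mult: "map_poly (of_int :: int \<Rightarrow> real) (p * q) = map_poly of_int p * map_poly of_int q"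
  by (intro poly_eqI) (simp add: coeff_map_poly coeff_mult)

lemma of_int_poly_add: "map_poly (of_int :: int \<Rightarrow> real) (p + q) = map_poly of_int p + map_poly of_int q"
  by (intro poly_eqI) (simp add: coeff_map_poly)

lemma of_int_poly_smult: "map_poly (of_int :: int \<Rightarrow> real) (Polynomial.smult c p) = Polynomial.smult (of_int c) (map_poly of_int p)"
  by (intro poly_eqI) (simp add: coeff_map_poly)

text \<open>By Gauss's lemma, the primitive integer polynomial of degree two that annihilates an
  irrational algebraic integer divides its monic integer polynomial, hence has leading
  coefficient \<open>\<plusminus>1\<close>.\<close>

lemma quadratic_algebraic_int:
  fixes z :: real
  assumes z: "algebraic_int z" "z \<notin> \<rat>" and st: "s \<in> \<rat>" "n \<in> \<rat>" and eq: "z^2 - s * z + n = 0"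
  shows "s \<in> \<int>" "n \<in> \<int>"
proof -
  obtain a b where s: "s = of_int a / of_int b" "b > 0" using st(1) by (rule Rats_cases') auto
  obtain c d where n: "n = of_int c / of_int d" "d > 0" using st(2) by (rule Rats_cases') auto
  define g0 :: "int poly" where "g0 = [:c * b, - (a * d), b * d:]"
  define g where "g = primitive_part g0"
  let ?h = "map_poly (of_int :: int \<Rightarrow> real)"
  have g0_nz: "g0 \<noteq> 0" and deg: "degree g0 = 2" using s n by (auto simp: g0_def)
  have g0: "g0 = Polynomial.smult (content g0) g" by (simp add: g_def)
  have cg0: "content g0 \<noteq> 0" using g0_nz by simp
  have g_nz: "g \<noteq> 0" and degg: "degree g = 2" and cg: "content g = 1"
    using g0_nz deg by (auto simp: g_def)
  have "poly (?h g0) z = of_int b * of_int d * (z^2 - s * z + n)"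
    using s n by (simp add: g0_def map_poly_pCons power2_eq_square field_simps)
  hence "poly (?h g0) z = 0" using eq by simp
  hence "of_int (content g0) * poly (?h g) z = 0"
    by (subst (asm) g0) (simp add: of_int_poly_smult)
  hence gz: "poly (?h g) z = 0" using cg0 by simp
  obtain p where p: "poly (?h p) z = 0" "lead_coeff p = 1"
    using z(1) unfolding algebraic_int_altdef_ipoly by blast
  \<comment> \<open>Pseudo-division stays over the integers although \<open>g\<close> is not yet
    known to be monic up to sign. The remainder has degree at most 1 and vanishes at an irrational
    point, so it is 0.\<close>
  obtain e u where eu: "e \<noteq> 0" "Polynomial.smult e p = g * u + pseudo_mod p g"
    using pseudo_mod(1)[OF g_nz, of p] by blast
  let ?r = "pseudo_mod p g"
  have "?r = 0"
  proof -
    have "degree ?r \<le> 1" using pseudo_mod(2)[OF g_nz, of p] degg by auto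
    define r0 r1 where "r0 = Polynomial.coeff ?r 0" and "r1 = Polynomial.coeff ?r 1"
    have r: "?r = [:r0, r1:]"
    proof (rule poly_eqI)
      fix i
      have "Polynomial.coeff ?r i = 0" if "i > 1"
        using that \<open>degree ?r \<le> 1\<close> by (intro coeff_eq_0) linarith
      thus "Polynomial.coeff ?r i = Polynomial.coeff [:r0, r1:] i"
        by (auto simp: r0_def r1_def coeff_pCons split: nat.splits)
    qed
    have "poly (?h (Polynomial.smult e p)) z = poly (?h (g * u + ?r)) z" using eu by simp
    hence "poly (?h ?r) z = 0" using p gz by (simp add: of_int_poly_smult of_int_poly_add of_int_poly_mult)
    hence 0: "of_int r0 + z * of_int r1 = (0 :: real)" unfolding r by (simp add: map_poly_pCons)
    have "r1 = 0"
    proof (rule ccontr)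
      assume "r1 \<noteq> 0"
      hence "z = - of_int r0 / of_int r1" using 0 by (simp add: field_simps)
      thus False using z(2) by auto
    qed
    thus ?thesis using 0 r by simp
  qed
  hence *: "Polynomial.smult e p = g * u" using eu by simp
  \<comment> \<open>In e p = g u, multiplicativity of the content makes \<open>e\<close> divide all
    coefficients of \<open>u\<close>; comparing leading coefficients then leaves
    \<open>lead_coeff g\<close> as a divisor of 1.\<close>
  have "content p dvd 1" using content_dvd_coeff[of p "degree p"] p(2) by simp
  hence "content p = 1" by (metis is_unit_normalize normalize_content)
  hence "content u = \<bar>e\<bar>" using arg_cong[OF *, of content] cg by (simp add: content_mult)
  hence "e dvd lead_coeff u" using content_dvd_coeff[of u "degree u"] by simp
  then obtain t where t: "lead_coeff u = e * t" by blast
  have "e = lead_coeff g * lead_coeff u" using arg_cong[OF *, of lead_coeff] p(2) eu(1) by (simp add: lead_coeff_mult)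
  hence "e * 1 = e * (lead_coeff g * t)" using t by simp
  hence "lead_coeff g * t = 1" using eu(1) by simp
  hence lg: "lead_coeff g = 1 \<or> lead_coeff g = -1" by (metis zmult_eq_1_iff)
  have co: "Polynomial.coeff g0 i = content g0 * Polynomial.coeff g i" for i
    using arg_cong[OF g0, of "\<lambda>p. Polynomial.coeff p i"] by simp
  have c0: "c * b = content g0 * Polynomial.coeff g 0" using co[of 0] by (simp add: g0_def)
  have c1: "a * d = - (content g0 * Polynomial.coeff g 1)" using co[of 1] by (simp add: g0_def)
  have c2: "b * d = content g0 * lead_coeff g" using co[of 2] degg by (simp add: g0_def numeral_2_eq_2)
  have "b dvd a"
  proof -
    have "a * d = (b * d) * (- (lead_coeff g * Polynomial.coeff g 1))" using c1 c2 lg by auto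
    hence "a * d = (b * (- (lead_coeff g * Polynomial.coeff g 1))) * d" by simp
    hence "a = b * (- (lead_coeff g * Polynomial.coeff g 1))" using n by (metis mult_right_cancel less_irrefl)
    thus ?thesis by (rule dvdI)
  qed
  thus "s \<in> \<int>" using s by (auto simp: dvd_def)
  have "d dvd c"
  proof -
    have "c * b = (b * d) * (lead_coeff g * Polynomial.coeff g 0)" using c0 c2 lg by auto
    hence "c * b = (d * (lead_coeff g * Polynomial.coeff g 0)) * b" by simp
    hence "c = d * (lead_coeff g * Polynomial.coeff g 0)" using s by (metis mult_right_cancel less_irrefl)
    thus ?thesis by (rule dvdI)
  qed
  thus "n \<in> \<int>" using n by (auto simp: dvd_def)
qed

lemma quadratic_field_coords_unique:
  fixes r :: real
  assumes "r \<notin> \<rat>" "x \<in> \<rat>" "y \<in> \<rat>" "x' \<in> \<rat>" "y' \<in> \<rat>" "x + y * r = x' + y' * r"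
  shows "x = x'" "y = y'"
proof -
  show "y = y'"
  proof (rule ccontr)
    assume "y \<noteq> y'"
    hence "r = (x' - x) / (y - y')" using assms(6) by (simp add: field_simps)
    thus False using assms by simp
  qed
  thus "x = x'" using assms(6) by simp
qed

lemma quadratic_field_algebraic_int:
  assumes "sqrt (of_int q) \<notin> \<rat>" "q > 0" "x \<in> \<rat>" "y \<in> \<rat>" "algebraic_int (x + y * sqrt (of_int q))"
  shows "2 * x \<in> \<int>" "x^2 - of_int q * y^2 \<in> \<int>"
proof -
  let ?r = "sqrt (of_int q)"
  have "2 * x \<in> \<int> \<and> x^2 - of_int q * y^2 \<in> \<int>"
  proof (cases "y = 0")
    case True
    hence "x \<in> \<int>" using rational_algebraic_int_is_int assms by simp
    thus ?thesis using True by simp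
  next
    case False
    have irr: "x + y * ?r \<notin> \<rat>"
    proof
      assume "x + y * ?r \<in> \<rat>"
      hence "(x + y * ?r - x) / y \<in> \<rat>" using assms by (intro Rats_divide Rats_diff)
      thus False using False assms by simp
    qed
    have "(x + y * ?r)^2 - (2 * x) * (x + y * ?r) + (x^2 - of_int q * y^2) = 0"
      using assms(2) by (simp add: power2_eq_square algebra_simps)
    from quadratic_algebraic_int[OF assms(5) irr _ _ this] show ?thesis using assms by simp
  qed
  thus "2 * x \<in> \<int>" "x^2 - of_int q * y^2 \<in> \<int>" by blast+
qed

lemma algebraic_int_quadratic_root:
  fixes z :: real
  assumes "z^2 - of_int t * z + of_int n = 0"
  shows "algebraic_int z"
proof (rule algebraic_int.intros)
  show "lead_coeff [:of_int n, - of_int t, 1:] = (1 :: real)" by simp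
  show "\<forall>i. Polynomial.coeff [:of_int n, - of_int t, 1 :: real:] i \<in> \<int>"
    by (auto simp: coeff_pCons split: nat.splits)
  show "poly [:of_int n, - of_int t, 1:] z = 0"
    using assms by (simp add: power2_eq_square algebra_simps)
qed

section \<open>The discriminant and the shape of the maximal order\<close>

lemma quadratic_conj_eq:
  assumes "sqrt (of_int q) \<notin> \<rat>" "x \<in> \<rat>" "y \<in> \<rat>"
  shows "quadratic_conj q (x + y * sqrt (of_int q)) = x - y * sqrt (of_int q)"
  unfolding quadratic_conj_def
proof (rule the_equality)
  fix w assume "\<exists>x' y'. x' \<in> \<rat> \<and> y' \<in> \<rat> \<and> x + y * sqrt (of_int q) = x' + y' * sqrt (of_int q) \<and>
      w = x' - y' * sqrt (of_int q)"
  thus "w = x - y * sqrt (of_int q)"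
    using quadratic_field_coords_unique[OF assms] by blast
qed (use assms in blast)

text \<open>Since \<open>1\<close> and \<open>\<surd>q\<close> are integral and have discriminant \<open>4 q\<close>, they span a sublattice of
  index two.\<close>

lemma discriminant_double_span:
  assumes "real_quadratic_discriminant q" "z \<in> carrier (quadratic_integers q)"
  shows "\<exists>i j :: int. z = (of_int i + of_int j * sqrt (of_int q)) / 2"
proof -
  let ?r = "sqrt (of_int q) :: real"
  have q1: "q > 1" and irr: "?r \<notin> \<rat>" using assms by (auto simp: real_quadratic_discriminant_def)
  obtain v w where vw: "integral_basis q v w" and
    disc: "of_int q = (v * quadratic_conj q w - quadratic_conj q v * w)\<^sup>2"
    using assms by (auto simp: real_quadratic_discriminant_def)
  obtain x1 y1 where v: "x1 \<in> \<rat>" "y1 \<in> \<rat>" "v = x1 + y1 * ?r"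
    using vw by (auto simp: integral_basis_def quadratic_integers_def quadratic_field_def)
  obtain x2 y2 where w: "x2 \<in> \<rat>" "y2 \<in> \<rat>" "w = x2 + y2 * ?r"
    using vw by (auto simp: integral_basis_def quadratic_integers_def quadratic_field_def)
  have rr: "?r * ?r = of_int q" using q1 by simp
  have one: "1 \<in> carrier (quadratic_integers q)"
  proof -
    have "\<exists>x y. (1::real) = x + y * ?r \<and> x \<in> \<rat> \<and> y \<in> \<rat>"
      by (rule exI[of _ 1], rule exI[of _ 0]) simp
    thus ?thesis by (simp add: quadratic_integers_def quadratic_field_def)
  qed
  have rt: "?r \<in> carrier (quadratic_integers q)"
  proof -
    have "\<exists>x y. ?r = x + y * ?r \<and> x \<in> \<rat> \<and> y \<in> \<rat>"
      by (rule exI[of _ 0], rule exI[of _ 1]) simp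
    thus ?thesis by (simp add: quadratic_integers_def quadratic_field_def algebraic_int_sqrt)
  qed
  obtain a b where ab: "1 = of_int a * v + of_int b * w"
    using vw one unfolding integral_basis_def by metis
  obtain c d where cd: "?r = of_int c * v + of_int d * w"
    using vw rt unfolding integral_basis_def by metis
  have "1 + 0 * ?r = (of_int a * x1 + of_int b * x2) + (of_int a * y1 + of_int b * y2) * ?r"
    using ab v w by (simp add: algebra_simps)
  from quadratic_field_coords_unique[OF irr _ _ _ _ this]
  have A: "of_int a * x1 + of_int b * x2 = 1" "of_int a * y1 + of_int b * y2 = 0" using v w by auto
  have "0 + 1 * ?r = (of_int c * x1 + of_int d * x2) + (of_int c * y1 + of_int d * y2) * ?r"
    using cd v w by (simp add: algebra_simps)
  from quadratic_field_coords_unique[OF irr _ _ _ _ this]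
  have B: "of_int c * x1 + of_int d * x2 = 0" "of_int c * y1 + of_int d * y2 = 1" using v w by auto
  \<comment> \<open>The determinant of \<open>v\<close>, \<open>w\<close> in the coordinates 1, sqrt
    q. The discriminant is 4 q \<delta>^2, so being equal to \<open>q\<close> it forces \<delta> to
    be 1/2 up to sign, and the inverse integer matrix has determinant 2 up to sign.\<close>
  define \<delta> where "\<delta> = x1 * y2 - x2 * y1"
  have det: "of_int (a * d - b * c) * \<delta> = 1"
  proof -
    have "of_int (a * d - b * c) * \<delta> =
      (of_int a * x1 + of_int b * x2) * (of_int c * y1 + of_int d * y2)
      - (of_int a * y1 + of_int b * y2) * (of_int c * x1 + of_int d * x2)"
      by (simp add: \<delta>_def algebra_simps)
    thus ?thesis using A B by simp
  qed
  have conj: "quadratic_conj q v = x1 - y1 * ?r" "quadratic_conj q w = x2 - y2 * ?r"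
    unfolding v(3) w(3) using v w by (simp_all add: quadratic_conj_eq[OF irr])
  have "v * quadratic_conj q w - quadratic_conj q v * w =
      (x1 + y1 * ?r) * (x2 - y2 * ?r) - (x1 - y1 * ?r) * (x2 + y2 * ?r)"
    unfolding conj unfolding v(3) w(3) ..
  also have "\<dots> = - 2 * \<delta> * ?r" by (simp add: \<delta>_def algebra_simps)
  finally have "v * quadratic_conj q w - quadratic_conj q v * w = - 2 * \<delta> * ?r" .
  hence "of_int q = (- 2 * \<delta> * ?r)^2" using disc by simp
  hence "of_int q * 1 = of_int q * (2 * \<delta>)^2" using rr by (simp add: power_mult_distrib)
  hence "(2 * \<delta>)^2 = 1" using q1 by simp
  moreover have "(of_int (a * d - b * c))^2 * (2 * \<delta>)^2 = (4 :: real)"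
  proof -
    have "(of_int (a * d - b * c))^2 * (2 * \<delta>)^2 = (2 * (of_int (a * d - b * c) * \<delta>))^2"
      by (simp only: power_mult_distrib mult.left_commute)
    thus ?thesis unfolding det by simp
  qed
  ultimately have "(of_int ((a * d - b * c)^2) :: real) = of_int 4" by simp
  hence "(a * d - b * c)^2 = 2^2" by (simp only: of_int_eq_iff) simp
  hence D: "a * d - b * c = 2 \<or> a * d - b * c = - 2" by (simp only: power2_eq_iff)
  obtain k l where z: "z = of_int k * v + of_int l * w"
    using vw assms(2) unfolding integral_basis_def by metis
  \<comment> \<open>Cramer's rule: multiplied by the determinant, \<open>v\<close> and
    \<open>w\<close> become integer combinations of 1 and sqrt q.\<close>
  have Dv: "of_int (a * d - b * c) * v = of_int d - of_int b * ?r"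
  proof -
    have "of_int (a * d - b * c) * v = of_int d * (of_int a * v + of_int b * w) - of_int b * (of_int c * v + of_int d * w)"
      by (simp add: algebra_simps)
    thus ?thesis unfolding ab[symmetric] cd[symmetric] by simp
  qed
  have Dw: "of_int (a * d - b * c) * w = of_int a * ?r - of_int c"
  proof -
    have "of_int (a * d - b * c) * w = of_int a * (of_int c * v + of_int d * w) - of_int c * (of_int a * v + of_int b * w)"
      by (simp add: algebra_simps)
    thus ?thesis unfolding ab[symmetric] cd[symmetric] by simp
  qed
  have "of_int (a * d - b * c) * z = of_int k * (of_int (a * d - b * c) * v) + of_int l * (of_int (a * d - b * c) * w)"
    unfolding z by (simp add: algebra_simps)
  hence "of_int (a * d - b * c) * z = of_int (k * d - l * c) + of_int (l * a - k * b) * ?r"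
    unfolding Dv Dw by (simp add: algebra_simps)
  then obtain i j :: int where Dz: "of_int (a * d - b * c) * z = of_int i + of_int j * ?r" by blast
  from D show ?thesis
  proof
    assume "a * d - b * c = 2"
    thus ?thesis using Dz by (intro exI[of _ i] exI[of _ j]) simp
  next
    assume "a * d - b * c = - 2"
    thus ?thesis using Dz by (intro exI[of _ "- i"] exI[of _ "- j"]) simp
  qed
qed

lemma half_integer_norm:
  assumes "real_quadratic_discriminant q" "z \<in> carrier (quadratic_integers q)"
    "z = (of_int i + of_int j * sqrt (of_int q)) / 2"
  shows "4 dvd i^2 - q * j^2"
proof -
  have q: "q > 1" "sqrt (of_int q) \<notin> \<rat>" using assms by (auto simp: real_quadratic_discriminant_def)
  have "z = of_int i / 2 + (of_int j / 2) * sqrt (of_int q)" using assms(3) by (simp add: add_divide_distrib)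
  moreover have "algebraic_int z" using assms(2) by (simp add: quadratic_integers_def)
  ultimately have "(of_int i / 2)^2 - of_int q * (of_int j / 2)^2 \<in> (\<int> :: real set)"
    using quadratic_field_algebraic_int(2)[of q "of_int i / 2" "of_int j / 2"] q by simp
  then obtain n where "(of_int i / 2)^2 - of_int q * (of_int j / 2)^2 = (of_int n :: real)"
    by (auto elim: Ints_cases)
  hence "of_int (i^2 - q * j^2) = (of_int (4 * n) :: real)"
    by (simp add: power_divide field_simps)
  thus ?thesis by (simp only: of_int_eq_iff dvd_triv_left)
qed

text \<open>If \<open>q\<close> were 3 modulo 4, integrality of (i + j sqrt q) / 2 would force i and
  j to be even. All integers of the field would then be integer combinations of 1 and sqrt q, and
  the discriminant would be \<open>q\<close> times an even square.\<close>

lemma discriminant_mod_4: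
  assumes "real_quadratic_discriminant q" "odd q"
  shows "q mod 4 = 1"
proof (rule ccontr)
  assume "q mod 4 \<noteq> 1"
  hence q4: "q mod 4 = 3" using assms(2) by presburger
  let ?r = "sqrt (of_int q) :: real"
  have q1: "q > 1" and irr: "?r \<notin> \<rat>" using assms by (auto simp: real_quadratic_discriminant_def)
  obtain v w where vw: "integral_basis q v w" and
    disc: "of_int q = (v * quadratic_conj q w - quadratic_conj q v * w)\<^sup>2"
    using assms by (auto simp: real_quadratic_discriminant_def)
  have integral: "\<exists>x y :: int. z = of_int x + of_int y * ?r" if z: "z \<in> carrier (quadratic_integers q)" for z
  proof -
    obtain i j :: int where ij: "z = (of_int i + of_int j * ?r) / 2"
      using discriminant_double_span assms(1) z by blast
    have "4 dvd i^2 - q * j^2" using half_integer_norm[OF assms(1) z ij] .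
    moreover have "4 dvd (q + 1) * j^2" using q4 by (intro dvd_mult2) presburger
    ultimately have "4 dvd (i^2 - q * j^2) + (q + 1) * j^2" by (rule dvd_add)
    hence sum: "4 dvd i^2 + j^2" by (simp add: algebra_simps)
    have sq: "x^2 mod 4 = (if even x then 0 else 1)" for x :: int
    proof (cases "even x")
      case False
      then obtain y where "x = 2 * y + 1" by (rule oddE)
      hence "x^2 = 4 * (y * y + y) + 1" by (simp add: power2_eq_square algebra_simps)
      thus ?thesis using False by presburger
    qed (auto elim!: evenE simp: power2_eq_square)
    have "even i" "even j" using sum sq[of i] sq[of j] by (presburger, presburger)
    then obtain x y where "i = 2 * x" "j = 2 * y" by blast
    thus ?thesis using ij by (intro exI[of _ x] exI[of _ y]) (simp add: field_simps)
  qed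
  have "v \<in> carrier (quadratic_integers q)" "w \<in> carrier (quadratic_integers q)"
    using vw by (simp_all add: integral_basis_def)
  then obtain x1 y1 x2 y2 where v: "v = of_int x1 + of_int y1 * ?r" and w: "w = of_int x2 + of_int y2 * ?r"
    using integral by metis
  have "quadratic_conj q v = of_int x1 - of_int y1 * ?r" "quadratic_conj q w = of_int x2 - of_int y2 * ?r"
    unfolding v w by (simp_all add: quadratic_conj_eq[OF irr])
  hence "v * quadratic_conj q w - quadratic_conj q v * w =
      (of_int x1 + of_int y1 * ?r) * (of_int x2 - of_int y2 * ?r)
      - (of_int x1 - of_int y1 * ?r) * (of_int x2 + of_int y2 * ?r)"
    using v w by metis
  also have "\<dots> = of_int (2 * (y1 * x2 - x1 * y2)) * ?r" by (simp add: algebra_simps)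
  finally have "of_int q = (of_int (2 * (y1 * x2 - x1 * y2)) * ?r)\<^sup>2" using disc by simp
  hence "of_int q = (of_int (2 * (y1 * x2 - x1 * y2)))\<^sup>2 * (of_int q :: real)"
    using q1 by (simp add: power_mult_distrib)
  hence "(of_int ((2 * (y1 * x2 - x1 * y2))\<^sup>2) :: real) = of_int 1" using q1 by simp
  hence "(2 * (y1 * x2 - x1 * y2))\<^sup>2 = 1" by (simp only: of_int_eq_iff)
  hence "odd ((2 * (y1 * x2 - x1 * y2))\<^sup>2)" by simp
  thus False by simp
qed

definition omega :: "int \<Rightarrow> real" where
  "omega q = (1 + sqrt (of_int q)) / 2"

lemma carrier_quadratic_integers:
  assumes "real_quadratic_discriminant q" "odd q"
  shows "carrier (quadratic_integers q) = {of_int x + of_int y * omega q | x y. True}"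
proof (intro equalityI subsetI)
  have q1: "q > 1" using assms by (auto simp: real_quadratic_discriminant_def)
  let ?r = "sqrt (of_int q) :: real"
  fix z assume z: "z \<in> carrier (quadratic_integers q)"
  obtain i j :: int where ij: "z = (of_int i + of_int j * ?r) / 2"
    using discriminant_double_span assms(1) z by blast
  have "4 dvd i^2 - q * j^2" using half_integer_norm[OF assms(1) z ij] .
  hence "even (i^2 - q * j^2)" by (meson dvd_trans even_numeral)
  hence "even (i - j)" using assms(2) by simp
  then obtain x where "i = j + 2 * x" by (metis add.commute diff_add_cancel dvd_def)
  hence "z = of_int x + of_int j * omega q" using ij by (simp add: omega_def field_simps)
  thus "z \<in> {of_int x + of_int y * omega q | x y. True}" by blast
next
  let ?r = "sqrt (of_int q) :: real"
  have q1: "q > 1" using assms by (auto simp: real_quadratic_discriminant_def)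
  fix z assume "z \<in> {of_int x + of_int y * omega q | x y. True}"
  then obtain x y :: int where z: "z = of_int x + of_int y * omega q" by blast
  obtain k where k: "q = 4 * k + 1"
    using discriminant_mod_4[OF assms] by (metis mult_div_mod_eq)
  have rr: "?r * ?r = 4 * of_int k + 1" using q1 k by simp
  have "z^2 - of_int (2 * x + y) * z + of_int (x^2 + x * y - k * y^2) =
     of_int y * of_int y * (?r * ?r - (4 * of_int k + 1)) / 4"
    unfolding z omega_def by (simp add: power2_eq_square field_simps)
  hence "algebraic_int z" unfolding rr
    by (intro algebraic_int_quadratic_root[of z "2 * x + y" "x^2 + x * y - k * y^2"]) simp
  moreover have "\<exists>a b. z = a + b * ?r \<and> a \<in> \<rat> \<and> b \<in> \<rat>"
    by (rule exI[of _ "of_int x + of_int y / 2"], rule exI[of _ "of_int y / 2"])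
       (simp add: z omega_def field_simps)
  ultimately show "z \<in> carrier (quadratic_integers q)"
    by (simp add: quadratic_integers_def quadratic_field_def)
qed

text \<open>If p^2 divides \<open>q\<close>, then q / p^2 is again 1 modulo 4, so (1 + sqrt q / p) /
  2 is an algebraic integer of the field with a non-integral coefficient of
  \<open>omega q\<close>.\<close>

lemma discriminant_squarefree:
  assumes "real_quadratic_discriminant q" "odd q"
  shows "squarefree q"
proof -
  let ?r = "sqrt (of_int q) :: real"
  have q1: "q > 1" and irr: "?r \<notin> \<rat>" using assms by (auto simp: real_quadratic_discriminant_def)
  have "\<not> p^2 dvd q" if p: "prime p" for p
  proof
    assume "p^2 dvd q"
    then obtain d where d: "q = p^2 * d" by blast
    have p0: "p > 1" using p prime_gt_1_int by blast
    have op: "odd p" using d assms(2) by (auto simp: power2_eq_square)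
    have "p mod 4 = 1 \<or> p mod 4 = 3" using op by presburger
    moreover have "(p^2) mod 4 = (p mod 4)^2 mod 4" by (simp add: power_mod)
    ultimately have "p^2 mod 4 = 1" by auto
    hence "d mod 4 = 1"
      using discriminant_mod_4[OF assms] unfolding d by (metis mod_mult_left_eq mult_1)
    then obtain e where e: "d = 4 * e + 1" by (metis mult_div_mod_eq)
    define z where "z = 1 / 2 + (1 / (2 * of_int p)) * ?r"
      have "?r * ?r = of_int q" using q1 by simp
    hence rr: "?r * ?r = of_int p * of_int p * (4 * of_int e + 1)"
      unfolding d e by (simp add: power2_eq_square)
    have "z^2 - of_int 1 * z + of_int (- e) = (?r * ?r / (of_int p * of_int p) - 1) / 4 - of_int e"
      unfolding z_def using p0 by (simp add: power2_eq_square field_simps)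
    hence "algebraic_int z" unfolding rr using p0
      by (intro algebraic_int_quadratic_root[of z 1 "- e"]) simp
    moreover have "\<exists>a b. z = a + b * ?r \<and> a \<in> \<rat> \<and> b \<in> \<rat>"
      by (rule exI[of _ "1 / 2"], rule exI[of _ "1 / (2 * of_int p)"]) (simp add: z_def)
    ultimately have "z \<in> carrier (quadratic_integers q)"
      by (simp add: quadratic_integers_def quadratic_field_def)
    then obtain x y :: int where "z = of_int x + of_int y * omega q"
      unfolding carrier_quadratic_integers[OF assms] by blast
    hence "1 / 2 + (1 / (2 * of_int p)) * ?r = (of_int x + of_int y / 2) + (of_int y / 2) * ?r"
      unfolding z_def omega_def by (simp add: field_simps)
    hence "1 / (2 * of_int p) = (of_int y / 2 :: real)"
      by (rule quadratic_field_coords_unique(2)[OF irr, rotated -1]) simp_all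
    hence "(of_int (p * y) :: real) = of_int 1" using p0 by (simp add: field_simps)
    hence "p * y = 1" by (simp only: of_int_eq_iff)
    thus False using p0 by (metis dvd_triv_left not_prime_unit p)
  qed
  thus ?thesis using squarefree_factorial_semiring[of q] q1 by simp
qed

section \<open>Lattice points in hyperbolic sectors\<close>

text \<open>On each cell the integrand is at most \<open>g\<close> at the right end minus
  \<open>h\<close> at the left end. Moving \<open>h\<close> to the right end as well costs an
  increment of \<open>h\<close>, and these telescope to the error term.\<close>

lemma riemann_sum_mono_diff:
  fixes g h :: "real \<Rightarrow> real"
  assumes cont: "continuous_on {0..} g" "continuous_on {0..} h"
    and mono: "mono_on {0..} g" "mono_on {0..} h" and \<eta>: "\<eta> > 0"
  shows "integral {0..real N * \<eta>} (\<lambda>x. g x - h x) - \<eta> * (h (real N * \<eta>) - h 0)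
     \<le> \<eta> * (\<Sum>n=1..N. g (real n * \<eta>) - h (real n * \<eta>))"
proof (induction N)
  case (Suc N)
  let ?f = "\<lambda>x. g x - h x" and ?x = "real N * \<eta>" and ?y = "real (Suc N) * \<eta>"
  have xy: "0 \<le> ?x" "?x \<le> ?y" and diff: "?y - ?x = \<eta>" using \<eta> by (simp_all add: algebra_simps)
  have int: "?f integrable_on {u..v}" if "0 \<le> u" for u v
    using that by (intro integrable_continuous_real continuous_on_diff continuous_on_subset[OF cont(1)]
      continuous_on_subset[OF cont(2)]) auto
  have "integral {?x..?y} ?f \<le> integral {?x..?y} (\<lambda>_. g ?y - h ?x)"
  proof (rule integral_le)
    fix u assume u: "u \<in> {?x..?y}"
    have "g u \<le> g ?y" using u xy by (intro mono_onD[OF mono(1)]) auto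
    moreover have "h ?x \<le> h u" using u xy by (intro mono_onD[OF mono(2)]) auto
    ultimately show "g u - h u \<le> g ?y - h ?x" by simp
  qed (use xy int in auto)
  also have "\<dots> = \<eta> * (g ?y - h ?x)" using xy diff by simp
  finally have cell: "integral {?x..?y} ?f \<le> \<eta> * (g ?y - h ?x)" .
  have "integral {0..?y} ?f = integral {0..?x} ?f + integral {?x..?y} ?f"
    using Henstock_Kurzweil_Integration.integral_combine[OF xy int[of 0 ?y]] by simp
  thus ?case using Suc.IH cell by (simp add: algebra_simps)
qed simp

text \<open>For \<open>u = sinh (ln E)\<close> and \<open>u = cosh (ln E)\<close> the two integrals are the areas of hyperbolic
  sectors.\<close>

lemma hyperbola_antiderivative:
  fixes w :: "real \<Rightarrow> real"
  assumes "(w has_real_derivative w') (at x)" "x + w x > 0"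
  shows "((\<lambda>x. (x * w x + ln (x + w x)) / 2) has_real_derivative
      ((w x + x * w') + (1 + w') / (x + w x)) / 2) (at x)"
    and "((\<lambda>x. (x * w x - ln (x + w x)) / 2) has_real_derivative
      ((w x + x * w') - (1 + w') / (x + w x)) / 2) (at x)"
  using assms by (auto intro!: derivative_eq_intros)

text \<open>\<open>\<kappa>\<close> is coth (ln E). For the sum s and the difference d of the
  coordinates \<alpha>, \<alpha>', the ray s = \<kappa> d is where \<alpha> = E^2 \<alpha>', and it
  meets the hyperbola s^2 - d^2 = 1 at d = u.\<close>

lemma integral_hyperbola_positive:
  fixes E :: real
  assumes E: "E > 1"
  defines "u \<equiv> (E - 1 / E) / 2" and "\<kappa> \<equiv> (E^2 + 1) / (E^2 - 1)"
  shows "integral {0..u} (\<lambda>x. sqrt (1 + x^2) - \<kappa> * x) = ln E / 2"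
proof -
  let ?F = "\<lambda>x. (x * sqrt (1 + x^2) + ln (x + sqrt (1 + x^2))) / 2 - \<kappa> * x^2 / 2"
  have u0: "0 \<le> u" using E unfolding u_def by (simp add: field_simps) (use mult_mono[of 1 E 1 E] in simp)
  have pos: "0 < x + sqrt (1 + x^2)" for x :: real
  proof -
    have "\<bar>x\<bar> < sqrt (1 + x^2)" by (rule real_less_rsqrt) simp
    thus ?thesis by linarith
  qed
  have "((\<lambda>x. sqrt (1 + x^2) - \<kappa> * x) has_integral ?F u - ?F 0) {0..u}"
  proof (rule fundamental_theorem_of_calculus[OF u0])
    fix x assume "x \<in> {0..u}"
    have s: "sqrt (1 + x^2) > 0" "sqrt (1 + x^2) * sqrt (1 + x^2) = 1 + x^2"
      by (simp_all add: add_pos_nonneg)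
    have "((\<lambda>x. sqrt (1 + x^2)) has_real_derivative x / sqrt (1 + x^2)) (at x)"
      using s by (auto intro!: derivative_eq_intros simp: field_simps)
    note hyperbola_antiderivative(1)[OF this pos]
    moreover have "((\<lambda>x. \<kappa> * x^2 / 2) has_real_derivative \<kappa> * x) (at x)"
      by (auto intro!: derivative_eq_intros)
    ultimately have "(?F has_real_derivative ((sqrt (1 + x^2) + x * (x / sqrt (1 + x^2)))
        + (1 + x / sqrt (1 + x^2)) / (x + sqrt (1 + x^2))) / 2 - \<kappa> * x) (at x)"
      by (rule DERIV_diff)
    also have "(1 + x / sqrt (1 + x^2)) / (x + sqrt (1 + x^2)) = 1 / sqrt (1 + x^2)"
    proof -
      have "1 + x / sqrt (1 + x^2) = (x + sqrt (1 + x^2)) / sqrt (1 + x^2)"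
        using s by (simp add: add_divide_distrib)
      thus ?thesis using pos[of x] by simp
    qed
    also have "((sqrt (1 + x^2) + x * (x / sqrt (1 + x^2))) + 1 / sqrt (1 + x^2)) / 2 = sqrt (1 + x^2)"
      using s by (simp add: field_simps power2_eq_square)
    finally show "(?F has_vector_derivative sqrt (1 + x^2) - \<kappa> * x) (at x within {0..u})"
      by (simp add: has_real_derivative_iff_has_vector_derivative has_vector_derivative_at_within)
  qed
  hence "integral {0..u} (\<lambda>x. sqrt (1 + x^2) - \<kappa> * x) = ?F u - ?F 0" by (rule integral_unique)
  also have "sqrt (1 + u^2) = (E + 1 / E) / 2"
    by (rule real_sqrt_unique) (use E in \<open>simp_all add: u_def power2_eq_square field_simps\<close>)
  also have "u * ((E + 1 / E) / 2) = \<kappa> * u^2"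
  proof -
    have "\<kappa> * u = (E + 1 / E) / 2"
    proof -
      have "E^2 - 1 \<noteq> 0" using E by (simp add: power2_eq_1_iff)
      thus ?thesis using E unfolding u_def \<kappa>_def by (simp add: power2_eq_square field_simps)
    qed
    thus ?thesis by (simp add: power2_eq_square mult.commute)
  qed
  also have "u + (E + 1 / E) / 2 = E" by (simp add: u_def field_simps)
  finally show ?thesis by (simp add: add_divide_distrib)
qed

text \<open>The part with \<alpha>' < 0: s and d exchange roles, so the ray has slope 1 / \<kappa>.
  Up to d = 1 the axis s = 0 bounds the region from below, afterwards the hyperbola d^2 - s^2 = 1,
  whence the \<open>max\<close>.\<close>

lemma integral_hyperbola_negative:
  fixes E :: real
  assumes E: "E > 1"
  defines "u \<equiv> (E + 1 / E) / 2" and "\<kappa> \<equiv> (E^2 + 1) / (E^2 - 1)"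
  shows "integral {0..u} (\<lambda>x. x / \<kappa> - sqrt (max 0 (x^2 - 1))) = ln E / 2"
proof -
  have u1: "1 \<le> u"
  proof -
    have "0 \<le> (E - 1)^2" by simp
    hence "2 * E \<le> E * E + 1" by (simp add: power2_eq_square algebra_simps)
    thus ?thesis using E unfolding u_def by (simp add: field_simps)
  qed
  have \<kappa>0: "\<kappa> > 0" using E unfolding \<kappa>_def by (intro divide_pos_pos) (auto simp: add_pos_pos)
  let ?f = "\<lambda>x. x / \<kappa> - sqrt (max 0 (x^2 - 1))"
  have int1: "(?f has_integral 1^2 / (2 * \<kappa>) - 0^2 / (2 * \<kappa>)) {0..1}"
  proof (rule has_integral_eq)
    show "((\<lambda>x. x / \<kappa>) has_integral 1^2 / (2 * \<kappa>) - 0^2 / (2 * \<kappa>)) {0..1}"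
      by (rule fundamental_theorem_of_calculus)
        (use \<kappa>0 in \<open>auto intro!: derivative_eq_intros simp: has_real_derivative_iff_has_vector_derivative[symmetric]\<close>)
    show "x / \<kappa> = ?f x" if "x \<in> {0..1}" for x :: real
      using that power_mono[of x 1 2] by simp
  qed
  let ?F = "\<lambda>x. x^2 / (2 * \<kappa>) - (x * sqrt (x^2 - 1) - ln (x + sqrt (x^2 - 1))) / 2"
  \<comment> \<open>At x = 1 the square root is continuous but not differentiable, hence the version
    asking for derivatives in the interior only.\<close>
  have int2: "(?f has_integral ?F u - ?F 1) {1..u}"
  proof (rule fundamental_theorem_of_calculus_interior[OF u1])
    have "x + sqrt (x^2 - 1) > 0" if "x \<ge> 1" for x :: real
    proof -
      have "sqrt (x^2 - 1) \<ge> 0" using that power_mono[of 1 x 2] by simp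
      thus ?thesis using that by linarith
    qed
    thus "continuous_on {1..u} ?F" using \<kappa>0 by (auto intro!: continuous_intros simp: less_imp_neq[symmetric])
    fix x assume x: "x \<in> {1<..<u}"
    have x2: "x^2 > 1" using x power_strict_mono[of 1 x 2] by simp
    hence s: "sqrt (x^2 - 1) > 0" "sqrt (x^2 - 1) * sqrt (x^2 - 1) = x^2 - 1" by simp_all
    hence pos: "x + sqrt (x^2 - 1) > 0" using x by (simp add: add_pos_pos)
    have "((\<lambda>x. sqrt (x^2 - 1)) has_real_derivative x / sqrt (x^2 - 1)) (at x)"
      using s x2 by (auto intro!: derivative_eq_intros simp: field_simps)
    note hyperbola_antiderivative(2)[OF this pos]
    moreover have "((\<lambda>x. x^2 / (2 * \<kappa>)) has_real_derivative x / \<kappa>) (at x)"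
      using \<kappa>0 by (auto intro!: derivative_eq_intros)
    ultimately have "(?F has_real_derivative x / \<kappa> - ((sqrt (x^2 - 1) + x * (x / sqrt (x^2 - 1)))
        - (1 + x / sqrt (x^2 - 1)) / (x + sqrt (x^2 - 1))) / 2) (at x)"
      by (intro DERIV_diff)
    also have "(1 + x / sqrt (x^2 - 1)) / (x + sqrt (x^2 - 1)) = 1 / sqrt (x^2 - 1)"
    proof -
      have "1 + x / sqrt (x^2 - 1) = (x + sqrt (x^2 - 1)) / sqrt (x^2 - 1)"
        using s by (simp add: add_divide_distrib)
      thus ?thesis using pos by simp
    qed
    also have "((sqrt (x^2 - 1) + x * (x / sqrt (x^2 - 1))) - 1 / sqrt (x^2 - 1)) / 2 = sqrt (x^2 - 1)"
      using s by (simp add: field_simps power2_eq_square)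
    finally show "(?F has_vector_derivative ?f x) (at x)"
      using x2 by (simp add: has_real_derivative_iff_has_vector_derivative)
  qed
  have "(?f has_integral (1^2 / (2 * \<kappa>) - 0^2 / (2 * \<kappa>)) + (?F u - ?F 1)) {0..u}"
    by (rule has_integral_combine[OF _ u1 int1 int2]) simp
  hence "integral {0..u} ?f = ?F u" by (simp add: integral_unique)
  also have "sqrt (u^2 - 1) = (E - 1 / E) / 2"
    by (rule real_sqrt_unique)
      (use E mult_mono[of 1 E 1 E] in \<open>simp_all add: u_def power2_eq_square field_simps\<close>)
  also have "u^2 / (2 * \<kappa>) = u * ((E - 1 / E) / 2) / 2"
  proof -
    have "E^2 - 1 \<noteq> 0" "E^2 + 1 \<noteq> 0" using E by (simp_all add: power2_eq_1_iff add_nonneg_eq_0_iff)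
    hence "\<kappa> * ((E - 1 / E) / 2) = u"
      using E unfolding u_def \<kappa>_def by (simp add: power2_eq_square field_simps)
    hence *: "u / \<kappa> = (E - 1 / E) / 2" using \<kappa>0 by (simp add: field_simps)
    have "u^2 / (2 * \<kappa>) = u * (u / \<kappa>) / 2" by (simp add: power2_eq_square)
    thus ?thesis unfolding * .
  qed
  also have "u + (E - 1 / E) / 2 = E" by (simp add: u_def field_simps)
  finally show ?thesis by (simp add: field_simps)
qed

section \<open>Counting lattice points slice by slice\<close>

lemma card_int_interval_ge:
  fixes lo hi c w :: real
  assumes "w > 0"
  shows "finite {m :: int. lo < w * of_int m + c \<and> w * of_int m + c \<le> hi}"
    and "(hi - lo) / w - 1 \<le> real (card {m :: int. lo < w * of_int m + c \<and> w * of_int m + c \<le> hi})"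
proof -
  let ?l = "\<lfloor>(lo - c) / w\<rfloor>" and ?h = "\<lfloor>(hi - c) / w\<rfloor>"
  have eq: "{m :: int. lo < w * of_int m + c \<and> w * of_int m + c \<le> hi} = {?l<..?h}"
  proof (intro equalityI subsetI)
    fix m :: int assume "m \<in> {m. lo < w * of_int m + c \<and> w * of_int m + c \<le> hi}"
    hence "(lo - c) / w < of_int m" "of_int m \<le> (hi - c) / w"
      using assms by (simp_all add: field_simps)
    thus "m \<in> {?l<..?h}" by (simp add: floor_less_iff le_floor_iff)
  next
    fix m :: int assume "m \<in> {?l<..?h}"
    hence "(lo - c) / w < of_int m" "of_int m \<le> (hi - c) / w"
      by (simp_all add: floor_less_iff le_floor_iff)
    thus "m \<in> {m. lo < w * of_int m + c \<and> w * of_int m + c \<le> hi}"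
      using assms by (simp add: field_simps)
  qed
  show "finite {m :: int. lo < w * of_int m + c \<and> w * of_int m + c \<le> hi}" unfolding eq by simp
  have "(hi - c) / w - 1 - (lo - c) / w \<le> of_int (?h - ?l)" by simp linarith
  also have "(hi - c) / w - 1 - (lo - c) / w = (hi - lo) / w - 1" by (simp add: diff_divide_distrib)
  also have "of_int (?h - ?l) \<le> real (nat (?h - ?l))" by simp
  also have "nat (?h - ?l) = card {?l<..?h}" by simp
  finally show "(hi - lo) / w - 1 \<le> real (card {m :: int. lo < w * of_int m + c \<and> w * of_int m + c \<le> hi})"
    unfolding eq .
qed

lemma tendsto_floor_mult:
  fixes u :: real and \<eta> :: "'a \<Rightarrow> real"
  assumes "u \<ge> 0" "\<And>x. \<eta> x > 0" "(\<eta> \<longlongrightarrow> 0) F"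
  shows "((\<lambda>x. real (nat \<lfloor>u / \<eta> x\<rfloor>) * \<eta> x) \<longlongrightarrow> u) F"
proof (rule tendsto_sandwich)
  have *: "u / \<eta> x - 1 \<le> real (nat \<lfloor>u / \<eta> x\<rfloor>)" "real (nat \<lfloor>u / \<eta> x\<rfloor>) \<le> u / \<eta> x" for x
  proof -
    have "0 \<le> u / \<eta> x" using assms(1) assms(2)[of x] by simp
    hence "real (nat \<lfloor>u / \<eta> x\<rfloor>) = of_int \<lfloor>u / \<eta> x\<rfloor>" by simp
    thus "u / \<eta> x - 1 \<le> real (nat \<lfloor>u / \<eta> x\<rfloor>)" "real (nat \<lfloor>u / \<eta> x\<rfloor>) \<le> u / \<eta> x"
      by linarith+
  qed
  have "u - \<eta> x \<le> real (nat \<lfloor>u / \<eta> x\<rfloor>) * \<eta> x" for x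
    using mult_right_mono[OF *(1)[of x], of "\<eta> x"] assms(2)[of x] by (simp add: algebra_simps)
  thus "\<forall>\<^sub>F x in F. u - \<eta> x \<le> real (nat \<lfloor>u / \<eta> x\<rfloor>) * \<eta> x" by simp
  have "real (nat \<lfloor>u / \<eta> x\<rfloor>) * \<eta> x \<le> u" for x
    using mult_right_mono[OF *(2)[of x], of "\<eta> x"] assms(2)[of x] by simp
  thus "\<forall>\<^sub>F x in F. real (nat \<lfloor>u / \<eta> x\<rfloor>) * \<eta> x \<le> u" by simp
  show "((\<lambda>x. u - \<eta> x) \<longlongrightarrow> u) F" using tendsto_diff[OF tendsto_const assms(3), of u] by simp
qed simp

text \<open>\<open>u\<close> is rarely a multiple of the step; rounding it down is absorbed by
  continuity of the indefinite integral. The minorant \<phi> is stated for every x, so that it can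
  be added up over the parts of the sector and later over the classes.\<close>

lemma riemann_sum_liminf:
  fixes g h :: "real \<Rightarrow> real"
  assumes cont: "continuous_on {0..} g" "continuous_on {0..} h"
    and mono: "mono_on {0..} g" "mono_on {0..} h" and \<eta>: "\<And>x. \<eta> x > 0" "(\<eta> \<longlongrightarrow> 0) F" and u: "u \<ge> 0"
  shows "\<exists>\<phi>. (\<phi> \<longlongrightarrow> integral {0..u} (\<lambda>x. g x - h x)) F \<and>
    (\<forall>x. \<phi> x \<le> \<eta> x * (\<Sum>n=1..nat \<lfloor>u / \<eta> x\<rfloor>. g (real n * \<eta> x) - h (real n * \<eta> x)))"
proof -
  let ?f = "\<lambda>x. g x - h x" and ?N = "\<lambda>x. nat \<lfloor>u / \<eta> x\<rfloor>"
  let ?y = "\<lambda>x. real (?N x) * \<eta> x"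
  define \<phi> where "\<phi> x = integral {0..?y x} ?f - \<eta> x * (h (?y x) - h 0)" for x
  have y: "(?y \<longlongrightarrow> u) F" by (rule tendsto_floor_mult[OF u \<eta>])
  have y0: "?y x \<ge> 0" for x using \<eta>(1)[of x] by simp
  have le: "?y x \<le> u" for x
  proof -
    have "0 \<le> u / \<eta> x" using u \<eta>(1)[of x] by simp
    hence "real (?N x) \<le> u / \<eta> x" by linarith
    thus ?thesis using \<eta>(1)[of x] by (simp add: field_simps)
  qed
  have "?f integrable_on {0..u}"
    by (intro integrable_continuous_real continuous_on_diff continuous_on_subset[OF cont(1)]
      continuous_on_subset[OF cont(2)]) auto
  hence "continuous_on {0..u} (\<lambda>t. integral {0..t} ?f)" by (rule indefinite_integral_continuous_1)
  hence 1: "((\<lambda>x. integral {0..?y x} ?f) \<longlongrightarrow> integral {0..u} ?f) F"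
    by (rule continuous_on_tendsto_compose[OF _ y]) (use u y0 le in auto)
  have 2: "((\<lambda>x. h (?y x)) \<longlongrightarrow> h u) F"
    by (rule continuous_on_tendsto_compose[OF cont(2) y]) (use u y0 in auto)
  have "(\<phi> \<longlongrightarrow> integral {0..u} ?f - 0 * (h u - h 0)) F"
    unfolding \<phi>_def by (intro tendsto_intros 1 2 \<eta>(2))
  moreover have "\<phi> x \<le> \<eta> x * (\<Sum>n=1..?N x. ?f (real n * \<eta> x))" for x
    unfolding \<phi>_def by (rule riemann_sum_mono_diff[OF cont mono \<eta>(1)])
  ultimately show ?thesis by auto
qed

text \<open>\<open>2 a m + c n\<close> and \<open>n r\<close> are the sum and the difference of the coordinates \<open>\<alpha>\<close>, \<open>\<alpha>'\<close> of a
  lattice point; in the application \<open>\<alpha>'\<close> is the conjugate of \<open>\<alpha>\<close>.\<close>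

definition sector_points :: "real \<Rightarrow> real \<Rightarrow> (nat \<Rightarrow> real) \<Rightarrow> real \<Rightarrow> real \<Rightarrow> (int \<times> nat) set" where
  "sector_points r a c E Z = {(m, n).
     let \<alpha> = (2 * a * of_int m + c n + real n * r) / 2; \<alpha>' = (2 * a * of_int m + c n - real n * r) / 2
     in 0 < \<alpha> \<and> \<bar>\<alpha>'\<bar> < \<alpha> \<and> \<alpha> \<le> E^2 * \<bar>\<alpha>'\<bar> \<and> \<alpha> * \<bar>\<alpha>'\<bar> \<le> Z}"

text \<open>On the line of fixed difference \<open>d\<close>, the part of the sector with \<alpha>'
  > 0 is an interval for the sum \<open>s\<close>, from the ray \<alpha> = E^2 \<alpha>' up to the
  hyperbola \<alpha> \<alpha>' = Z.\<close>

lemma sector_points_positive: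
  fixes m :: int and n :: nat and c :: "nat \<Rightarrow> real" and a r E Z :: real
  assumes r: "r > 0" and E: "E > 1" and n: "n \<ge> 1"
  defines "s \<equiv> 2 * a * of_int m + c n" and "d \<equiv> real n * r" and "\<kappa> \<equiv> (E^2 + 1) / (E^2 - 1)"
  assumes lo: "\<kappa> * d < s" and hi: "s \<le> sqrt (4 * Z + d^2)" and Z: "Z > 0"
  shows "(m, n) \<in> sector_points r a c E Z" "d < s"
proof -
  have d: "d > 0" unfolding d_def using r n by simp
  have E2: "E^2 > 1" using E power_strict_mono[of 1 E 2] by simp
  have "\<kappa> \<ge> 1" using E2 unfolding \<kappa>_def by simp
  hence "d \<le> \<kappa> * d" using d by simp
  thus ds: "d < s" using lo by simp
  have "d * (E^2 + 1) < s * (E^2 - 1)"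
    using lo E2 unfolding \<kappa>_def by (simp add: field_simps)
  hence "s + d \<le> E^2 * (s - d)" by (simp add: algebra_simps)
  hence 1: "(s + d) / 2 \<le> E^2 * ((s - d) / 2)" by simp
  have "s^2 \<le> (sqrt (4 * Z + d^2))^2" using hi ds d by (intro power_mono) auto
  also have "\<dots> = 4 * Z + d^2" using Z by simp
  finally have 2: "(s + d) / 2 * ((s - d) / 2) \<le> Z" by (simp add: power2_eq_square algebra_simps)
  show "(m, n) \<in> sector_points r a c E Z"
    unfolding sector_points_def Let_def mem_Collect_eq prod.case s_def[symmetric] d_def[symmetric]
    using 1 2 d ds by simp
qed

lemma sector_points_negative:
  fixes m :: int and n :: nat and c :: "nat \<Rightarrow> real" and a r E Z :: real
  assumes r: "r > 0" and E: "E > 1" and n: "n \<ge> 1"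
  defines "s \<equiv> 2 * a * of_int m + c n" and "d \<equiv> real n * r" and "\<kappa> \<equiv> (E^2 + 1) / (E^2 - 1)"
  assumes lo: "sqrt (max 0 (d^2 - 4 * Z)) < s" and hi: "s \<le> d / \<kappa>" and Z: "Z > 0"
  shows "(m, n) \<in> sector_points r a c E Z" "s < d"
proof -
  have d: "d > 0" unfolding d_def using r n by simp
  have E2: "E^2 > 1" using E power_strict_mono[of 1 E 2] by simp
  have k1: "\<kappa> > 1" using E2 unfolding \<kappa>_def by simp
  hence "d / \<kappa> < d" using d by (simp add: field_simps)
  thus sd: "s < d" using hi by simp
  have s0: "s > 0" using lo real_sqrt_ge_zero[of "max 0 (d^2 - 4 * Z)"] by linarith
  have "s * (E^2 + 1) \<le> d * (E^2 - 1)"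
  proof -
    have "s * \<kappa> \<le> d" using hi k1 by (simp add: field_simps)
    thus ?thesis using E2 unfolding \<kappa>_def by (simp add: field_simps)
  qed
  hence "s + d \<le> E^2 * (d - s)" by (simp add: algebra_simps)
  hence 1: "(s + d) / 2 \<le> E^2 * ((d - s) / 2)" by simp
  have "(sqrt (max 0 (d^2 - 4 * Z)))^2 \<le> s^2" using lo by (intro power_mono) auto
  hence "d^2 - 4 * Z \<le> s^2" by simp
  hence 2: "(s + d) / 2 * ((d - s) / 2) \<le> Z" by (simp add: power2_eq_square algebra_simps)
  show "(m, n) \<in> sector_points r a c E Z"
    unfolding sector_points_def Let_def mem_Collect_eq prod.case s_def[symmetric] d_def[symmetric]
    using 1 2 d sd s0 by simp
qed

lemma card_swap_Sigma:
  assumes "finite I" "\<And>n. n \<in> I \<Longrightarrow> finite (A n)"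
  shows "finite {(m, n). n \<in> I \<and> m \<in> A n}" "card {(m, n). n \<in> I \<and> m \<in> A n} = (\<Sum>n\<in>I. card (A n))"
proof -
  have eq: "{(m, n). n \<in> I \<and> m \<in> A n} = prod.swap ` Sigma I A" by (auto simp: image_iff)
  show "finite {(m, n). n \<in> I \<and> m \<in> A n}" unfolding eq using assms by auto
  show "card {(m, n). n \<in> I \<and> m \<in> A n} = (\<Sum>n\<in>I. card (A n))"
    unfolding eq using assms by (subst card_image) (auto simp: card_SigmaI)
qed

text \<open>The sums in one slice are spaced by 2 a, and a slice loses at most one point to its
  ends. In the application the step is of order 1 / sqrt Z, so the total loss u / \<eta> is of order
  sqrt Z against a main term of order Z.\<close>

lemma sum_card_slices_ge:
  fixes lo hi :: "nat \<Rightarrow> real" and f :: "real \<Rightarrow> real"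
  assumes a: "a > 0" and Z: "Z > 0" and \<eta>: "\<eta> > 0" and u: "u \<ge> 0"
    and slice: "\<And>n. hi n - lo n = 2 * sqrt Z * f (real n * \<eta>)"
    and \<phi>: "\<phi> \<le> \<eta> * (\<Sum>n=1..nat \<lfloor>u / \<eta>\<rfloor>. f (real n * \<eta>))"
  shows "sqrt Z / (a * \<eta>) * \<phi> - u / \<eta> \<le>
    real (\<Sum>n=1..nat \<lfloor>u / \<eta>\<rfloor>. card {m :: int. lo n < 2 * a * of_int m + c n \<and> 2 * a * of_int m + c n \<le> hi n})"
proof -
  let ?N = "nat \<lfloor>u / \<eta>\<rfloor>"
  have "0 \<le> u / \<eta>" using u \<eta> by simp
  hence N: "real ?N \<le> u / \<eta>" by linarith
  have "sqrt Z / (a * \<eta>) * \<phi> \<le> sqrt Z / (a * \<eta>) * (\<eta> * (\<Sum>n=1..?N. f (real n * \<eta>)))"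
    using \<phi> a Z \<eta> by (intro mult_left_mono) auto
  also have "\<dots> = (\<Sum>n=1..?N. sqrt Z / a * f (real n * \<eta>))"
    using \<eta> by (simp add: sum_distrib_left)
  finally have "sqrt Z / (a * \<eta>) * \<phi> - u / \<eta> \<le> (\<Sum>n=1..?N. sqrt Z / a * f (real n * \<eta>)) - real ?N"
    using N by linarith
  also have "\<dots> = (\<Sum>n=1..?N. sqrt Z / a * f (real n * \<eta>) - 1)" by (simp add: sum_subtractf)
  also have "\<dots> \<le> (\<Sum>n=1..?N. real (card {m :: int. lo n < 2 * a * of_int m + c n \<and> 2 * a * of_int m + c n \<le> hi n}))"
  proof (rule sum_mono)
    fix n
    have "sqrt Z / a * f (real n * \<eta>) - 1 = (hi n - lo n) / (2 * a) - 1" using a by (simp add: slice)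
    thus "sqrt Z / a * f (real n * \<eta>) - 1 \<le> real (card {m :: int. lo n < 2 * a * of_int m + c n \<and> 2 * a * of_int m + c n \<le> hi n})"
      using card_int_interval_ge(2)[of "2 * a" "hi n" "lo n" "c n"] a by simp
  qed
  finally show ?thesis by simp
qed

text \<open>Dividing coordinates by 2 sqrt Z turns s^2 - d^2 = 4 Z into the unit hyperbola and the
  spacing \<open>r\<close> of the slices into \<open>\<eta>\<close>. The two signs of \<alpha>'
  contribute an area of ln E / 2 each, multiplied by 2 / r.\<close>

lemma sector_points_count:
  fixes r a E :: real and c :: "nat \<Rightarrow> real"
  assumes r: "r > 0" and a: "a > 0" and E: "E > 1"
  shows "\<exists>\<phi>. \<phi> \<longlonglongrightarrow> 2 * ln E / r \<and> (\<forall>x. \<exists>P. P \<subseteq> sector_points r a c E (a * real (Suc x)) \<and> finite P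
    \<and> \<phi> x * real (Suc x) \<le> real (card P))"
proof -
  define \<kappa> where "\<kappa> = (E^2 + 1) / (E^2 - 1)"
  define u1 u2 where "u1 = (E - 1 / E) / 2" and "u2 = (E + 1 / E) / 2"
  define \<eta> where "\<eta> x = r / (2 * sqrt (a * real (Suc x)))" for x :: nat
  have E2: "E^2 > 1" using E power_strict_mono[of 1 E 2] by simp
  have k1: "\<kappa> > 1" using E2 unfolding \<kappa>_def by simp
  have u1: "u1 \<ge> 0" using E E2 unfolding u1_def by (simp add: field_simps power2_eq_square)
  have u2: "u2 \<ge> 0" using E unfolding u2_def by simp
  have \<eta>: "\<eta> x > 0" for x using r a by (simp add: \<eta>_def)
  have \<eta>0: "\<eta> \<longlonglongrightarrow> 0" unfolding \<eta>_def using r a by real_asymp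
  let ?f1 = "\<lambda>x. sqrt (1 + x^2) - \<kappa> * x" and ?f2 = "\<lambda>x. x / \<kappa> - sqrt (max 0 (x^2 - 1))"
  have mono: "mono_on {0..} (\<lambda>x::real. sqrt (1 + x^2))" "mono_on {0..} (\<lambda>x. \<kappa> * x)"
    "mono_on {0..} (\<lambda>x. x / \<kappa>)" "mono_on {0..} (\<lambda>x::real. sqrt (max 0 (x^2 - 1)))"
    using k1 by (auto intro!: mono_onI real_sqrt_le_mono mult_left_mono divide_right_mono max.mono power_mono)
  have cont: "continuous_on {0..} (\<lambda>x::real. sqrt (1 + x^2))" "continuous_on {0..} (\<lambda>x. \<kappa> * x)"
    "continuous_on {0..} (\<lambda>x. x / \<kappa>)" "continuous_on {0..} (\<lambda>x::real. sqrt (max 0 (x^2 - 1)))"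
    using k1 by (auto intro!: continuous_intros)
  obtain \<phi>1 where \<phi>1: "\<phi>1 \<longlonglongrightarrow> integral {0..u1} ?f1"
      "\<And>x. \<phi>1 x \<le> \<eta> x * (\<Sum>n=1..nat \<lfloor>u1 / \<eta> x\<rfloor>. ?f1 (real n * \<eta> x))"
    using riemann_sum_liminf[OF cont(1,2) mono(1,2) \<eta> \<eta>0 u1] by blast
  obtain \<phi>2 where \<phi>2: "\<phi>2 \<longlonglongrightarrow> integral {0..u2} ?f2"
      "\<And>x. \<phi>2 x \<le> \<eta> x * (\<Sum>n=1..nat \<lfloor>u2 / \<eta> x\<rfloor>. ?f2 (real n * \<eta> x))"
    using riemann_sum_liminf[OF cont(3,4) mono(3,4) \<eta> \<eta>0 u2] by blast
  define \<phi> where "\<phi> x = 2 / r * \<phi>1 x + 2 / r * \<phi>2 x - (u1 + u2) * (2 * sqrt a / r / sqrt (real (Suc x)))" for x :: nat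
  have "\<phi> \<longlonglongrightarrow> 2 / r * (ln E / 2) + 2 / r * (ln E / 2) - (u1 + u2) * 0"
    unfolding \<phi>_def
  proof (intro tendsto_intros)
    show "\<phi>1 \<longlonglongrightarrow> ln E / 2" 
      using \<phi>1(1) unfolding u1_def \<kappa>_def integral_hyperbola_positive[OF E] .
    show "\<phi>2 \<longlonglongrightarrow> ln E / 2" 
      using \<phi>2(1) unfolding u2_def \<kappa>_def integral_hyperbola_negative[OF E] .
    show "(\<lambda>x. 2 * sqrt a / r / sqrt (real (Suc x))) \<longlonglongrightarrow> 0" using a r by real_asymp
  qed
  hence lim: "\<phi> \<longlonglongrightarrow> 2 * ln E / r" by (simp add: field_simps)
  have "\<exists>P. P \<subseteq> sector_points r a c E (a * real (Suc x)) \<and> finite P \<and> \<phi> x * real (Suc x) \<le> real (card P)" for x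
  proof -
    define Z where "Z = a * real (Suc x)"
    have Z: "Z > 0" using a by (simp add: Z_def)
    have d\<eta>: "real n * r = 2 * sqrt Z * (real n * \<eta> x)" for n
      using Z a by (simp add: \<eta>_def Z_def)
    define lo1 hi1 lo2 hi2 where "lo1 n = \<kappa> * (real n * r)" and "hi1 n = sqrt (4 * Z + (real n * r)^2)"
      and "lo2 n = sqrt (max 0 ((real n * r)^2 - 4 * Z))" and "hi2 n = real n * r / \<kappa>" for n
    define A1 A2 where
      "A1 n = {m :: int. lo1 n < 2 * a * of_int m + c n \<and> 2 * a * of_int m + c n \<le> hi1 n}" and
      "A2 n = {m :: int. lo2 n < 2 * a * of_int m + c n \<and> 2 * a * of_int m + c n \<le> hi2 n}" for n
    let ?I1 = "{1..nat \<lfloor>u1 / \<eta> x\<rfloor>}" and ?I2 = "{1..nat \<lfloor>u2 / \<eta> x\<rfloor>}"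
    define P1 P2 where "P1 = {(m, n). n \<in> ?I1 \<and> m \<in> A1 n}" and "P2 = {(m, n). n \<in> ?I2 \<and> m \<in> A2 n}"
    have fin: "finite (A1 n)" "finite (A2 n)" for n
      unfolding A1_def A2_def using card_int_interval_ge(1)[of "2 * a"] a by simp_all
    have P1: "finite P1" "card P1 = (\<Sum>n\<in>?I1. card (A1 n))"
      unfolding P1_def using card_swap_Sigma[of ?I1 A1] fin by simp_all
    have P2: "finite P2" "card P2 = (\<Sum>n\<in>?I2. card (A2 n))"
      unfolding P2_def using card_swap_Sigma[of ?I2 A2] fin by simp_all
    have in1: "(m, n) \<in> sector_points r a c E Z \<and> real n * r < 2 * a * of_int m + c n" if "(m, n) \<in> P1" for m n
      using that sector_points_positive[OF r E, where n = n and c = c and a = a and m = m and Z = Z] Z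
      unfolding P1_def A1_def lo1_def hi1_def \<kappa>_def by auto
    have in2: "(m, n) \<in> sector_points r a c E Z \<and> 2 * a * of_int m + c n < real n * r" if "(m, n) \<in> P2" for m n
      using that sector_points_negative[OF r E, where n = n and c = c and a = a and m = m and Z = Z] Z
      unfolding P2_def A2_def lo2_def hi2_def \<kappa>_def by auto
    \<comment> \<open>The sum exceeds the difference in one family and falls short of it in the
      other, which is the sign of \<alpha>'.\<close>
    have "P1 \<inter> P2 = {}" using in1 in2 by fastforce
    hence card: "card (P1 \<union> P2) = card P1 + card P2" using P1 P2 by (simp add: card_Un_disjoint)
    have s1: "hi1 n - lo1 n = 2 * sqrt Z * ?f1 (real n * \<eta> x)" for n
    proof -
      have "4 * Z + (real n * r)^2 = (2 * sqrt Z)^2 * (1 + (real n * \<eta> x)^2)"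
        unfolding d\<eta> using Z by (simp add: power_mult_distrib algebra_simps)
      hence "hi1 n = 2 * sqrt Z * sqrt (1 + (real n * \<eta> x)^2)"
        unfolding hi1_def using Z by (simp add: real_sqrt_mult)
      thus ?thesis unfolding lo1_def d\<eta> by (simp add: algebra_simps)
    qed
    have s2: "hi2 n - lo2 n = 2 * sqrt Z * ?f2 (real n * \<eta> x)" for n
    proof -
      have "max 0 ((real n * r)^2 - 4 * Z) = (2 * sqrt Z)^2 * max 0 ((real n * \<eta> x)^2 - 1)"
        unfolding d\<eta> using Z by (simp add: power_mult_distrib algebra_simps max_def)
      hence "lo2 n = 2 * sqrt Z * sqrt (max 0 ((real n * \<eta> x)^2 - 1))"
        unfolding lo2_def using Z by (simp add: real_sqrt_mult)
      thus ?thesis unfolding hi2_def d\<eta> by (simp add: algebra_simps)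
    qed
    have c1: "sqrt Z / (a * \<eta> x) * \<phi>1 x - u1 / \<eta> x \<le> real (card P1)"
      unfolding P1(2) A1_def by (rule sum_card_slices_ge[OF a Z \<eta> u1 s1 \<phi>1(2)])
    have c2: "sqrt Z / (a * \<eta> x) * \<phi>2 x - u2 / \<eta> x \<le> real (card P2)"
      unfolding P2(2) A2_def by (rule sum_card_slices_ge[OF a Z \<eta> u2 s2 \<phi>2(2)])
    have e1: "sqrt Z / (a * \<eta> x) = 2 / r * real (Suc x)"
    proof -
      have "sqrt Z / (a * \<eta> x) = 2 * (sqrt Z * sqrt Z) / (a * r)" by (simp add: \<eta>_def Z_def)
      also have "sqrt Z * sqrt Z = a * real (Suc x)" using Z by (simp add: Z_def)
      finally show ?thesis using a by simp
    qed
    have e2: "u / \<eta> x = u * (2 * sqrt a / r / sqrt (real (Suc x))) * real (Suc x)" for u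
    proof -
      define w where "w = sqrt (real (Suc x))"
      have w: "w \<noteq> 0" "real (Suc x) = w * w" by (simp_all add: w_def)
      have "\<eta> x = r / (2 * (sqrt a * w))" by (simp add: \<eta>_def real_sqrt_mult w_def)
      hence "u / \<eta> x = u * (2 * sqrt a / r / w) * (w * w)" using w(1) by simp
      thus ?thesis unfolding w(2)[symmetric] unfolding w_def .
    qed
    define R T y where "R = 2 / r" and "T = 2 * sqrt a / r / sqrt (real (Suc x))" and "y = real (Suc x)"
    have "\<phi> x * y = (R * y * \<phi>1 x - u1 * T * y) + (R * y * \<phi>2 x - u2 * T * y)"
      unfolding \<phi>_def R_def[symmetric] T_def[symmetric] by (simp add: algebra_simps)
    hence "\<phi> x * real (Suc x) \<le> real (card (P1 \<union> P2))"
      using c1 c2 unfolding e1 e2 card R_def T_def y_def by simp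
    thus ?thesis using in1 in2 P1 P2 unfolding Z_def by (intro exI[of _ "P1 \<union> P2"]) auto
  qed
  thus ?thesis using lim by blast
qed

section \<open>Ideals and units of the maximal order\<close>

lemma int_subgroup_cyclic:
  fixes S :: "int set"
  assumes diff: "\<And>x y. x \<in> S \<Longrightarrow> y \<in> S \<Longrightarrow> x - y \<in> S" and mult: "\<And>x t. x \<in> S \<Longrightarrow> t * x \<in> S"
    and nz: "s \<in> S" "s \<noteq> 0"
  shows "\<exists>g>0. g \<in> S \<and> (\<forall>x\<in>S. g dvd x)"
proof -
  define g where "g = (LEAST n::nat. n > 0 \<and> int n \<in> S)"
  have "\<bar>s\<bar> \<in> S" using nz(1) mult[of s "-1"] by (auto simp: abs_if)
  hence "nat \<bar>s\<bar> > 0 \<and> int (nat \<bar>s\<bar>) \<in> S" using nz by simp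
  hence g: "g > 0 \<and> int g \<in> S" unfolding g_def by (rule LeastI)
  have "int g dvd x" if x: "x \<in> S" for x
  proof (rule ccontr)
    assume "\<not> int g dvd x"
    hence "x mod int g \<noteq> 0" by (simp only: dvd_eq_mod_eq_0 not_False_eq_True)
    moreover have "x mod int g \<ge> 0" using g by simp
    ultimately have pos: "x mod int g > 0" by linarith
    have "x mod int g = x - (x div int g) * int g" by (simp add: minus_div_mult_eq_mod)
    also have "\<dots> \<in> S" using g x diff mult by blast
    finally have "nat (x mod int g) > 0 \<and> int (nat (x mod int g)) \<in> S" using pos by simp
    hence "g \<le> nat (x mod int g)" unfolding g_def by (rule Least_le)
    moreover have "x mod int g < int g" using g by simp
    ultimately show False using pos by linarith
  qed
  thus ?thesis using g by (intro exI[of _ "int g"]) auto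
qed

locale real_quadratic_order = jacobi_modulus +
  assumes disc: "real_quadratic_discriminant q"
begin

abbreviation "R \<equiv> quadratic_integers q"
abbreviation "\<O> \<equiv> carrier (quadratic_integers q)"
abbreviation "w \<equiv> omega q"
abbreviation "w' \<equiv> 1 - omega q"
abbreviation "k \<equiv> (q - 1) div 4"

lemma irrational: "sqrt (of_int q) \<notin> \<rat>"
  using disc by (simp add: real_quadratic_discriminant_def)

lemma four_k: "4 * k = q - 1"
  using q_mod_8 by presburger

lemma even_k: "even k"
  using q_mod_8 by presburger

lemma omega_diff: "w - w' = sqrt (of_int q)"
  by (simp add: omega_def field_simps)

lemma omega_square: "w * w = w + of_int k"
proof -
  have "(of_int (4 * k) :: real) = of_int (q - 1)" unfolding four_k ..
  thus ?thesis using q_gt_1 by (simp add: omega_def field_simps)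
qed

lemma omega_norm: "w * w' = - of_int k"
  using omega_square by (simp add: algebra_simps)

lemma omega_irrational: "w \<notin> \<rat>"
proof
  assume "w \<in> \<rat>"
  hence "2 * w - 1 \<in> \<rat>" by simp
  thus False using irrational by (simp add: omega_def field_simps)
qed

lemma coords_unique:
  fixes x y x' y' :: int
  assumes "of_int x + of_int y * w = of_int x' + of_int y' * w"
  shows "x = x'" "y = y'"
  using quadratic_field_coords_unique[OF omega_irrational _ _ _ _ assms] by simp_all

lemma carrier_eq: "\<O> = {of_int x + of_int y * w | x y. True}"
  by (rule carrier_quadratic_integers[OF disc odd_q])

lemma carrierI: "of_int x + of_int y * w \<in> \<O>"
  unfolding carrier_eq by blast

lemma carrierE:
  assumes "z \<in> \<O>"
  obtains x y where "z = of_int x + of_int y * w"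
  using assms unfolding carrier_eq by blast

lemma of_int_in_carrier: "of_int x \<in> \<O>"
  using carrierI[of x 0] by simp

lemma omega_in_carrier: "w \<in> \<O>"
  using carrierI[of 0 1] by simp

lemma carrier_add: "z \<in> \<O> \<Longrightarrow> v \<in> \<O> \<Longrightarrow> z + v \<in> \<O>"
proof (elim carrierE)
  fix x y x' y' assume "z = of_int x + of_int y * w" "v = of_int x' + of_int y' * w"
  hence "z + v = of_int (x + x') + of_int (y + y') * w" by (simp add: algebra_simps)
  thus "z + v \<in> \<O>" using carrierI by metis
qed

lemma carrier_mult: "z \<in> \<O> \<Longrightarrow> v \<in> \<O> \<Longrightarrow> z * v \<in> \<O>"
proof (elim carrierE)
  fix x y x' y' assume z: "z = of_int x + of_int y * w" "v = of_int x' + of_int y' * w"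
  have "z * v = of_int (x * x') + of_int (x * y' + y * x') * w + of_int (y * y') * (w * w)"
    unfolding z by (simp add: algebra_simps)
  also have "\<dots> = of_int (x * x' + y * y' * k) + of_int (x * y' + y * x' + y * y') * w"
    unfolding omega_square by (simp add: algebra_simps)
  finally show "z * v \<in> \<O>" using carrierI by metis
qed

lemma carrier_minus: "z \<in> \<O> \<Longrightarrow> - z \<in> \<O>"
  using carrier_mult[OF of_int_in_carrier[of "-1"], of z] by simp

lemma carrier_diff: "z \<in> \<O> \<Longrightarrow> v \<in> \<O> \<Longrightarrow> z - v \<in> \<O>"
  using carrier_add[of z "- v"] carrier_minus[of v] by simp

lemma ring_simps: "mult R = (*)" "one R = 1" "zero R = 0" "add R = (+)"
  by (simp_all add: quadratic_integers_def)

lemma ring_quadratic_integers: "ring R"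
proof (rule ringI)
  show "abelian_group R"
  proof (rule abelian_groupI)
    fix x assume "x \<in> \<O>"
    thus "\<exists>y\<in>\<O>. y \<oplus>\<^bsub>R\<^esub> x = \<zero>\<^bsub>R\<^esub>"
      using carrier_minus by (intro bexI[of _ "- x"]) (simp_all add: ring_simps)
  qed (use of_int_in_carrier[of 0] in \<open>simp_all add: ring_simps carrier_add\<close>)
  show "Group.monoid R"
    by (rule monoidI) (use of_int_in_carrier[of 1] in \<open>simp_all add: ring_simps carrier_mult\<close>)
qed (simp_all add: ring_simps algebra_simps)

lemma a_inv_eq: "z \<in> \<O> \<Longrightarrow> \<ominus>\<^bsub>R\<^esub> z = - z"
  using carrier_minus[of z]
    abelian_group.minus_equality[OF ring.is_abelian_group[OF ring_quadratic_integers], of "- z" z]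
  by (simp add: ring_simps)

lemma ideal_iff:
  "ideal I R \<longleftrightarrow> I \<subseteq> \<O> \<and> 0 \<in> I \<and> (\<forall>x\<in>I. \<forall>y\<in>I. x + y \<in> I) \<and> (\<forall>x\<in>I. \<forall>z\<in>\<O>. z * x \<in> I)"
proof
  assume I: "ideal I R"
  interpret ideal I R by fact
  have "I \<subseteq> \<O>" by (rule a_subset)
  moreover have "0 \<in> I" using additive_subgroup.zero_closed[OF is_additive_subgroup] by (simp add: ring_simps)
  moreover have "x + y \<in> I" if "x \<in> I" "y \<in> I" for x y
    using additive_subgroup.a_closed[OF is_additive_subgroup that] by (simp add: ring_simps)
  moreover have "z * x \<in> I" if "x \<in> I" "z \<in> \<O>" for x z
    using I_l_closed that by (simp add: ring_simps)
  ultimately show "I \<subseteq> \<O> \<and> 0 \<in> I \<and> (\<forall>x\<in>I. \<forall>y\<in>I. x + y \<in> I) \<and> (\<forall>x\<in>I. \<forall>z\<in>\<O>. z * x \<in> I)"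
    by blast
next
  assume *: "I \<subseteq> \<O> \<and> 0 \<in> I \<and> (\<forall>x\<in>I. \<forall>y\<in>I. x + y \<in> I) \<and> (\<forall>x\<in>I. \<forall>z\<in>\<O>. z * x \<in> I)"
  show "ideal I R"
  proof (rule idealI[OF ring_quadratic_integers])
    show "subgroup I (add_monoid R)"
    proof
      fix x assume x: "x \<in> I"
      have "inv\<^bsub>add_monoid R\<^esub> x = - x" using a_inv_eq[of x] x * unfolding a_inv_def by blast
      moreover have "of_int (-1) * x \<in> I" using * x of_int_in_carrier by blast
      ultimately show "inv\<^bsub>add_monoid R\<^esub> x \<in> I" by simp
    qed (use * in \<open>auto simp: ring_simps\<close>)
  qed (use * in \<open>auto simp: ring_simps mult.commute\<close>)
qed

section \<open>Conjugation, norms and units\<close>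

definition conj :: "real \<Rightarrow> real" where "conj = quadratic_conj q"

lemma conj_coords: "conj (of_int x + of_int y * w) = of_int x + of_int y * w'"
proof -
  have "of_int x + of_int y * w = (of_int x + of_int y / 2) + (of_int y / 2) * sqrt (of_int q)"
    by (simp add: omega_def field_simps)
  moreover have "quadratic_conj q \<dots> = (of_int x + of_int y / 2) - (of_int y / 2) * sqrt (of_int q)"
    by (rule quadratic_conj_eq[OF irrational]) simp_all
  ultimately show ?thesis by (simp add: conj_def omega_def field_simps)
qed

lemma conj_of_int: "conj (of_int x) = of_int x"
  using conj_coords[of x 0] by simp

lemma conj_add: "z \<in> \<O> \<Longrightarrow> v \<in> \<O> \<Longrightarrow> conj (z + v) = conj z + conj v"
proof (elim carrierE)
  fix x y x' y' assume z: "z = of_int x + of_int y * w" "v = of_int x' + of_int y' * w"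
  have "z + v = of_int (x + x') + of_int (y + y') * w" unfolding z by (simp add: algebra_simps)
  hence "conj (z + v) = of_int (x + x') + of_int (y + y') * w'" by (simp only: conj_coords)
  thus "conj (z + v) = conj z + conj v" unfolding z conj_coords by (simp add: algebra_simps)
qed

lemma conj_mult: "z \<in> \<O> \<Longrightarrow> v \<in> \<O> \<Longrightarrow> conj (z * v) = conj z * conj v"
proof (elim carrierE)
  fix x y x' y' assume z: "z = of_int x + of_int y * w" "v = of_int x' + of_int y' * w"
  have "z * v = of_int (x * x') + of_int (x * y' + y * x') * w + of_int (y * y') * (w * w)"
    unfolding z by (simp add: algebra_simps)
  also have "\<dots> = of_int (x * x' + y * y' * k) + of_int (x * y' + y * x' + y * y') * w"
    unfolding omega_square by (simp add: algebra_simps)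
  finally have "conj (z * v) = of_int (x * x' + y * y' * k) + of_int (x * y' + y * x' + y * y') * w'"
    by (simp only: conj_coords)
  also have "\<dots> = of_int (x * x') + of_int (x * y' + y * x') * w' + of_int (y * y') * (w' + of_int k)"
    by (simp add: algebra_simps)
  also have "w' + of_int k = w' * w'" using omega_square by (simp add: algebra_simps)
  finally show "conj (z * v) = conj z * conj v"
    unfolding z conj_coords by (simp add: algebra_simps)
qed

lemma norm_coords:
  "(of_int x + of_int y * w) * (of_int x + of_int y * w') = of_int (x^2 + x * y - k * y^2)"
proof -
  have "(of_int x + of_int y * w) * (of_int x + of_int y * w') =
    of_int (x^2 + x * y) + of_int (y^2) * (w * w')"
    by (simp add: power2_eq_square algebra_simps)
  thus ?thesis unfolding omega_norm by (simp add: mult.commute)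
qed

lemma norm_int: "z \<in> \<O> \<Longrightarrow> \<exists>n :: int. z * conj z = of_int n"
  by (elim carrierE) (metis conj_coords norm_coords)

lemma conj_in_carrier: "z \<in> \<O> \<Longrightarrow> conj z \<in> \<O>"
proof (elim carrierE)
  fix x y assume z: "z = of_int x + of_int y * w"
  have "conj z = of_int (x + y) + of_int (- y) * w" unfolding z conj_coords by (simp add: algebra_simps)
  thus "conj z \<in> \<O>" using carrierI by metis
qed

lemma conj_eq_0_iff: "z \<in> \<O> \<Longrightarrow> conj z = 0 \<longleftrightarrow> z = 0"
proof (elim carrierE)
  fix x y assume z: "z = of_int x + of_int y * w"
  have "conj z = of_int (x + y) + of_int (- y) * w" unfolding z conj_coords by (simp add: algebra_simps)
  thus "conj z = 0 \<longleftrightarrow> z = 0"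
    using coords_unique[of "x + y" "- y" 0 0] coords_unique[of x y 0 0] z by auto
qed

text \<open>Here \<open>\<chi>(2) = 1\<close> enters: \<open>k\<close> is even, hence so is the coefficient of \<open>\<omega>\<close> in a unit. This doubles
  the trivial lower bound for units above \<open>1\<close>, and the gain \<open>ln 2\<close> in the regulator outweighs the
  constant in the upper bound for \<open>L(1, \<chi>)\<close>.\<close>

definition unit_bound :: real where "unit_bound = sqrt (of_int q) + sqrt (of_int q - 1)"

lemma unit_bound_gt_1: "unit_bound > 1"
proof -
  have "1 < sqrt (of_int q)" "0 \<le> sqrt (of_int q - 1)" using q_gt_1 by simp_all
  thus ?thesis unfolding unit_bound_def by linarith
qed

text \<open>A coefficient of \<open>w\<close> that is even and nonzero gives u + 1 / u >= |u - conj
  u| >= 2 sqrt q. \<open>unit_bound\<close> is the larger root of t^2 - 2 sqrt q t + 1; the other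
  root lies below 1, so \<open>u\<close> must clear the larger one.\<close>

lemma unit_ge_bound:
  assumes "u \<in> \<O>" "\<bar>u * conj u\<bar> = 1" "u > 1"
  shows "u \<ge> unit_bound"
proof (rule ccontr)
  assume less: "\<not> u \<ge> unit_bound"
  obtain x y where u: "u = of_int x + of_int y * w" using assms(1) by (rule carrierE)
  have cu: "conj u = of_int x + of_int y * w'" unfolding u conj_coords ..
  have "(of_int \<bar>x^2 + x * y - k * y^2\<bar> :: real) = of_int 1"
    using assms(2) unfolding cu unfolding u norm_coords by simp
  hence "\<bar>x^2 + x * y - k * y^2\<bar> = 1" by (simp only: of_int_eq_iff)
  hence "odd (x^2 + x * y - k * y^2)" by presburger
  hence "odd (x * (x + y))" using even_k by (simp add: power2_eq_square algebra_simps)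
  hence "even y" by auto
  moreover have "y \<noteq> 0"
  proof
    assume "y = 0"
    hence "u = of_int x" "conj u = of_int x" using u cu by auto
    hence "u * u = 1 \<or> u * u = - 1" using assms(2) by (auto simp: abs_if split: if_splits)
    moreover have "u * u > 1" using assms(3) less_1_mult by blast
    ultimately show False by linarith
  qed
  ultimately have "2 \<le> \<bar>y\<bar>" by presburger
  have "2 * sqrt (of_int q) \<le> \<bar>of_int y\<bar> * sqrt (of_int q)"
    using \<open>2 \<le> \<bar>y\<bar>\<close> q_gt_1 by (intro mult_right_mono) (auto simp flip: of_int_abs)
  also have "\<dots> = \<bar>u - conj u\<bar>"
  proof -
    have "u - conj u = of_int y * (w - w')" unfolding cu unfolding u by (simp add: algebra_simps)
    thus ?thesis unfolding omega_diff using q_gt_1 by (simp add: abs_mult)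
  qed
  also have "\<dots> \<le> u + \<bar>conj u\<bar>" using assms(3) by linarith
  also have "\<bar>conj u\<bar> = 1 / u" using assms(2,3) by (simp add: abs_mult field_simps)
  finally have ge: "2 * sqrt (of_int q) * u \<le> u * u + 1" using assms(3) by (simp add: field_simps)
  have E: "unit_bound * (sqrt (of_int q) - sqrt (of_int q - 1)) = 1"
    using q_gt_1 by (simp add: unit_bound_def algebra_simps)
  let ?e = "sqrt (of_int q) - sqrt (of_int q - 1)"
  have "?e < 1"
  proof (rule ccontr)
    assume "\<not> ?e < 1"
    hence "unit_bound * 1 \<le> unit_bound * ?e" using unit_bound_gt_1 by (intro mult_left_mono) auto
    thus False using E unit_bound_gt_1 by simp
  qed
  hence "(unit_bound - u) * (u - ?e) > 0" using less assms(3) by (intro mult_pos_pos) auto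
  also have "(unit_bound - u) * (u - ?e) = 2 * sqrt (of_int q) * u - u * u - unit_bound * ?e"
    by (simp add: unit_bound_def algebra_simps)
  finally show False using ge E by simp
qed

section \<open>Ideals in normal form\<close>

definition lattice :: "int \<Rightarrow> int \<Rightarrow> real set" where
  "lattice a b = {of_int x * of_int a + of_int y * (of_int b + w) | x y. True}"

lemma latticeE:
  assumes "z \<in> lattice a b"
  obtains x y where "z = of_int x * of_int a + of_int y * (of_int b + w)"
  using assms unfolding lattice_def by blast

lemma lattice_gens: "of_int a \<in> lattice a b" "of_int b + w \<in> lattice a b"
proof -
  have "of_int a = of_int 1 * of_int a + of_int 0 * (of_int b + w)" by simp
  thus "of_int a \<in> lattice a b" unfolding lattice_def by blast
  have "of_int b + w = of_int 0 * of_int a + of_int 1 * (of_int b + w)" by simp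
  thus "of_int b + w \<in> lattice a b" unfolding lattice_def by blast
qed

lemma lattice_norm: "(of_int b + w) * (of_int b + w') = of_int (b^2 + b - k)"
  using norm_coords[of b 1] by simp

lemma lattice_ideal:
  assumes "b \<in> roots_mod a"
  shows "ideal (lattice a b) R"
  unfolding ideal_iff
proof (intro conjI ballI)
  obtain f where f: "b^2 + b - k = a * f" using assms by (auto simp: roots_mod_def)
  show "lattice a b \<subseteq> \<O>"
  proof
    fix z assume "z \<in> lattice a b"
    then obtain x y where "z = of_int x * of_int a + of_int y * (of_int b + w)" by (rule latticeE)
    hence "z = of_int (x * a + y * b) + of_int y * w" by (simp add: algebra_simps)
    thus "z \<in> \<O>" using carrierI by metis
  qed
  have "0 = of_int 0 * of_int a + of_int 0 * (of_int b + w)" by simp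
  thus "0 \<in> lattice a b" unfolding lattice_def by blast
  fix z assume z: "z \<in> lattice a b"
  then obtain x y where zxy: "z = of_int x * of_int a + of_int y * (of_int b + w)" by (rule latticeE)
  { fix v assume "v \<in> lattice a b"
    then obtain x' y' where "v = of_int x' * of_int a + of_int y' * (of_int b + w)" by (rule latticeE)
    hence "z + v = of_int (x + x') * of_int a + of_int (y + y') * (of_int b + w)"
      using zxy by (simp add: algebra_simps)
    thus "z + v \<in> lattice a b" unfolding lattice_def by blast }
  { fix v assume "v \<in> \<O>"
    then obtain s t where v: "v = of_int s + of_int t * w" by (rule carrierE)
    \<comment> \<open>With \<open>w\<close> written as (b + 1) - (b + w') the product becomes a
      multiple of b + w minus its norm, and that norm is a multiple of \<open>a\<close>.\<close>
    have "(of_int b + w) * w = (of_int b + w) * (of_int (b + 1) - (of_int b + w'))"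
      by simp
    also have "\<dots> = of_int (b + 1) * (of_int b + w) - of_int (b^2 + b - k)"
      unfolding lattice_norm[symmetric] by (simp add: algebra_simps)
    finally have bw: "(of_int b + w) * w = of_int (b + 1) * (of_int b + w) - of_int a * of_int f"
      unfolding f by simp
    have "v * z = of_int s * z + of_int t * (of_int x * (of_int a * w) + of_int y * ((of_int b + w) * w))"
      unfolding v zxy by (simp add: algebra_simps)
    also have "\<dots> = of_int (s * x - t * x * b - t * y * f) * of_int a
        + of_int (s * y + t * x * a + t * y * (b + 1)) * (of_int b + w)"
      unfolding bw zxy by (simp add: algebra_simps)
    finally show "v * z \<in> lattice a b" unfolding lattice_def by blast }
qed

text \<open>Hermite normal form. \<open>A\<close> generates the rational integers in the ideal and
  \<open>c\<close> its coefficients of \<open>w\<close>. Multiplying by \<open>w\<close> the element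
  \<open>A\<close>, and the element with coefficient \<open>c\<close>, shows that \<open>c\<close>
  divides \<open>A\<close> and \<open>b0\<close>, so it splits off as the content.\<close>

lemma ideal_standard_form:
  assumes I: "ideal I R" "I \<noteq> {0}"
  shows "\<exists>c a :: nat. \<exists>b. c > 0 \<and> a > 0 \<and> b \<in> roots_mod (int a) \<and> I = (\<lambda>z. real c * z) ` lattice (int a) b"
proof -
  have sub: "I \<subseteq> \<O>" and zero: "0 \<in> I" and add: "\<And>x y. x \<in> I \<Longrightarrow> y \<in> I \<Longrightarrow> x + y \<in> I"
    and mul: "\<And>x z. x \<in> I \<Longrightarrow> z \<in> \<O> \<Longrightarrow> z * x \<in> I"
    using I(1) unfolding ideal_iff by auto
  have imul: "of_int t * x \<in> I" if "x \<in> I" for x t using mul that of_int_in_carrier by blast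
  have sbt: "x - y \<in> I" if "x \<in> I" "y \<in> I" for x y
    using add[OF that(1) imul[OF that(2), of "-1"]] by simp
  obtain z0 where z0: "z0 \<in> I" "z0 \<noteq> 0" using zero I(2) by blast
  have z0O: "z0 \<in> \<O>" using z0 sub by blast
  obtain n0 :: int where n0: "z0 * conj z0 = of_int n0" using norm_int[OF z0O] by blast
  have n0I: "of_int n0 \<in> I" using mul[OF z0(1) conj_in_carrier[OF z0O]] n0 by (simp add: mult.commute)
  have n0nz: "n0 \<noteq> 0" using n0 z0 conj_eq_0_iff[OF z0O] by auto
  let ?S = "{x :: int. of_int x \<in> I}" and ?T = "{y :: int. \<exists>x :: int. of_int x + of_int y * w \<in> I}"
  have "\<exists>g>0. g \<in> ?S \<and> (\<forall>x\<in>?S. g dvd x)"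
    by (rule int_subgroup_cyclic[of _ n0]) (use sbt imul n0I n0nz in fastforce)+
  then obtain A where A: "A > 0" "of_int A \<in> I" "\<And>x. of_int x \<in> I \<Longrightarrow> A dvd x" by blast
  have wn0: "of_int 0 + of_int n0 * w \<in> I" using mul[OF n0I omega_in_carrier] by (simp add: mult.commute)
  have "\<exists>g>0. g \<in> ?T \<and> (\<forall>x\<in>?T. g dvd x)"
  proof (rule int_subgroup_cyclic[of _ n0])
    fix y y' assume "y \<in> ?T" "y' \<in> ?T"
    then obtain x x' where "of_int x + of_int y * w \<in> I" "of_int x' + of_int y' * w \<in> I" by blast
    from sbt[OF this] have "of_int (x - x') + of_int (y - y') * w \<in> I" by (simp add: algebra_simps)
    thus "y - y' \<in> ?T" by blast
  next
    fix y t assume "y \<in> ?T"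
    then obtain x where "of_int x + of_int y * w \<in> I" by blast
    from imul[OF this, of t] have "of_int (t * x) + of_int (t * y) * w \<in> I" by (simp add: algebra_simps)
    thus "t * y \<in> ?T" by blast
  qed (use wn0 n0nz in blast)+
  then obtain c b0 where c: "c > 0" "of_int b0 + of_int c * w \<in> I"
    "\<And>x y. of_int x + of_int y * w \<in> I \<Longrightarrow> c dvd y" by blast
  have "of_int 0 + of_int A * w \<in> I" using mul[OF A(2) omega_in_carrier] by (simp add: mult.commute)
  then obtain a where a: "A = c * a" using c(3) by blast
  have a0: "a > 0" using a A(1) c(1) by (simp add: zero_less_mult_iff)
  have "w * (of_int b0 + of_int c * w) = of_int b0 * w + of_int c * (w * w)" by (simp add: algebra_simps)
  also have "\<dots> = of_int (c * k) + of_int (b0 + c) * w" unfolding omega_square by (simp add: algebra_simps)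
  finally have "of_int (c * k) + of_int (b0 + c) * w \<in> I" using mul[OF c(2) omega_in_carrier] by simp
  hence "c dvd b0 + c" by (rule c(3))
  hence "c dvd b0" by simp
  then obtain b1 where b1: "b0 = c * b1" by blast
  define b where "b = b1 mod a"
  define t where "t = b1 div a"
  have b1': "b1 = a * t + b" unfolding b_def t_def by simp
  have \<beta>: "of_int c * (of_int b + w) \<in> I"
  proof -
    have "of_int c * (of_int b + w) = (of_int b0 + of_int c * w) - of_int t * of_int A"
      unfolding b1 b1' a by (simp add: algebra_simps)
    thus ?thesis using sbt[OF c(2) imul[OF A(2)]] by simp
  qed
  have "of_int b + w' \<in> \<O>" using carrierI[of "b + 1" "-1"] by (simp add: algebra_simps)
  hence "(of_int b + w') * (of_int c * (of_int b + w)) \<in> I" by (rule mul[OF \<beta>])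
  also have "(of_int b + w') * (of_int c * (of_int b + w)) = of_int (c * (b^2 + b - k))"
    using lattice_norm[of b] by (simp add: mult.commute mult.left_commute)
  finally have "A dvd c * (b^2 + b - k)" by (rule A(3))
  hence "a dvd b^2 + b - k" unfolding a using c(1) by simp
  hence root: "b \<in> roots_mod a" using a0 by (simp add: roots_mod_def b_def)
  have "I = (\<lambda>z. of_int c * z) ` lattice a b"
  proof (intro equalityI subsetI)
    fix z assume z: "z \<in> I"
    then obtain x y where xy: "z = of_int x + of_int y * w" using sub carrierE by blast
    then obtain y1 where y1: "y = c * y1" using c(3) z by blast
    have "z - of_int y1 * (of_int c * (of_int b + w)) \<in> I" using sbt[OF z imul[OF \<beta>]] .
    also have "z - of_int y1 * (of_int c * (of_int b + w)) = of_int (x - c * y1 * b)"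
      unfolding xy y1 by (simp add: algebra_simps)
    finally obtain x1 where x1: "x - c * y1 * b = A * x1" using A(3) by blast
    have "z = of_int (x - c * y1 * b) + of_int y1 * (of_int c * (of_int b + w))"
      unfolding xy y1 by (simp add: algebra_simps)
    hence "z = of_int c * (of_int x1 * of_int a + of_int y1 * (of_int b + w))"
      unfolding x1 a by (simp add: algebra_simps)
    thus "z \<in> (\<lambda>z. of_int c * z) ` lattice a b" unfolding lattice_def by blast
  next
    fix z assume "z \<in> (\<lambda>z. of_int c * z) ` lattice a b"
    then obtain x y where "z = of_int c * (of_int x * of_int a + of_int y * (of_int b + w))"
      by (auto simp: lattice_def)
    hence "z = of_int x * of_int A + of_int y * (of_int c * (of_int b + w))"
      unfolding a by (simp add: algebra_simps)
    thus "z \<in> I" using add imul A(2) \<beta> by blast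
  qed
  thus ?thesis using c(1) a0 root by (intro exI[of _ "nat c"] exI[of _ "nat a"] exI[of _ b]) simp
qed

end

section \<open>The class number\<close>

context real_quadratic_order
begin

definition span2 :: "real \<Rightarrow> real \<Rightarrow> real set" where
  "span2 u v = {of_int x * u + of_int y * v | x y. True}"

text \<open>A square root of the discriminant of the pair. Up to sign it depends only on the span,
  so after division by sqrt q it serves as the ideal norm without any residue rings.\<close>

definition det2 :: "real \<Rightarrow> real \<Rightarrow> real" where
  "det2 u v = u * conj v - conj u * v"

lemma conj_comb:
  assumes "u \<in> \<O>" "v \<in> \<O>"
  shows "conj (of_int x * u + of_int y * v) = of_int x * conj u + of_int y * conj v"
  using assms by (simp add: conj_add conj_mult carrier_mult of_int_in_carrier conj_of_int)

lemma span2_basis: "u \<in> span2 u v" "v \<in> span2 u v"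
proof -
  have "u = of_int 1 * u + of_int 0 * v" "v = of_int 0 * u + of_int 1 * v" by simp_all
  thus "u \<in> span2 u v" "v \<in> span2 u v" unfolding span2_def by blast+
qed

lemma det2_change_basis:
  assumes "u \<in> \<O>" "v \<in> \<O>" "u' \<in> span2 u v" "v' \<in> span2 u v"
  shows "\<exists>d :: int. det2 u' v' = of_int d * det2 u v"
proof -
  obtain x y where u': "u' = of_int x * u + of_int y * v" using assms(3) unfolding span2_def by blast
  obtain s t where v': "v' = of_int s * u + of_int t * v" using assms(4) unfolding span2_def by blast
  have "det2 u' v' = of_int (x * t - y * s) * det2 u v"
    unfolding det2_def u' v' conj_comb[OF assms(1,2)] by (simp add: algebra_simps)
  thus ?thesis by blast
qed

lemma abs_det2_eq:
  assumes "u \<in> \<O>" "v \<in> \<O>" "u' \<in> \<O>" "v' \<in> \<O>" "span2 u v = span2 u' v'" "det2 u v \<noteq> 0"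
  shows "\<bar>det2 u v\<bar> = \<bar>det2 u' v'\<bar>"
proof -
  obtain d where d: "det2 u' v' = of_int d * det2 u v"
    using det2_change_basis[OF assms(1,2), of u' v'] span2_basis(1)[of u' v'] span2_basis(2)[of v' u'] assms(5) by auto
  obtain e where e: "det2 u v = of_int e * det2 u' v'"
    using det2_change_basis[OF assms(3,4), of u v] span2_basis(1)[of u v] span2_basis(2)[of v u] assms(5) by auto
  have "det2 u v = of_int e * (of_int d * det2 u v)" unfolding d[symmetric] by (rule e)
  hence "1 * det2 u v = of_int (e * d) * det2 u v" by (simp add: mult.assoc)
  hence "(of_int (e * d) :: real) = of_int 1" using assms(6) by (metis mult_right_cancel of_int_1)
  hence "e * d = 1" by (simp only: of_int_eq_iff)
  hence "d = 1 \<or> d = -1" by (metis mult.commute zmult_eq_1_iff)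
  thus ?thesis using d by auto
qed

lemma scaled_lattice_eq_span2: "(\<lambda>z. t * z) ` lattice a b = span2 (t * of_int a) (t * (of_int b + w))"
proof -
  have eq: "t * (of_int x * of_int a + of_int y * (of_int b + w)) =
      of_int x * (t * of_int a) + of_int y * (t * (of_int b + w))" for x y :: int
    by (simp add: algebra_simps)
  show ?thesis unfolding lattice_def span2_def by (auto simp: image_iff) (metis eq)+
qed

lemma l_coset_eq: "x <#\<^bsub>R\<^esub> A = (\<lambda>z. x * z) ` A"
  unfolding l_coset_def ring_simps by blast

lemma lattice_in_carrier: "of_int b + w \<in> \<O>" "of_int b + w' \<in> \<O>"
  using carrierI[of b 1] carrierI[of "b + 1" "-1"] by (simp_all add: algebra_simps)

lemma conj_lattice: "conj (of_int b + w) = of_int b + w'"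
  using conj_coords[of b 1] by simp

definition decode :: "nat \<times> nat \<times> int \<Rightarrow> real set" where
  "decode = (\<lambda>(c, a, b). (\<lambda>z. real c * z) ` lattice (int a) b)"

context
  fixes a :: nat and b :: int
  assumes a_pos: "a > 0" and root: "b \<in> roots_mod (int a)"
begin

text \<open>The conjugate of \<open>lattice a b\<close> has the \<open>\<int>\<close>-basis \<open>a\<close>, \<open>b + w'\<close>; multiplying
  \<open>lattice a b\<close> by \<open>\<alpha> / a\<close> with \<open>\<alpha>\<close> in the conjugate gives an integral ideal in the same class,
  because the product of \<open>lattice a b\<close> with its conjugate lies in \<open>a \<O>\<close>.\<close>

definition conj_point :: "int \<Rightarrow> nat \<Rightarrow> real" where
  "conj_point m n = of_int m * real a - real n * (of_int b + w')"

definition twisted :: "int \<Rightarrow> nat \<Rightarrow> real set" where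
  "twisted m n = (\<lambda>z. conj_point m n / real a * z) ` lattice (int a) b"

text \<open>The minus sign in \<open>conj_point\<close> gives \<open>w\<close> the coefficient +n,
  so a natural number \<open>n\<close> means that the point is not below its conjugate.\<close>

lemma conj_point_coords: "conj_point m n = of_int (m * int a - int n * (b + 1)) + of_int (int n) * w"
  by (simp add: conj_point_def algebra_simps)

lemma conj_point_in_carrier: "conj_point m n \<in> \<O>"
  unfolding conj_point_coords by (rule carrierI)

lemma conj_conj_point: "conj (conj_point m n) = of_int m * real a - real n * (of_int b + w)"
  unfolding conj_point_coords conj_coords by (simp add: algebra_simps)

lemma conj_point_inj:
  assumes "conj_point m n = conj_point m' n'"
  shows "m = m'" "n = n'"
proof -
  have eq: "m * int a - int n * (b + 1) = m' * int a - int n' * (b + 1)" "int n = int n'"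
    using coords_unique[OF assms[unfolded conj_point_coords]] by blast+
  thus "n = n'" by simp
  hence "m * int a = m' * int a" using eq by simp
  thus "m = m'" using a_pos by simp
qed

lemma twisted_second_basis: "conj_point m n / real a * (of_int b + w) \<in> \<O>"
proof -
  obtain f where f: "b^2 + b - k = int a * f" using root by (auto simp: roots_mod_def)
  have "conj_point m n / real a * (of_int b + w) =
      of_int m * (of_int b + w) - real n * ((of_int b + w) * (of_int b + w')) / real a"
    using a_pos by (simp add: conj_point_def field_simps)
  also have "\<dots> = of_int m * (of_int b + w) - of_int (int n * f)"
    unfolding lattice_norm f using a_pos by simp
  also have "\<dots> \<in> \<O>" by (intro carrier_diff carrier_mult of_int_in_carrier lattice_in_carrier)
  finally show ?thesis .
qed

lemma twisted_eq_span2: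
  "twisted m n = span2 (conj_point m n) (conj_point m n / real a * (of_int b + w))"
  unfolding twisted_def scaled_lattice_eq_span2 using a_pos by simp

lemma twisted_ideal:
  assumes "conj_point m n \<noteq> 0"
  shows "ideal (twisted m n) R" "twisted m n \<noteq> {0}"
proof -
  have L: "ideal (lattice (int a) b) R" by (rule lattice_ideal[OF root])
  have L0: "0 \<in> lattice (int a) b" and
    Ladd: "\<And>x y. x \<in> lattice (int a) b \<Longrightarrow> y \<in> lattice (int a) b \<Longrightarrow> x + y \<in> lattice (int a) b" and
    Lmul: "\<And>x z. x \<in> lattice (int a) b \<Longrightarrow> z \<in> \<O> \<Longrightarrow> z * x \<in> lattice (int a) b"
    using L unfolding ideal_iff by auto
  show "ideal (twisted m n) R"
    unfolding ideal_iff
  proof (intro conjI ballI)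
    show "twisted m n \<subseteq> \<O>"
    proof
      fix z assume "z \<in> twisted m n"
      then obtain x y where "z = of_int x * conj_point m n + of_int y * (conj_point m n / real a * (of_int b + w))"
        unfolding twisted_eq_span2 span2_def by blast
      thus "z \<in> \<O>"
        by (simp only:) (intro carrier_add carrier_mult of_int_in_carrier conj_point_in_carrier twisted_second_basis)
    qed
    show "0 \<in> twisted m n" unfolding twisted_def using L0 by (intro image_eqI[of _ _ 0]) auto
    fix z assume "z \<in> twisted m n"
    then obtain x where x: "x \<in> lattice (int a) b" "z = conj_point m n / real a * x"
      unfolding twisted_def by blast
    { fix v assume "v \<in> twisted m n"
      then obtain y where y: "y \<in> lattice (int a) b" "v = conj_point m n / real a * y"
        unfolding twisted_def by blast
      have "z + v = conj_point m n / real a * (x + y)" unfolding x y by (simp add: distrib_left)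
      thus "z + v \<in> twisted m n" unfolding twisted_def using Ladd[OF x(1) y(1)] by blast }
    { fix v assume "v \<in> \<O>"
      have "v * z = conj_point m n / real a * (v * x)" unfolding x by simp
      thus "v * z \<in> twisted m n" unfolding twisted_def using Lmul[OF x(1) \<open>v \<in> \<O>\<close>] by blast }
  qed
  show "twisted m n \<noteq> {0}" using assms span2_basis(1) unfolding twisted_eq_span2 by (metis singletonD)
qed

lemma twisted_class:
  assumes "conj_point m n \<noteq> 0" "c > 0" "ideal ((\<lambda>z. real c * z) ` lattice (int a) b) R"
    "(\<lambda>z. real c * z) ` lattice (int a) b \<noteq> {0}"
  shows "(twisted m n, (\<lambda>z. real c * z) ` lattice (int a) b) \<in> ideal_class_rel R"
proof -
  have "of_int (int c * int a) <#\<^bsub>R\<^esub> twisted m n = conj_point m n <#\<^bsub>R\<^esub> ((\<lambda>z. real c * z) ` lattice (int a) b)"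
    unfolding l_coset_eq twisted_def image_image using a_pos by (intro image_cong refl) simp
  moreover have "(of_int (int c * int a) :: real) \<in> \<O> - {\<zero>\<^bsub>R\<^esub>}" "conj_point m n \<in> \<O> - {\<zero>\<^bsub>R\<^esub>}"
    using of_int_in_carrier[of "int c * int a"] conj_point_in_carrier assms a_pos by (auto simp: ring_simps)
  ultimately show ?thesis
    using twisted_ideal[OF assms(1)] assms(3,4)
    unfolding ideal_class_rel_def nonzero_ideals_def ring_simps(3) by blast
qed

text \<open>The ideal has two bases, the twisted one and that of its normal form, with determinants
  of size |\<alpha> conj \<alpha>| sqrt q / a and c^2 a' sqrt q. Their equality is the norm
  formula.\<close>

lemma twisted_code:
  assumes "conj_point m n \<noteq> 0"
  shows "\<exists>N t. t \<in> ideal_codes N \<and> decode t = twisted m n \<and> N > 0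
    \<and> real N * real a = \<bar>conj_point m n * conj (conj_point m n)\<bar>"
proof -
  let ?\<alpha> = "conj_point m n"
  obtain c a' b' where J: "c > 0" "a' > 0" "b' \<in> roots_mod (int a')"
    "twisted m n = (\<lambda>z. real c * z) ` lattice (int a') b'"
    using ideal_standard_form[OF twisted_ideal[OF assms]] by blast
  \<comment> \<open>\<open>conj_mult\<close> applies to elements of the order, and \<alpha> / a may
    lie outside it; so the denominator is cleared before conjugating.\<close>
  have conj_second: "conj (?\<alpha> / real a * (of_int b + w)) = conj ?\<alpha> * (of_int b + w') / real a"
  proof -
    have "of_int (int a) * (?\<alpha> / real a * (of_int b + w)) = ?\<alpha> * (of_int b + w)" using a_pos by simp
    hence "conj (of_int (int a) * (?\<alpha> / real a * (of_int b + w))) = conj ?\<alpha> * (of_int b + w')"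
      using conj_mult[OF conj_point_in_carrier lattice_in_carrier(1)] conj_lattice by simp
    hence "real a * conj (?\<alpha> / real a * (of_int b + w)) = conj ?\<alpha> * (of_int b + w')"
      using conj_mult[OF of_int_in_carrier twisted_second_basis, of "int a"] conj_of_int[of "int a"] by simp
    thus ?thesis using a_pos by (simp add: field_simps)
  qed
  have conj\<alpha>: "conj ?\<alpha> \<noteq> 0" using conj_eq_0_iff[OF conj_point_in_carrier] assms by simp
  have "det2 ?\<alpha> (?\<alpha> / real a * (of_int b + w)) = - (?\<alpha> * conj ?\<alpha> / real a * (w - w'))"
    unfolding det2_def conj_second using a_pos by (simp add: field_simps)
  hence det1: "det2 ?\<alpha> (?\<alpha> / real a * (of_int b + w)) = - (?\<alpha> * conj ?\<alpha> / real a * sqrt (of_int q))"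
    unfolding omega_diff .
  let ?u = "of_int (int c * int a')" and ?v = "of_int (int c) * (of_int b' + w)"
  have uv: "?u \<in> \<O>" "?v \<in> \<O>"
    by (intro of_int_in_carrier) (intro carrier_mult of_int_in_carrier lattice_in_carrier)
  have conj_v: "conj ?v = of_int (int c) * (of_int b' + w')"
    using conj_mult[OF of_int_in_carrier lattice_in_carrier(1)] conj_of_int conj_lattice by metis
  have "det2 ?u ?v = - (real (c^2 * a') * (w - w'))"
    unfolding det2_def conj_of_int conj_v by (simp add: power2_eq_square algebra_simps)
  hence det2': "det2 ?u ?v = - (real (c^2 * a') * sqrt (of_int q))" unfolding omega_diff .
  have "span2 ?\<alpha> (?\<alpha> / real a * (of_int b + w)) = span2 ?u ?v"
    using J(4) unfolding twisted_eq_span2 scaled_lattice_eq_span2 by simp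
  moreover have "det2 ?\<alpha> (?\<alpha> / real a * (of_int b + w)) \<noteq> 0"
    unfolding det1 using assms conj\<alpha> a_pos q_gt_1 by simp
  ultimately have "\<bar>det2 ?\<alpha> (?\<alpha> / real a * (of_int b + w))\<bar> = \<bar>det2 ?u ?v\<bar>"
    by (intro abs_det2_eq conj_point_in_carrier twisted_second_basis uv)
  hence "\<bar>?\<alpha> * conj ?\<alpha>\<bar> / real a * sqrt (of_int q) = real (c^2 * a') * sqrt (of_int q)"
    unfolding det1 det2' using q_gt_1 by (simp add: abs_mult)
  hence "real (c^2 * a') * real a = \<bar>?\<alpha> * conj ?\<alpha>\<bar>" using a_pos q_gt_1 by (simp add: field_simps)
  moreover have "(c, a', b') \<in> ideal_codes (c^2 * a')" using J by (simp add: ideal_codes_def)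
  moreover have "decode (c, a', b') = twisted m n" using J by (simp add: decode_def)
  moreover have "c^2 * a' > 0" using J by simp
  ultimately show ?thesis by blast
qed

text \<open>A multiplier acts on the basis of the lattice by an integer matrix and is a root of its
  characteristic polynomial, hence integral. Maximality of the order does the rest.\<close>

lemma lattice_multiplier:
  assumes "\<And>z. z \<in> lattice (int a) b \<Longrightarrow> \<gamma> * z \<in> lattice (int a) b"
  shows "\<gamma> \<in> \<O>"
proof -
  obtain x y where xy: "\<gamma> * real a = of_int x * real a + of_int y * (of_int b + w)"
    using assms[OF lattice_gens(1)] by (auto elim: latticeE)
  obtain s t where st: "\<gamma> * (of_int b + w) = of_int s * real a + of_int t * (of_int b + w)"
    using assms[OF lattice_gens(2)] by (auto elim: latticeE)
  have bw: "of_int b + w \<noteq> 0" using coords_unique[of b 1 0 0] by auto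
  have "(\<gamma> - of_int x) * real a * ((\<gamma> - of_int t) * (of_int b + w)) =
      (of_int y * (of_int b + w)) * (of_int s * real a)"
    using xy st by (simp add: left_diff_distrib)
  hence "(\<gamma> - of_int x) * (\<gamma> - of_int t) * (real a * (of_int b + w)) =
      of_int y * of_int s * (real a * (of_int b + w))" by (simp only: mult_ac)
  hence "(\<gamma> - of_int x) * (\<gamma> - of_int t) = of_int y * of_int s"
    using bw a_pos by simp
  hence "\<gamma>^2 - of_int (x + t) * \<gamma> + of_int (x * t - y * s) = 0"
    by (simp add: power2_eq_square algebra_simps)
  hence "algebraic_int \<gamma>" by (rule algebraic_int_quadratic_root)
  moreover have "\<gamma> \<in> quadratic_field q"
  proof -
    have "\<gamma> = of_int x + of_int y / real a * (of_int b + w)" using xy a_pos by (simp add: field_simps)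
    also have "\<dots> = (of_int x + of_int y / real a * (of_int b + 1 / 2))
        + (of_int y / (2 * real a)) * sqrt (of_int q)"
      by (simp add: omega_def field_simps) (simp add: add_divide_distrib)
    finally have "\<gamma> = (of_int x + of_int y / real a * (of_int b + 1 / 2))
        + (of_int y / (2 * real a)) * sqrt (of_int q)" .
    moreover have "of_int x + of_int y / real a * (of_int b + 1 / 2) \<in> \<rat>" "of_int y / (2 * real a) \<in> \<rat>"
      by simp_all
    ultimately show ?thesis unfolding quadratic_field_def by blast
  qed
  ultimately show ?thesis by (simp add: quadratic_integers_def)
qed

lemma twisted_eq_quotient:
  assumes "twisted m n = twisted m' n'" "conj_point m' n' \<noteq> 0"
  shows "conj_point m n / conj_point m' n' \<in> \<O>"
proof (rule lattice_multiplier)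
  fix z assume "z \<in> lattice (int a) b"
  hence "conj_point m n / real a * z \<in> twisted m' n'" using assms(1) unfolding twisted_def by blast
  then obtain z' where "z' \<in> lattice (int a) b" "conj_point m n / real a * z = conj_point m' n' / real a * z'"
    unfolding twisted_def by blast
  moreover from this have "conj_point m n / conj_point m' n' * z = z'"
    using assms(2) a_pos by (simp add: field_simps)
  ultimately show "conj_point m n / conj_point m' n' * z \<in> lattice (int a) b" by simp
qed

text \<open>Points of the sector are pairwise non-associate: the quotient of two of them lies strictly
  between \<open>1 / unit_bound\<close> and \<open>unit_bound\<close>.\<close>

lemma twisted_inj:
  assumes eq: "twisted m n = twisted m' n'"
    and \<alpha>: "0 < conj_point m n" "\<bar>conj (conj_point m n)\<bar> < conj_point m n"
      "conj_point m n \<le> unit_bound^2 * \<bar>conj (conj_point m n)\<bar>"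
    and \<beta>: "0 < conj_point m' n'" "\<bar>conj (conj_point m' n')\<bar> < conj_point m' n'"
      "conj_point m' n' \<le> unit_bound^2 * \<bar>conj (conj_point m' n')\<bar>"
  shows "m = m' \<and> n = n'"
proof -
  let ?\<alpha> = "conj_point m n" and ?\<beta> = "conj_point m' n'"
  define \<gamma> \<delta> where "\<gamma> = ?\<alpha> / ?\<beta>" and "\<delta> = ?\<beta> / ?\<alpha>"
  have \<gamma>O: "\<gamma> \<in> \<O>" and \<delta>O: "\<delta> \<in> \<O>"
    unfolding \<gamma>_def \<delta>_def using eq \<alpha> \<beta> by (auto intro!: twisted_eq_quotient)
  have pos: "\<gamma> > 0" "\<delta> > 0" and inv: "\<gamma> * \<delta> = 1" using \<alpha> \<beta> by (simp_all add: \<gamma>_def \<delta>_def)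
  have cnz: "conj ?\<alpha> \<noteq> 0" "conj ?\<beta> \<noteq> 0" using conj_eq_0_iff[OF conj_point_in_carrier] \<alpha> \<beta> by auto
  have "?\<alpha> = \<gamma> * ?\<beta>" "?\<beta> = \<delta> * ?\<alpha>" using \<alpha> \<beta> by (simp_all add: \<gamma>_def \<delta>_def)
  hence c\<gamma>: "conj ?\<alpha> = conj \<gamma> * conj ?\<beta>" and c\<delta>: "conj ?\<beta> = conj \<delta> * conj ?\<alpha>"
    using conj_mult[OF \<gamma>O conj_point_in_carrier] conj_mult[OF \<delta>O conj_point_in_carrier] by metis+
  obtain i j :: int where ij: "\<gamma> * conj \<gamma> = of_int i" "\<delta> * conj \<delta> = of_int j"
    using norm_int \<gamma>O \<delta>O by meson
  have "conj \<gamma> * conj \<delta> = 1" using conj_mult[OF \<gamma>O \<delta>O] inv conj_of_int[of 1] by simp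
  hence "of_int (i * j) = (\<gamma> * \<delta>) * (conj \<gamma> * conj \<delta>)" unfolding of_int_mult ij[symmetric] by simp
  hence "(of_int (i * j) :: real) = of_int 1" using inv \<open>conj \<gamma> * conj \<delta> = 1\<close> by simp
  hence "i * j = 1" by (simp only: of_int_eq_iff)
  hence "\<bar>i\<bar> = 1" "\<bar>j\<bar> = 1" by (auto simp: zmult_eq_1_iff)
  hence units: "\<bar>\<gamma> * conj \<gamma>\<bar> = 1" "\<bar>\<delta> * conj \<delta>\<bar> = 1" unfolding ij by (simp_all flip: of_int_abs)
  have less: "x / y < unit_bound"
    if "0 < y" "\<bar>conj y\<bar> < y" "x \<le> unit_bound^2 * \<bar>conj x\<bar>" "0 < x" "conj x = conj u * conj y" "conj y \<noteq> 0"
      "\<bar>u * conj u\<bar> = 1" "u = x / y" for x y u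
  proof -
    have u: "u > 0" using that by simp
    have cu: "\<bar>conj u\<bar> = 1 / u" using that(7) u by (simp add: abs_mult field_simps)
    \<comment> \<open>As |conj u| = 1 / u, the square of u is the quotient of the ratios x / |conj
      x| and y / |conj y|. The sector admits ratios above 1 and at most \<open>unit_bound^2\<close>;
      the strict lower end makes the bound on u strict.\<close>
    have "u * u = x / y / \<bar>conj u\<bar>" unfolding cu using that(8) by simp
    also have "\<dots> = (x / \<bar>conj x\<bar>) * (\<bar>conj y\<bar> / y)"
      using that u cu by (simp add: abs_mult)
    also have "\<dots> < unit_bound^2 * 1"
    proof (rule mult_le_less_imp_less)
      have "conj u \<noteq> 0" using cu u by auto
      hence "conj x \<noteq> 0" using that by simp
      thus "x / \<bar>conj x\<bar> \<le> unit_bound^2" "0 < x / \<bar>conj x\<bar>" using that by (simp_all add: field_simps)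
      show "\<bar>conj y\<bar> / y < 1" "0 \<le> \<bar>conj y\<bar> / y" using that by simp_all
    qed
    finally have "u^2 < unit_bound^2" by (simp add: power2_eq_square)
    hence "u < unit_bound" using power_less_imp_less_base[of u 2 unit_bound] unit_bound_gt_1 by simp
    thus ?thesis using that by simp
  qed
  have "\<gamma> < unit_bound"
    unfolding \<gamma>_def by (rule less[where u = \<gamma>]) (use \<alpha> \<beta> c\<gamma> cnz units in \<open>auto simp: \<gamma>_def\<close>)
  moreover have "\<delta> < unit_bound"
    unfolding \<delta>_def by (rule less[where u = \<delta>]) (use \<alpha> \<beta> c\<delta> cnz units in \<open>auto simp: \<delta>_def\<close>)
  \<comment> \<open>Both are units below \<open>unit_bound\<close>, so neither exceeds 1; being
    inverse to each other they are equal to 1.\<close>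
  ultimately have "\<gamma> \<le> 1" "\<delta> \<le> 1"
    using unit_ge_bound[OF \<gamma>O units(1)] unit_ge_bound[OF \<delta>O units(2)] by linarith+
  hence "?\<alpha> = ?\<beta>" using \<alpha> \<beta> by (simp add: \<gamma>_def \<delta>_def)
  thus ?thesis using conj_point_inj by blast
qed

text \<open>For these parameters the points of the sector are the \<open>conj_point\<close> values:
  their trace is 2 a m - n (2 b + 1) and their difference n sqrt q. The norm of \<alpha> may reach a
  X because twisting divides it by \<open>a\<close>.\<close>

lemma class_ideals_count:
  "\<exists>\<phi>. \<phi> \<longlonglongrightarrow> 2 * ln unit_bound / sqrt (of_int q) \<and>
    (\<forall>x. \<exists>S. S \<subseteq> (\<Union>N\<in>{1..Suc x}. ideal_codes N) \<and> \<phi> x * real (Suc x) \<le> real (card S) \<and>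
      (\<forall>t\<in>S. \<exists>m n. conj_point m n \<noteq> 0 \<and> decode t = twisted m n))"
proof -
  let ?r = "sqrt (of_int q)" and ?c = "\<lambda>n. - real n * (2 * of_int b + 1)"
  have "?r > 0" "real a > 0" using q_gt_1 a_pos by simp_all
  from sector_points_count[OF this unit_bound_gt_1, of ?c]
  obtain \<phi> where \<phi>: "\<phi> \<longlonglongrightarrow> 2 * ln unit_bound / ?r" and
    P: "\<And>x. \<exists>P. P \<subseteq> sector_points ?r (real a) ?c unit_bound (real a * real (Suc x)) \<and> finite P \<and>
      \<phi> x * real (Suc x) \<le> real (card P)" by blast
  have "\<exists>S. S \<subseteq> (\<Union>N\<in>{1..Suc x}. ideal_codes N) \<and> \<phi> x * real (Suc x) \<le> real (card S) \<and>
      (\<forall>t\<in>S. \<exists>m n. conj_point m n \<noteq> 0 \<and> decode t = twisted m n)" for x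
  proof -
    obtain P where P: "P \<subseteq> sector_points ?r (real a) ?c unit_bound (real a * real (Suc x))" "finite P"
      "\<phi> x * real (Suc x) \<le> real (card P)" using P by blast
    have in_sector: "0 < conj_point m n \<and> \<bar>conj (conj_point m n)\<bar> < conj_point m n \<and>
        conj_point m n \<le> unit_bound^2 * \<bar>conj (conj_point m n)\<bar> \<and>
        conj_point m n * \<bar>conj (conj_point m n)\<bar> \<le> real a * real (Suc x)" if "(m, n) \<in> P" for m n
    proof -
      have 1: "(2 * real a * of_int m + ?c n + real n * ?r) / 2 = conj_point m n"
        by (simp add: conj_point_def omega_def field_simps)
      have 2: "(2 * real a * of_int m + ?c n - real n * ?r) / 2 = conj (conj_point m n)"
        unfolding conj_conj_point by (simp add: omega_def field_simps)
      have "(m, n) \<in> sector_points ?r (real a) ?c unit_bound (real a * real (Suc x))" using P that by blast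
      thus ?thesis unfolding sector_points_def Let_def mem_Collect_eq prod.case 1 2 .
    qed
    \<comment> \<open>Any code of the twisted ideal will do: \<open>decode\<close> recovers the
      ideal, and \<open>twisted_inj\<close> then recovers the point.\<close>
    define code where "code = (\<lambda>(m, n). SOME t. t \<in> (\<Union>N\<in>{1..Suc x}. ideal_codes N) \<and> decode t = twisted m n)"
    have code: "code (m, n) \<in> (\<Union>N\<in>{1..Suc x}. ideal_codes N) \<and> decode (code (m, n)) = twisted m n"
      if "(m, n) \<in> P" for m n
    proof -
      have nz: "conj_point m n \<noteq> 0" using in_sector[OF that] by simp
      obtain N t where t: "t \<in> ideal_codes N" "decode t = twisted m n" "N > 0"
        "real N * real a = \<bar>conj_point m n * conj (conj_point m n)\<bar>"
        using twisted_code[OF nz] by blast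
      have "real a * real N \<le> real a * real (Suc x)"
        using t(4) in_sector[OF that] by (simp add: abs_mult mult.commute)
      hence "N \<le> Suc x" using a_pos by (simp del: of_nat_Suc)
      hence "t \<in> (\<Union>N\<in>{1..Suc x}. ideal_codes N)" using t(1,3) by (intro UN_I[of N]) auto
      hence "\<exists>t. t \<in> (\<Union>N\<in>{1..Suc x}. ideal_codes N) \<and> decode t = twisted m n" using t(2) by blast
      from someI_ex[OF this] show ?thesis unfolding code_def by simp
    qed
    have "inj_on code P"
    proof (rule inj_onI)
      fix p p' assume p: "p \<in> P" "p' \<in> P" "code p = code p'"
      obtain m n m' n' where mn: "p = (m, n)" "p' = (m', n')" by (metis surj_pair)
      have "twisted m n = twisted m' n'" using code p mn by metis
      thus "p = p'" using twisted_inj[of m n m' n'] in_sector[of m n] in_sector[of m' n'] p mn by auto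
    qed
    hence "card (code ` P) = card P" by (rule card_image)
    moreover have "\<exists>m n. conj_point m n \<noteq> 0 \<and> decode t = twisted m n" if "t \<in> code ` P" for t
      using that code in_sector by force
    moreover have "code ` P \<subseteq> (\<Union>N\<in>{1..Suc x}. ideal_codes N)" using code by auto
    ultimately show ?thesis using P(3) by (intro exI[of _ "code ` P"]) auto
  qed
  thus ?thesis using \<phi> by blast
qed

end

section \<open>From ideal counts to the class number\<close>

lemma ideal_class_rel_equiv: "equiv (nonzero_ideals R) (ideal_class_rel R)"
proof (rule equivI)
  show "ideal_class_rel R \<subseteq> nonzero_ideals R \<times> nonzero_ideals R"
    by (auto simp: ideal_class_rel_def)
  show "refl_on (nonzero_ideals R) (ideal_class_rel R)"
  proof (rule refl_onI)
    fix I assume "I \<in> nonzero_ideals R"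
    moreover have "1 \<in> \<O> - {\<zero>\<^bsub>R\<^esub>}" using of_int_in_carrier[of 1] by (simp add: ring_simps)
    ultimately show "(I, I) \<in> ideal_class_rel R" unfolding ideal_class_rel_def by blast
  qed
  show "sym (ideal_class_rel R)"
    by (auto simp: sym_def ideal_class_rel_def)
  show "trans (ideal_class_rel R)"
  proof (rule transI)
    fix I J K assume "(I, J) \<in> ideal_class_rel R" "(J, K) \<in> ideal_class_rel R"
    then obtain s t u v where st: "s \<in> \<O> - {0}" "t \<in> \<O> - {0}" "s <#\<^bsub>R\<^esub> I = t <#\<^bsub>R\<^esub> J"
      and uv: "u \<in> \<O> - {0}" "v \<in> \<O> - {0}" "u <#\<^bsub>R\<^esub> J = v <#\<^bsub>R\<^esub> K"
      and IK: "I \<in> nonzero_ideals R" "K \<in> nonzero_ideals R"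
      unfolding ideal_class_rel_def ring_simps(3) by blast
    have "(\<lambda>z. u * s * z) ` I = (\<lambda>z. u * z) ` ((\<lambda>z. s * z) ` I)" by (simp add: image_image mult.assoc)
    also have "\<dots> = (\<lambda>z. t * z) ` ((\<lambda>z. u * z) ` J)"
      using st(3) unfolding l_coset_eq by (simp add: image_image mult.left_commute)
    also have "\<dots> = (\<lambda>z. t * v * z) ` K"
      using uv(3) unfolding l_coset_eq by (simp add: image_image mult.assoc)
    finally have "u * s <#\<^bsub>R\<^esub> I = t * v <#\<^bsub>R\<^esub> K" unfolding l_coset_eq .
    moreover have "u * s \<in> \<O> - {0}" "t * v \<in> \<O> - {0}" using st uv carrier_mult by auto
    ultimately show "(I, K) \<in> ideal_class_rel R"
      using IK unfolding ideal_class_rel_def ring_simps(3) by blast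
  qed
qed

lemma ideal_class_count:
  assumes "C \<in> nonzero_ideals R // ideal_class_rel R"
  shows "\<exists>\<phi>. \<phi> \<longlonglongrightarrow> 2 * ln unit_bound / sqrt (of_int q) \<and>
    (\<forall>x. \<exists>S. S \<subseteq> (\<Union>N\<in>{1..Suc x}. ideal_codes N) \<and> \<phi> x * real (Suc x) \<le> real (card S) \<and> decode ` S \<subseteq> C)"
proof -
  obtain K where K: "K \<in> nonzero_ideals R" "C = ideal_class_rel R `` {K}"
    using assms by (rule quotientE)
  have Ki: "ideal K R" "K \<noteq> {0}" using K(1) by (auto simp: nonzero_ideals_def ring_simps)
  obtain c a b where cab: "c > 0" "a > 0" "b \<in> roots_mod (int a)" "K = (\<lambda>z. real c * z) ` lattice (int a) b"
    using ideal_standard_form[OF Ki] by blast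
  have "twisted a b m n \<in> C" if "conj_point a b m n \<noteq> 0" for m n
  proof -
    have "(twisted a b m n, K) \<in> ideal_class_rel R"
      using twisted_class[OF cab(2,3) that cab(1)] Ki unfolding cab(4) by blast
    hence "(K, twisted a b m n) \<in> ideal_class_rel R"
      using equivE[OF ideal_class_rel_equiv] by (meson symE)
    thus ?thesis using K(2) by blast
  qed
  hence *: "decode ` S \<subseteq> C" if "\<forall>t\<in>S. \<exists>m n. conj_point a b m n \<noteq> 0 \<and> decode t = twisted a b m n" for S
    using that by fastforce
  from class_ideals_count[OF cab(2,3)] obtain \<phi> where
    "\<phi> \<longlonglongrightarrow> 2 * ln unit_bound / sqrt (of_int q)" and
    "\<And>x. \<exists>S. S \<subseteq> (\<Union>N\<in>{1..Suc x}. ideal_codes N) \<and> \<phi> x * real (Suc x) \<le> real (card S) \<and>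
      (\<forall>t\<in>S. \<exists>m n. conj_point a b m n \<noteq> 0 \<and> decode t = twisted a b m n)" by blast
  thus ?thesis using * by meson
qed

text \<open>The code sets are disjoint because they decode into different, hence disjoint, classes;
  together they fit into the set of all codes up to the norm bound.\<close>

lemma sum_class_counts_le:
  assumes F: "finite F" "F \<subseteq> nonzero_ideals R // ideal_class_rel R"
    and S: "\<And>C. C \<in> F \<Longrightarrow> S C \<subseteq> (\<Union>N\<in>{1..X}. ideal_codes N)" "\<And>C. C \<in> F \<Longrightarrow> decode ` S C \<subseteq> C"
  shows "int (\<Sum>C\<in>F. card (S C)) \<le> (\<Sum>N=1..X. psi_divisor_sum N)"
proof -
  let ?U = "\<Union>N\<in>{1..X}. ideal_codes N"
  have finU: "finite ?U" using finite_ideal_codes by auto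
  have "S C \<inter> S C' = {}" if "C \<in> F" "C' \<in> F" "C \<noteq> C'" for C C'
  proof -
    have "C \<inter> C' = {}" using quotient_disj[OF ideal_class_rel_equiv, of C C'] that F(2) by blast
    thus ?thesis using S(2)[OF that(1)] S(2)[OF that(2)] by blast
  qed
  hence "(\<Sum>C\<in>F. card (S C)) = card (\<Union>C\<in>F. S C)"
    using F(1) finite_subset[OF S(1) finU] by (intro card_UN_disjoint[symmetric]) blast+
  also have "\<dots> \<le> card ?U" using S(1) by (intro card_mono[OF finU]) blast
  also have "\<dots> \<le> (\<Sum>N\<in>{1..X}. card (ideal_codes N))" by (rule card_UN_le) simp
  finally have "int (\<Sum>C\<in>F. card (S C)) \<le> (\<Sum>N\<in>{1..X}. int (card (ideal_codes N)))"
    by (metis of_nat_le_iff of_nat_sum)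
  also have "\<dots> \<le> (\<Sum>N=1..X. psi_divisor_sum N)" by (intro sum_mono card_ideal_codes_le) auto
  finally show ?thesis .
qed

text \<open>The inequality \<open>h ln E \<le> (\<surd>q / 2) L(1, \<chi>)\<close> contained in the class number formula, with the series
  truncated at \<open>D\<close>.\<close>

lemma finite_classes_bound:
  assumes F: "finite F" "F \<subseteq> nonzero_ideals R // ideal_class_rel R" and D: "D \<ge> 1"
  shows "real (card F) * (2 * ln unit_bound / sqrt (of_int q)) \<le> psi_log_sum D + 2 * of_int q / real D"
proof -
  obtain \<phi> S where \<phi>: "\<And>C. C \<in> F \<Longrightarrow> \<phi> C \<longlonglongrightarrow> 2 * ln unit_bound / sqrt (of_int q)"
    and S: "\<And>C x. C \<in> F \<Longrightarrow> S C x \<subseteq> (\<Union>N\<in>{1..Suc x}. ideal_codes N)"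
      "\<And>C x. C \<in> F \<Longrightarrow> \<phi> C x * real (Suc x) \<le> real (card (S C x))"
      "\<And>C x. C \<in> F \<Longrightarrow> decode ` S C x \<subseteq> C"
  proof -
    have "\<exists>\<phi>. \<exists>S. \<phi> \<longlonglongrightarrow> 2 * ln unit_bound / sqrt (of_int q) \<and>
      (\<forall>x. S x \<subseteq> (\<Union>N\<in>{1..Suc x}. ideal_codes N) \<and> \<phi> x * real (Suc x) \<le> real (card (S x)) \<and> decode ` S x \<subseteq> C)"
      if "C \<in> F" for C
    proof -
      have "C \<in> nonzero_ideals R // ideal_class_rel R" using that F(2) by blast
      from ideal_class_count[OF this] show ?thesis by metis
    qed
    then obtain \<phi> S where "\<And>C. C \<in> F \<Longrightarrow> \<phi> C \<longlonglongrightarrow> 2 * ln unit_bound / sqrt (of_int q) \<and>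
      (\<forall>x. S C x \<subseteq> (\<Union>N\<in>{1..Suc x}. ideal_codes N) \<and> \<phi> C x * real (Suc x) \<le> real (card (S C x)) \<and> decode ` S C x \<subseteq> C)"
      by metis
    thus ?thesis using that[of \<phi> S] by blast
  qed
  have "(\<lambda>x. \<Sum>C\<in>F. \<phi> C x) \<longlonglongrightarrow> (\<Sum>C\<in>F. 2 * ln unit_bound / sqrt (of_int q))"
    by (rule tendsto_sum) (rule \<phi>)
  hence lim1: "(\<lambda>x. \<Sum>C\<in>F. \<phi> C x) \<longlonglongrightarrow> real (card F) * (2 * ln unit_bound / sqrt (of_int q))" by simp
  let ?g = "\<lambda>x. psi_log_sum D + 2 * of_int q / real D + real D / real (Suc x)"
  have lim2: "?g \<longlonglongrightarrow> psi_log_sum D + 2 * of_int q / real D + 0"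
    by (intro tendsto_intros) real_asymp
  have "(\<Sum>C\<in>F. \<phi> C x) \<le> ?g x" if "x \<ge> D" for x
  proof -
    have "(\<Sum>C\<in>F. \<phi> C x) * real (Suc x) \<le> (\<Sum>C\<in>F. real (card (S C x)))"
      unfolding sum_distrib_right by (rule sum_mono) (rule S(2))
    also have "\<dots> = of_int (int (\<Sum>C\<in>F. card (S C x)))" by simp
    also have "\<dots> \<le> of_int (\<Sum>N=1..Suc x. psi_divisor_sum N)"
      using sum_class_counts_le[OF F, of "\<lambda>C. S C x" "Suc x"] S(1,3) by (simp only: of_int_le_iff)
    also have "\<dots> \<le> real (Suc x) * psi_log_sum D + real D + 2 * of_int q * (real (Suc x) / real D)"
      by (rule sum_psi_divisor_sum_le) (use D that in auto)
    also have "\<dots> = ?g x * real (Suc x)" by (simp add: distrib_right del: of_nat_Suc)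
    finally show ?thesis by (simp del: of_nat_Suc)
  qed
  hence "eventually (\<lambda>x. (\<Sum>C\<in>F. \<phi> C x) \<le> ?g x) sequentially"
    unfolding eventually_sequentially by blast
  from tendsto_le[OF _ lim2 lim1 this] show ?thesis by simp
qed

text \<open>The second limit: letting \<open>D\<close> grow removes all boundary terms and leaves a
  bound that is the same for every finite set \<open>F\<close> of classes.\<close>

lemma card_classes_le:
  assumes F: "finite F" "F \<subseteq> nonzero_ideals R // ideal_class_rel R"
  shows "real (card F) * (2 * ln unit_bound / sqrt (of_int q)) \<le> ln ((sqrt (of_int q) + 5/2) / (5/2)) + 1"
proof -
  let ?L = "ln ((sqrt (of_int q) + 5/2) / (5/2)) + 1" and ?B = "real (card F) * (2 * ln unit_bound / sqrt (of_int q))"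
  let ?g = "\<lambda>D::nat. ?L + 2 * of_int q / (real D + 1) + 2 * of_int q / real D"
  have "?g \<longlonglongrightarrow> ?L + 0 + 0" by (intro tendsto_intros) real_asymp+
  moreover have "?B \<le> ?g D" if D: "D \<ge> nat \<lceil>sqrt (of_int q)\<rceil>" for D
  proof -
    have r: "sqrt (of_int q) \<le> real D" using D by linarith
    moreover have "1 < sqrt (of_int q)" using q_gt_1 by simp
    ultimately have "0 < real D" by linarith
    hence "D \<ge> 1" by simp
    thus ?thesis using finite_classes_bound[OF F, of D] psi_log_sum_le[OF r] by simp
  qed
  hence "eventually (\<lambda>D. ?B \<le> ?g D) sequentially" unfolding eventually_sequentially by blast
  ultimately show ?thesis using tendsto_lowerbound[of ?g ?L sequentially ?B] by simp
qed

section \<open>Numerical comparison\<close>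

lemma q_ge_17: "q \<ge> 17"
proof (rule ccontr)
  assume "\<not> q \<ge> 17"
  hence "q = 9" using q_mod_8 q_gt_1 by presburger
  hence "(3::int)^2 dvd q" by simp
  hence "is_unit (3::int)" using squarefree_q unfolding squarefree_def by blast
  thus False by simp
qed

lemma ln_unit_bound_estimates:
  "ln ((sqrt (of_int q) + 5/2) / (5/2)) + 1 \<le> ln unit_bound * (1 - 1 / (25 * ln (of_int q)))"
proof -
  let ?r = "sqrt (of_int q) :: real"
  have r4: "?r > 4" using q_ge_17 by (intro real_less_rsqrt) simp
  have rr: "?r * ?r = of_int q" using q_gt_1 by simp
  have lnq: "ln (of_int q) = 2 * ln ?r" using q_gt_1 by (simp add: ln_sqrt)
  \<comment> \<open>This is where sqrt q > 4 enters: ln 2 is at most (1/4) ln q, so ln (2 sqrt q) is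
    at most (3/4) ln q.\<close>
  have lnr: "ln 2 \<le> ln ?r / 2"
  proof -
    have "ln (2^2 :: real) \<le> ln ?r" using r4 q_gt_1 by (subst ln_le_cancel_iff) auto
    moreover have "ln ((2::real)^2) = real 2 * ln 2" by (rule ln_realpow)
    ultimately show ?thesis by simp
  qed
  have ln2: "ln (2::real) > 0" by simp
  have s: "sqrt (of_int q - 1) \<le> ?r" by simp
  have "ln unit_bound \<le> ln (2 * ?r)"
    using unit_bound_gt_1 s r4 q_gt_1 by (subst ln_le_cancel_iff) (auto simp: unit_bound_def)
  also have "\<dots> = ln 2 + ln ?r" using r4 q_gt_1 by (subst ln_mult) auto
  also have "\<dots> \<le> 3 / 4 * ln (of_int q)" using lnr lnq by simp
  finally have "ln unit_bound \<le> 3 / 4 * ln (of_int q)" .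
  moreover have "ln (of_int q :: real) > 0" using lnq lnr ln2 by linarith
  ultimately have upper: "ln unit_bound / (25 * ln (of_int q)) \<le> 3 / 100"
    by (simp add: pos_divide_le_eq)
  \<comment> \<open>103/100 is the 1 from the bound of the series plus 3/100 = (3/4) / 25, the room
    claimed by the saving factor of the theorem.\<close>
  have e: "exp (103 / 100 :: real) \<le> 281 / 100"
  proof -
    have e1: "exp (1 :: real) \<le> 272 / 100"
      using e_less_272 by simp
    have "exp (3 / 100 :: real) \<le> 1 + 3 / 100 + (3 / 100)^2" by (rule exp_bound) auto
    hence "exp (1 :: real) * exp (3 / 100) \<le> (272 / 100) * (1 + 3 / 100 + (3 / 100)^2)"
      using e1 by (intro mult_mono) auto
    also have "exp (1 :: real) * exp (3 / 100) = exp (103 / 100)" by (simp flip: exp_add)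
    finally show ?thesis by (simp add: power2_eq_square)
  qed
  have "(?r + 5/2) / (5/2) * exp (103 / 100) \<le> (?r + 5/2) / (5/2) * (281 / 100)"
    using e r4 by (intro mult_left_mono) auto
  also have "\<dots> \<le> unit_bound"
  proof -
    \<comment> \<open>With r = sqrt q it remains to see that (2/5) 2.81 r + 2.81 is at most 2 r -
      0.15, which holds from r = 3.4 on.\<close>
    have "?r - 3 / 20 \<le> sqrt (of_int q - 1)"
    proof (rule real_le_rsqrt)
      have "(?r - 3 / 20)^2 = of_int q - 3 / 10 * ?r + 9 / 400"
        using rr by (simp add: power2_eq_square algebra_simps)
      thus "(?r - 3 / 20)^2 \<le> of_int q - 1" using r4 by simp
    qed
    thus ?thesis using r4 unfolding unit_bound_def by (simp add: field_simps)
  qed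
  finally have "ln ((?r + 5/2) / (5/2) * exp (103 / 100)) \<le> ln unit_bound"
    using r4 unit_bound_gt_1 q_gt_1 by (subst ln_le_cancel_iff) auto
  moreover have "ln ((?r + 5/2) / (5/2) * exp (103 / 100)) = ln ((?r + 5/2) / (5/2)) + 103 / 100"
    using r4 q_gt_1 by (subst ln_mult) auto
  ultimately show ?thesis using upper by (simp add: right_diff_distrib)
qed

theorem class_number_le:
  "real (class_number R) \<le> sqrt (of_int q) / 2 * (1 - 1 / (25 * ln (of_int q)))"
proof -
  let ?r = "sqrt (of_int q) :: real" and ?Q = "nonzero_ideals R // ideal_class_rel R"
  \<comment> \<open>An infinite set has \<open>card\<close> 0, the value for the empty set, so the
    bound for finite sets of classes covers either case.\<close>
  let ?F = "if finite ?Q then ?Q else {}"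
  have E: "ln unit_bound > 0" using unit_bound_gt_1 by simp
  have r: "?r > 0" using q_gt_1 by simp
  have "card ?Q = card ?F" by simp
  moreover have "real (card ?F) * (2 * ln unit_bound / ?r) \<le> ln unit_bound * (1 - 1 / (25 * ln (of_int q)))"
    by (rule order_trans[OF card_classes_le ln_unit_bound_estimates]) auto
  ultimately have "real (class_number R) * (2 * ln unit_bound / ?r) \<le> ln unit_bound * (1 - 1 / (25 * ln (of_int q)))"
    unfolding class_number_def by (simp only:)
  hence "(ln unit_bound * (2 / ?r)) * real (class_number R) \<le>
      (ln unit_bound * (2 / ?r)) * (?r / 2 * (1 - 1 / (25 * ln (of_int q))))"
    using r by (simp add: mult_ac)
  thus ?thesis using E r by (subst (asm) mult_le_cancel_left_pos) auto
qed

end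

no_notation vec_lambda (binder "\<chi>" 10)

theorem theorem2:
  fixes q :: int and \<chi> :: "int \<Rightarrow> int"
  assumes "real_quadratic_discriminant q"
    and "\<chi> = kronecker q"
    and "\<chi> 2 = 1"
  shows "real (class_number (quadratic_integers q))
           \<le> sqrt (real_of_int q) / 2 * (1 - 1 / (25 * ln (real_of_int q)))"
proof -
  \<comment> \<open>The value at 2 excludes even \<open>q\<close> and the residues 3 and 5 modulo 8;
    the residue 7 falls to the discriminant condition.\<close>
  have "prime_factors (2 :: int) = {2}" by (simp add: prime_factorization_prime)
  hence "kronecker q 2 = kronecker_prime q 2" by (simp add: kronecker_def)
  hence q: "odd q" "q mod 8 = 1 \<or> q mod 8 = 7"
    using assms by (auto simp: kronecker_prime_def split: if_splits)
  have "q mod 4 = 1" by (rule discriminant_mod_4[OF assms(1) q(1)])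
  hence "q mod 8 = 1" using q(2) by presburger
  moreover have "q > 1" using assms(1) by (simp add: real_quadratic_discriminant_def)
  ultimately interpret real_quadratic_order q
    using discriminant_squarefree[OF assms(1) q(1)] assms(1) by unfold_locales
  show ?thesis by (rule class_number_le)
qed

end
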